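(* Let $d,m,n\ge1$ be integers and let $A$ be a linear differential (or pseudo-differential) operator with constant coefficients, with symbol matrix $M(\xi)\in\mathbb{C}^{n\times m}$, $\xi\in\mathbb{R}^d$. Suppose that $M(\xi)$ admits a pseudo-inverse $M(\xi)^\dagger$ such that $M(\xi)M(\xi)^\dagger=\mathrm{Id}$ for all $\xi\in\mathbb{R}^d\setminus\{\xi:\xi_1\cdots\xi_d=0\}$. Suppose also that there exists $\rho<1$ such that for all $\mathbf j=(j_1,\dots,j_d)\in\mathbb{Z}^d$ there exists a matrix $M_{\omega_{\mathbf j}}\in\mathbb{R}^{n\times m}$ with $$\|\mathrm{Id}-M(\xi)M_{\omega_{\mathbf j}}^\dagger\|\le\rho\qquad\text{for all }\xi\in\prod_{i=1}^d\pm[2^{j_i}\pi,2^{j_i+1}\pi].$$ Then the preconditioned Richardson iteration on wavelet coefficients $$\underline{\mathbf u}_0=0,\qquad \underline{\mathbf u}_p=\underline{\mathbf u}_{p-1}+\underline{D}^{-1}\big(\underline{\mathbf v}-\underline{A}\,\underline{\mathbf u}_{p-1}\big)\quad(p\ge1)$$ for the equation $A\mathbf u=\mathbf v$, using the tensorial Shannon wavelet decomposition and with $\underline{D}^{-1}$ the preconditioner that applies $M_{\omega_{\mathbf j}}^\dagger$ to the coefficients of level $\mathbf j$, converges.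
   Context: Symbol: $\widehat{A\mathbf u}(\xi)=M(\xi)\widehat{\mathbf u}(\xi)$. The operator $A$ is assumed continuous from $(H^{t/2}(\mathbb{R}^d))^m$ to $(H^{-t/2}(\mathbb{R}^d))^n$, where $H^s$ is the Sobolev space of distributions $f$ with $(1+|\xi|^2)^{s/2}\widehat f\in L^2$. $N^\dagger$ denotes the pseudo-inverse of a matrix $N$. $\|\cdot\|$ is the operator norm on matrices. $\pm[a,b]$ means $[-b,-a]\cup[a,b]$. Shannon wavelet: $\widehat\psi(\xi)=e^{-i\xi/2}\chi_{[-2\pi,-\pi]\cup[\pi,2\pi]}(\xi)$, $\psi_{jk}(x)=2^{j/2}\psi(2^jx-k)$. The tensorial wavelets of level $\mathbf j\in\mathbb{Z}^d$ are the products $\psi_{j_1k_1}(x_1)\cdots\psi_{j_dk_d}(x_d)$, $\mathbf k\in\mathbb{Z}^d$. Their Fourier transforms are supported in $\prod_i\pm[2^{j_i}\pi,2^{j_i+1}\pi]$. Vector functions are decomposed componentwise in this basis. $\underline{\mathbf v}$ and $\underline{\mathbf u}_p$ are the vectors of wavelet coefficients of $\mathbf v$ and of the $p$-th iterate. $\underline{A}$ is the matrix of $A$ in the wavelet basis (entries are the pairings of $A$ applied to a wavelet with a dual wavelet). For each level $\mathbf j$ and each $\mathbf k$, $\underline{D}^{-1}$ multiplies the vector of the $n$ component coefficients by the constant matrix $M_{\omega_{\mathbf j}}^\dagger$. Meaning of "converges": there is a constant $r<1$ such that, for all $p\ge1$, $\|\underline{\mathbf v}-\underline{A}\,\underline{\mathbf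 u}_p\|_{\ell^2_{-t/2}}\le r\,\|\underline{\mathbf v}-\underline{A}\,\underline{\mathbf u}_{p-1}\|_{\ell^2_{-t/2}}$. Here $\|\cdot\|_{\ell^2_s}^2$ is the sum of the squared moduli of the coefficients, those of level $\mathbf j$ being weighted by $2^{2s\max(j_1,\dots,j_d)}$. *)

theory Defs
  imports "HOL-Analysis.Analysis"
begin

section \<open>Fourier transform and tempered distributions\<close>

definition fourier :: "('a::euclidean_space \<Rightarrow> complex) \<Rightarrow> 'a \<Rightarrow> complex" where
  "fourier f \<xi> = (LINT x|lborel. exp (- \<i> * complex_of_real (x \<bullet> \<xi>)) * f x)"

definition inverse_fourier :: "('a::euclidean_space \<Rightarrow> complex) \<Rightarrow> 'a \<Rightarrow> complex" where
  "inverse_fourier g x =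
     (LINT \<xi>|lborel. exp (\<i> * complex_of_real (x \<bullet> \<xi>)) * g \<xi>) / complex_of_real ((2 * pi) ^ DIM('a))"

primrec iterated_partial :: "'a list \<Rightarrow> ('a::euclidean_space \<Rightarrow> complex) \<Rightarrow> 'a \<Rightarrow> complex" where
  "iterated_partial [] f = f"
| "iterated_partial (b # bs) f = (\<lambda>x. frechet_derivative (iterated_partial bs f) (at x) b)"

definition schwartz :: "('a::euclidean_space \<Rightarrow> complex) \<Rightarrow> bool" where
  "schwartz \<phi> \<longleftrightarrow>
     (\<forall>bs. set bs \<subseteq> Basis \<longrightarrow>
        (\<forall>x. iterated_partial bs \<phi> differentiable (at x)) \<and>
        (\<forall>N::nat. bdd_above (range (\<lambda>x. (1 + norm x) ^ N * norm (iterated_partial bs \<phi> x)))))"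

definition schwartz_seminorm :: "nat \<Rightarrow> ('a::euclidean_space \<Rightarrow> complex) \<Rightarrow> real" where
  "schwartz_seminorm N \<phi> =
     (\<Sum>bs | set bs \<subseteq> Basis \<and> length bs \<le> N.
        SUP x. (1 + norm x) ^ N * norm (iterated_partial bs \<phi> x))"

text \<open>A distribution is represented by a functional on all functions, of which only the values at
  Schwartz functions matter; two functionals that agree there stand for the same distribution.\<close>

type_synonym 'a distribution = "('a \<Rightarrow> complex) \<Rightarrow> complex"

definition tempered :: "('a::euclidean_space) distribution \<Rightarrow> bool" where
  "tempered T \<longleftrightarrow>
     (\<forall>\<phi> \<theta> a b. schwartz \<phi> \<longrightarrow> schwartz \<theta> \<longrightarrow>
        T (\<lambda>x. a * \<phi> x + b * \<theta> x) = a * T \<phi> + b * T \<theta>) \<and>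
     (\<exists>C N. \<forall>\<phi>. schwartz \<phi> \<longrightarrow> norm (T \<phi>) \<le> C * schwartz_seminorm N \<phi>)"

definition distribution_of :: "('a::euclidean_space \<Rightarrow> complex) \<Rightarrow> 'a distribution" where
  "distribution_of f = (\<lambda>\<phi>. LINT x|lborel. f x * \<phi> x)"

text \<open>The Fourier transform of \<open>T\<close> is the distribution \<open>\<lambda>\<phi>. T (fourier \<phi>)\<close>; here it is required
  to be the function \<open>g\<close>. Such a \<open>g\<close> is unique up to null sets.\<close>

definition is_fourier_of :: "('a::euclidean_space) distribution \<Rightarrow> ('a \<Rightarrow> complex) \<Rightarrow> bool" where
  "is_fourier_of T g \<longleftrightarrow> g \<in> borel_measurable lborel \<and>
     (\<forall>\<phi>. schwartz \<phi> \<longrightarrow>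
        integrable lborel (\<lambda>\<xi>. g \<xi> * \<phi> \<xi>) \<and> T (fourier \<phi>) = distribution_of g \<phi>)"

definition dist_fourier :: "('a::euclidean_space) distribution \<Rightarrow> 'a \<Rightarrow> complex" where
  "dist_fourier T = (SOME g. is_fourier_of T g)"

section \<open>Sobolev spaces\<close>

definition sobolev :: "real \<Rightarrow> ('a::euclidean_space) distribution set" where
  "sobolev s = {T. tempered T \<and> (\<exists>g. is_fourier_of T g) \<and>
     integrable lborel (\<lambda>\<xi>. (norm ((1 + (norm \<xi>)\<^sup>2) powr (s / 2) *\<^sub>R dist_fourier T \<xi>))\<^sup>2)}"

definition sobolev_norm :: "real \<Rightarrow> ('a::euclidean_space) distribution \<Rightarrow> real" where
  "sobolev_norm s T =
     sqrt (LINT \<xi>|lborel. (norm ((1 + (norm \<xi>)\<^sup>2) powr (s / 2) *\<^sub>R dist_fourier T \<xi>))\<^sup>2)"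

definition sobolev_vec :: "real \<Rightarrow> (('a::euclidean_space) distribution ^ 'm) set" where
  "sobolev_vec s = {u. \<forall>i. u $ i \<in> sobolev s}"

definition sobolev_norm_vec :: "real \<Rightarrow> ('a::euclidean_space) distribution ^ 'm \<Rightarrow> real" where
  "sobolev_norm_vec s u = sqrt (\<Sum>i\<in>UNIV. (sobolev_norm s (u $ i))\<^sup>2)"

definition dist_fourier_vec :: "('a::euclidean_space) distribution ^ 'm \<Rightarrow> 'a \<Rightarrow> complex ^ 'm" where
  "dist_fourier_vec u \<xi> = (\<chi> i. dist_fourier (u $ i) \<xi>)"

text \<open>The duality pairing of \<open>H\<^sup>s\<close> and \<open>H\<^sup>-\<^sup>s\<close> that extends the \<open>L\<^sup>2\<close> inner product (conjugate-linear
  in the second argument), by Plancherel for the above normalisation of the Fourier transform.\<close>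

definition pairing :: "('a::euclidean_space) distribution \<Rightarrow> 'a distribution \<Rightarrow> complex" where
  "pairing S T =
     (LINT \<xi>|lborel. dist_fourier S \<xi> * cnj (dist_fourier T \<xi>)) / complex_of_real ((2 * pi) ^ DIM('a))"

section \<open>Operators with constant coefficients\<close>

text \<open>\<open>A\<close> is a continuous operator from \<open>(H\<^sup>t\<^sup>/\<^sup>2)\<^sup>m\<close> to \<open>(H\<^sup>-\<^sup>t\<^sup>/\<^sup>2)\<^sup>n\<close> with symbol \<open>M\<close>. Linearity (up to
  equality of distributions) follows from the action on the Fourier side.\<close>

definition operator_with_symbol ::
    "real \<Rightarrow> (real ^ 'd \<Rightarrow> complex ^ 'm ^ 'n) \<Rightarrow>
     ((real ^ 'd) distribution ^ 'm \<Rightarrow> (real ^ 'd) distribution ^ 'n) \<Rightarrow> bool" where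
  "operator_with_symbol t M A \<longleftrightarrow>
     (\<forall>u \<in> sobolev_vec (t / 2).
        A u \<in> sobolev_vec (- t / 2) \<and>
        (AE \<xi> in lborel. dist_fourier_vec (A u) \<xi> = M \<xi> *v dist_fourier_vec u \<xi>)) \<and>
     (\<exists>C. \<forall>u \<in> sobolev_vec (t / 2).
        sobolev_norm_vec (- t / 2) (A u) \<le> C * sobolev_norm_vec (t / 2) u)"

section \<open>The pseudo-inverse\<close>

definition conj_transpose :: "complex ^ 'm ^ 'n \<Rightarrow> complex ^ 'n ^ 'm" where
  "conj_transpose N = (\<chi> i j. cnj (N $ j $ i))"

text \<open>The four Penrose conditions.\<close>

definition is_pseudo_inverse :: "complex ^ 'm ^ 'n \<Rightarrow> complex ^ 'n ^ 'm \<Rightarrow> bool" where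
  "is_pseudo_inverse N X \<longleftrightarrow>
     N ** X ** N = N \<and> X ** N ** X = X \<and>
     conj_transpose (N ** X) = N ** X \<and> conj_transpose (X ** N) = X ** N"

definition pseudo_inverse :: "complex ^ 'm ^ 'n \<Rightarrow> complex ^ 'n ^ 'm" where
  "pseudo_inverse N = (THE X. is_pseudo_inverse N X)"

lemma conj_transpose_mult:
  "conj_transpose (N ** X) = conj_transpose X ** conj_transpose N"
  by (simp add: conj_transpose_def matrix_matrix_mult_def vec_eq_iff mult.commute)

lemma is_pseudo_inverse_unique:
  assumes X: "is_pseudo_inverse N X" and Y: "is_pseudo_inverse N Y"
  shows "X = Y"
proof -
  have left: "N ** U = N ** V" if U: "is_pseudo_inverse N U" and V: "is_pseudo_inverse N V" for U V
  proof -
    have "N ** U = (N ** V) ** (N ** U)"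
      using V by (simp add: is_pseudo_inverse_def matrix_mul_assoc)
    also have "\<dots> = conj_transpose ((N ** U) ** (N ** V))"
      using U V by (simp add: is_pseudo_inverse_def conj_transpose_mult[of "N ** U" "N ** V"])
    also have "\<dots> = conj_transpose (N ** V)"
      using U by (simp add: is_pseudo_inverse_def matrix_mul_assoc)
    finally show ?thesis using V by (simp add: is_pseudo_inverse_def)
  qed
  have right: "X ** N = Y ** N"
  proof -
    have "X ** N = (X ** N) ** (Y ** N)"
      using Y by (simp add: is_pseudo_inverse_def matrix_mul_assoc[symmetric])
    also have "\<dots> = conj_transpose ((Y ** N) ** (X ** N))"
      using X Y by (simp add: is_pseudo_inverse_def conj_transpose_mult[of "Y ** N" "X ** N"])
    also have "\<dots> = conj_transpose (Y ** N)"
      using X by (simp add: is_pseudo_inverse_def matrix_mul_assoc[symmetric])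
    finally show ?thesis using Y by (simp add: is_pseudo_inverse_def)
  qed
  have "X = X ** (N ** X)" using X by (simp add: is_pseudo_inverse_def matrix_mul_assoc)
  also have "\<dots> = X ** (N ** Y)" using left[OF X Y] by simp
  also have "\<dots> = X ** N ** Y" by (simp add: matrix_mul_assoc)
  also have "\<dots> = Y ** N ** Y" by (simp add: right)
  finally show ?thesis using Y by (simp add: is_pseudo_inverse_def)
qed

lemma pseudo_inverse_eqI: "is_pseudo_inverse N X \<Longrightarrow> pseudo_inverse N = X"
  unfolding pseudo_inverse_def by (blast intro: is_pseudo_inverse_unique)

definition complex_matrix :: "real ^ 'm ^ 'n \<Rightarrow> complex ^ 'm ^ 'n" where
  "complex_matrix N = (\<chi> i j. complex_of_real (N $ i $ j))"

definition matrix_norm :: "complex ^ 'm ^ 'n \<Rightarrow> real" where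
  "matrix_norm N = onorm (\<lambda>x. N *v x)"

section \<open>Tensorial Shannon wavelets\<close>

definition shannon_hat :: "real \<Rightarrow> complex" where
  "shannon_hat \<xi> = exp (- \<i> * complex_of_real \<xi> / 2) * indicator ({- 2 * pi .. - pi} \<union> {pi .. 2 * pi}) \<xi>"

definition shannon :: "real \<Rightarrow> complex" where
  "shannon = inverse_fourier shannon_hat"

definition shannon_wavelet :: "int \<Rightarrow> int \<Rightarrow> real \<Rightarrow> complex" where
  "shannon_wavelet j k x =
     complex_of_real (2 powr (real_of_int j / 2)) * shannon (2 powr real_of_int j * x - real_of_int k)"

definition tensor_wavelet :: "int ^ 'd \<Rightarrow> int ^ 'd \<Rightarrow> real ^ 'd \<Rightarrow> complex" where
  "tensor_wavelet j k x = (\<Prod>i\<in>UNIV. shannon_wavelet (j $ i) (k $ i) (x $ i))"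

definition frequency_box :: "int ^ 'd \<Rightarrow> (real ^ 'd) set" where
  "frequency_box j = {\<xi>. \<forall>i. \<xi> $ i \<in>
     {- (2 powr real_of_int (j $ i + 1) * pi) .. - (2 powr real_of_int (j $ i) * pi)} \<union>
     {2 powr real_of_int (j $ i) * pi .. 2 powr real_of_int (j $ i + 1) * pi}}"

section \<open>Richardson iteration on wavelet coefficients\<close>

text \<open>Families of coefficients are indexed by pairs of a level \<open>j\<close> and a position \<open>k\<close>; the \<open>n\<close>
  component coefficients are grouped into a vector. Correspondingly the matrix of an operator is
  made of \<open>n \<times> m\<close> blocks. The Shannon wavelets are orthonormal, so they are their own duals.\<close>

type_synonym 'd wavelet_index = "(int ^ 'd) \<times> (int ^ 'd)"

definition wavelet_dist :: "('d::finite) wavelet_index \<Rightarrow> (real ^ 'd) distribution" where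
  "wavelet_dist q = distribution_of (tensor_wavelet (fst q) (snd q))"

definition wavelet_coeffs ::
    "(real ^ 'd) distribution ^ 'n \<Rightarrow> ('d::finite) wavelet_index \<Rightarrow> complex ^ 'n" where
  "wavelet_coeffs v q = (\<chi> a. pairing (v $ a) (wavelet_dist q))"

definition unit_dist_vec :: "'m \<Rightarrow> ('a::euclidean_space) distribution \<Rightarrow> 'a distribution ^ 'm" where
  "unit_dist_vec b T = (\<chi> b'. if b' = b then T else (\<lambda>\<phi>. 0))"

definition wavelet_matrix ::
    "((real ^ 'd) distribution ^ 'm \<Rightarrow> (real ^ 'd) distribution ^ 'n) \<Rightarrow>
     ('d::finite) wavelet_index \<Rightarrow> 'd wavelet_index \<Rightarrow> complex ^ 'm ^ 'n" where
  "wavelet_matrix A q q' =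
     (\<chi> a b. pairing (A (unit_dist_vec b (wavelet_dist q')) $ a) (wavelet_dist q))"

definition apply_wavelet_matrix ::
    "((real ^ 'd) distribution ^ 'm \<Rightarrow> (real ^ 'd) distribution ^ 'n) \<Rightarrow>
     (('d::finite) wavelet_index \<Rightarrow> complex ^ 'm) \<Rightarrow> 'd wavelet_index \<Rightarrow> complex ^ 'n" where
  "apply_wavelet_matrix A c q = (\<Sum>\<^sub>\<infinity>q'. wavelet_matrix A q q' *v c q')"

definition preconditioner ::
    "(int ^ 'd \<Rightarrow> real ^ 'm ^ 'n) \<Rightarrow>
     (('d::finite) wavelet_index \<Rightarrow> complex ^ 'n) \<Rightarrow> 'd wavelet_index \<Rightarrow> complex ^ 'm" where
  "preconditioner M\<omega> c q = pseudo_inverse (complex_matrix (M\<omega> (fst q))) *v c q"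

definition residual ::
    "((real ^ 'd) distribution ^ 'm \<Rightarrow> (real ^ 'd) distribution ^ 'n) \<Rightarrow>
     (real ^ 'd) distribution ^ 'n \<Rightarrow>
     (('d::finite) wavelet_index \<Rightarrow> complex ^ 'm) \<Rightarrow> 'd wavelet_index \<Rightarrow> complex ^ 'n" where
  "residual A v c = (\<lambda>q. wavelet_coeffs v q - apply_wavelet_matrix A c q)"

primrec richardson ::
    "((real ^ 'd) distribution ^ 'm \<Rightarrow> (real ^ 'd) distribution ^ 'n) \<Rightarrow>
     (int ^ 'd \<Rightarrow> real ^ 'm ^ 'n) \<Rightarrow> (real ^ 'd) distribution ^ 'n \<Rightarrow>
     nat \<Rightarrow> ('d::finite) wavelet_index \<Rightarrow> complex ^ 'm" where
  "richardson A M\<omega> v 0 = (\<lambda>q. 0)"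
| "richardson A M\<omega> v (Suc p) =
     (\<lambda>q. richardson A M\<omega> v p q + preconditioner M\<omega> (residual A v (richardson A M\<omega> v p)) q)"

text \<open>The value is \<open>\<infinity>\<close> outside of the weighted \<open>\<ell>\<^sup>2\<close> space.\<close>

definition weighted_sq :: "real \<Rightarrow> (('d::finite) wavelet_index \<Rightarrow> complex ^ 'n) \<Rightarrow> 'd wavelet_index \<Rightarrow> real" where
  "weighted_sq s c q =
     2 powr (2 * s * real_of_int (Max (range (\<lambda>i. fst q $ i)))) * (\<Sum>a\<in>UNIV. (cmod (c q $ a))\<^sup>2)"

definition l2_norm :: "real \<Rightarrow> (('d::finite) wavelet_index \<Rightarrow> complex ^ 'n) \<Rightarrow> ennreal" where
  "l2_norm s c =
     (if weighted_sq s c summable_on UNIV then ennreal (sqrt (\<Sum>\<^sub>\<infinity>q. weighted_sq s c q)) else \<infinity>)"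

end

theory Submission
  imports Defs "HOL-Probability.Probability"
begin

text \<open>The tensorial Shannon wavelets of one level are, on the Fourier side, the trigonometric system on
  the frequency box of that level, and the boxes of different levels overlap only in null sets. Hence
  the wavelet matrix is block diagonal, each block is multiplication by the symbol on a box, and a
  step of the iteration multiplies the Fourier transform of the residual on the box of level \<open>j\<close> by
  \<open>1 - M(\<xi>) M\<^sub>\<omega>\<^sup>\<dagger>\<close>, of norm at most \<open>\<rho>\<close>. By Parseval on each box the residual decreases level by
  level, whatever the weights are. The analytic input is Fourier inversion on Schwartz functions
  (which identifies the Fourier transforms of the wavelets as distributions), uniqueness of the
  density of a distribution, and completeness of the trigonometric system; the last two both follow
  from the Stone-Weierstrass theorem through a monotone class argument.\<close>

section \<open>Bounded Borel functions from polynomials\<close>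

text \<open>The product of the wavelet matrix with an iterate is an infinite sum over positions, so
  its convergence has to be shown at every step. What controls it is the product \<open>M P\<close>,
  where \<open>P\<close> is the pseudo-inverse attached to the level: the contraction hypothesis
  bounds its entries by 1 + \<rho>. The proof therefore keeps the invariant that on level
  \<open>j\<close> an iterate is \<open>P\<close> applied to the coefficients of a square-integrable
  function \<open>W\<close>. Then \<open>A\<close> acts on it as multiplication of \<open>W\<close>
  by \<open>M P\<close>, the residual comes from the function R = V - M P W, with V the transform of
  the data, and the update replaces \<open>W\<close> by W + R. The norm takes values in
  [0, \<infinity>], and where the old residual has infinite norm the inequality is trivial;
  otherwise summability is transferred from the old residual to the new one along with the estimate.
  The function \<open>dist_fourier\<close> is a choice among functions that agree almost everywhere,
  so identities on the frequency side hold only almost everywhere.\<close>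

lemma bounded_borel_poly_induct [consumes 3, case_names poly add cmult lim]:
  fixes P :: "('e::euclidean_space \<Rightarrow> real) \<Rightarrow> bool" and h :: "'e \<Rightarrow> real"
  assumes K: "compact K"
    and h: "h \<in> borel_measurable borel" "\<And>x. \<bar>h x\<bar> \<le> B"
    and poly: "\<And>p. real_polynomial_function p \<Longrightarrow> P p"
    and add: "\<And>f g. P f \<Longrightarrow> P g \<Longrightarrow> P (\<lambda>x. f x + g x)"
    and cmult: "\<And>f c. P f \<Longrightarrow> P (\<lambda>x. c * f x)"
    and lim: "\<And>F f C. (\<And>n::nat. P (F n)) \<Longrightarrow> (\<And>n. F n \<in> borel_measurable borel) \<Longrightarrow>
        f \<in> borel_measurable borel \<Longrightarrow> (\<And>n x. x \<in> K \<Longrightarrow> \<bar>F n x\<bar> \<le> C) \<Longrightarrow>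
        (\<And>x. x \<in> K \<Longrightarrow> (\<lambda>n. F n x) \<longlonglongrightarrow> f x) \<Longrightarrow> P f"
  shows "P h"
proof -
  have const: "P (\<lambda>x. c)" for c by (intro poly) auto
  \<comment> \<open>Polynomials approximate a continuous function uniformly only on the compact set
    \<open>K\<close>, so \<open>lim\<close> asks for bounds and convergence on \<open>K\<close>
    alone. This suits properties that see a function only through its values on \<open>K\<close>,
    such as integrals of its composite with a map into \<open>K\<close>.\<close>
  have cont: "P f" if f: "continuous_on UNIV f" for f
  proof -
    have fK: "continuous_on K f" using f continuous_on_subset by blast
    then have "bounded (f ` K)" using K compact_continuous_image compact_imp_bounded by blast
    then obtain C where C: "\<And>x. x \<in> K \<Longrightarrow> \<bar>f x\<bar> \<le> C" by (auto simp: bounded_iff)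
    have "\<exists>p. real_polynomial_function p \<and> (\<forall>x\<in>K. \<bar>f x - p x\<bar> < 1 / real (Suc n))" for n
      by (rule Stone_Weierstrass_real_polynomial_function[OF K fK, of "1 / real (Suc n)"]) auto
    then obtain p where p: "\<And>n. real_polynomial_function (p n)"
      and pf: "\<And>n x. x \<in> K \<Longrightarrow> \<bar>f x - p n x\<bar> < 1 / real (Suc n)" by metis
    show ?thesis
    proof (rule lim[of p f "C + 1"])
      show "P (p n)" for n using p poly by blast
      show "p n \<in> borel_measurable borel" for n
        by (intro borel_measurable_continuous_onI continuous_on_polymonial_function)
           (use p real_polynomial_function_eq in blast)
      show "f \<in> borel_measurable borel" using f by (rule borel_measurable_continuous_onI)
      fix x assume x: "x \<in> K"
      show "\<bar>p n x\<bar> \<le> C + 1" for n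
      proof -
        have "1 / real (Suc n) \<le> 1" by simp
        then show ?thesis using pf[OF x, of n] C[OF x] by linarith
      qed
      have "(\<lambda>n. p n x - f x) \<longlonglongrightarrow> 0"
        by (rule Lim_null_comparison[OF _ LIMSEQ_inverse_real_of_nat])
           (use pf[OF x] in \<open>auto simp: inverse_eq_divide abs_minus_commute intro!: always_eventually less_imp_le\<close>)
      then show "(\<lambda>n. p n x) \<longlonglongrightarrow> f x" by (simp add: LIM_zero_iff)
    qed
  qed
  have closed: "P (indicator S)" if S: "closed S" for S
  proof (cases "S = {}")
    case True
    then have "(indicator S :: 'e \<Rightarrow> real) = (\<lambda>x. 0)" by auto
    then show ?thesis using const[of 0] by simp
  next
    case False
    \<comment> \<open>Continuous tents that decrease to the indicator: off the closed set
      \<open>S\<close> the distance is positive, so the n-th tent vanishes there for large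
      n.\<close>
    let ?F = "\<lambda>n x. max 0 (1 - real n * infdist x S)"
    have c: "continuous_on UNIV (?F n)" for n by (intro continuous_intros)
    show ?thesis
    proof (rule lim[of ?F _ 1])
      show "P (?F n)" for n using c by (rule cont)
      show "?F n \<in> borel_measurable borel" for n using c by (rule borel_measurable_continuous_onI)
      show "(indicator S :: 'e \<Rightarrow> real) \<in> borel_measurable borel" using S by auto
      show "\<bar>?F n x\<bar> \<le> 1" for n x by (auto simp: infdist_nonneg)
      fix x
      show "(\<lambda>n. ?F n x) \<longlonglongrightarrow> indicator S x"
      proof (cases "x \<in> S")
        case False
        then have pos: "infdist x S > 0"
          using S \<open>S \<noteq> {}\<close> in_closed_iff_infdist_zero infdist_nonneg by (metis less_eq_real_def)
        then obtain N where N: "1 < real N * infdist x S" using reals_Archimedean3 by blast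
        have "?F n x = 0" if "n \<ge> N" for n
        proof -
          have "real N * infdist x S \<le> real n * infdist x S"
            using that pos by (intro mult_right_mono) auto
          then show ?thesis using N by auto
        qed
        then have "\<forall>\<^sub>F n in sequentially. ?F n x = 0" by (auto simp: eventually_sequentially)
        then show ?thesis using False by (simp add: tendsto_eventually)
      qed (simp add: infdist_zero)
    qed
  qed
  have borel: "P (indicator S)" if "S \<in> sets borel" for S
  proof -
    \<comment> \<open>Dynkin's theorem: closed sets are stable under intersection and generate the
      Borel sets, so complements and countable disjoint unions suffice.\<close>
    have "Int_stable (Collect closed :: 'e set set)" "Collect closed \<subseteq> Pow (UNIV :: 'e set)"
        "S \<in> sigma_sets UNIV (Collect closed)"
      using that by (auto simp: Int_stable_def borel_eq_closed)
    then show ?thesis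
    proof (induction rule: sigma_sets_induct_disjoint)
      case (basic A) then show ?case using closed by simp
    next
      case empty
      have "(indicator {} :: 'e \<Rightarrow> real) = (\<lambda>x. 0)" by auto
      then show ?case using const[of 0] by simp
    next
      case (compl A)
      have "P (\<lambda>x. 1 + (-1) * indicator A x)" by (intro add const cmult compl)
      moreover have "(\<lambda>x. 1 + (-1) * indicator A x) = (indicator (UNIV - A) :: 'e \<Rightarrow> real)"
        by (auto simp: indicator_def)
      ultimately show ?case by simp
    next
      case (union A)
      have A: "A i \<in> sets borel" for i using union(2) by (auto simp: borel_eq_closed)
      have ind: "(\<Sum>i<n. indicator (A i) x) = (indicator (\<Union>i<n. A i) x :: real)" for n x
        by (rule indicator_UN_disjoint[symmetric])
           (use union(1) in \<open>auto intro: disjoint_family_on_mono\<close>)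
      show ?case
      proof (rule lim[of "\<lambda>n x. \<Sum>i<n. indicator (A i) x" _ 1])
        show "P (\<lambda>x. \<Sum>i<n. indicator (A i) x)" for n
        proof (induction n)
          case 0 then show ?case using const[of 0] by simp
        next
          case (Suc n) then show ?case using add[OF Suc union(3)[of n]] by simp
        qed
        show "(\<lambda>x. \<Sum>i<n. indicator (A i) x :: real) \<in> borel_measurable borel" for n using A by measurable
        show "(indicator (\<Union> (range A)) :: 'e \<Rightarrow> real) \<in> borel_measurable borel" using A by measurable
        show "\<bar>\<Sum>i<n. indicator (A i) x :: real\<bar> \<le> 1" for n x unfolding ind by simp
        show "(\<lambda>n. \<Sum>i<n. indicator (A i) x) \<longlonglongrightarrow> (indicator (\<Union> (range A)) x :: real)" for x
          unfolding ind by (rule LIMSEQ_indicator_UN)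
      qed
    qed
  qed
  \<comment> \<open>Adding \<open>B\<close> makes the function nonnegative, as the induction rule
    demands. Boundedness is carried as a premise because \<open>lim\<close> needs a uniform bound;
    it is inherited by nonnegative summands and by increasing approximants.\<close>
  have "(\<exists>C. \<forall>x. h x + B \<le> C) \<longrightarrow> P (\<lambda>x. h x + B)"
  proof (rule borel_measurable_induct_real[where M = borel and u = "\<lambda>x. h x + B"])
    show "(\<lambda>x. h x + B) \<in> borel_measurable borel" using h by measurable
    show "0 \<le> h x + B" for x using h(2)[of x] by linarith
    show "(\<exists>C. \<forall>x. indicator A x \<le> C) \<longrightarrow> P (indicator A)" if "A \<in> sets borel" for A
      using borel[OF that] by simp
  next
    fix u :: "'e \<Rightarrow> real" and c :: real
    assume c: "0 \<le> c" and *: "(\<exists>C. \<forall>x. u x \<le> C) \<longrightarrow> P u"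
    show "(\<exists>C. \<forall>x. c * u x \<le> C) \<longrightarrow> P (\<lambda>x. c * u x)"
    proof (cases "c = 0")
      case False
      then have "c > 0" using c by simp
      then have "u x \<le> C / c" if "c * u x \<le> C" for x C
        using that by (simp add: pos_le_divide_eq mult.commute)
      then show ?thesis using * cmult[of u c] by blast
    qed (use const[of 0] in simp)
  next
    fix u v :: "'e \<Rightarrow> real"
    assume "\<And>x. 0 \<le> u x" "(\<exists>C. \<forall>x. u x \<le> C) \<longrightarrow> P u" "\<And>x. 0 \<le> v x" "(\<exists>C. \<forall>x. v x \<le> C) \<longrightarrow> P v"
    moreover have "u x \<le> C" "v x \<le> C" if "\<And>x. v x + u x \<le> C" for x C
      using that[of x] \<open>0 \<le> u x\<close> \<open>0 \<le> v x\<close> by linarith+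
    ultimately show "(\<exists>C. \<forall>x. v x + u x \<le> C) \<longrightarrow> P (\<lambda>x. v x + u x)"
      using add by blast
  next
    fix U :: "nat \<Rightarrow> 'e \<Rightarrow> real"
    assume U: "\<And>i. U i \<in> borel_measurable borel" "\<And>i x. 0 \<le> U i x"
      and IH: "\<And>i. (\<exists>C. \<forall>x. U i x \<le> C) \<longrightarrow> P (U i)" and inc: "incseq U"
      and lm: "\<And>x. x \<in> space borel \<Longrightarrow> (\<lambda>i. U i x) \<longlonglongrightarrow> h x + B"
    show "(\<exists>C. \<forall>x. h x + B \<le> C) \<longrightarrow> P (\<lambda>x. h x + B)"
    proof
      assume "\<exists>C. \<forall>x. h x + B \<le> C"
      then obtain C where C: "\<And>x. h x + B \<le> C" by blast
      have le: "U i x \<le> C" for i x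
      proof -
        have "incseq (\<lambda>i. U i x)" using inc by (auto simp: mono_def le_fun_def)
        then show ?thesis using incseq_le[of "\<lambda>i. U i x" _ i] lm[of x] C[of x] by fastforce
      qed
      show "P (\<lambda>x. h x + B)"
      proof (rule lim[of U _ C])
        show "P (U n)" for n using IH le by blast
      qed (use U le lm h in \<open>auto simp: abs_of_nonneg\<close>)
    qed
  qed
  moreover have "h x + B \<le> B + B" for x using h(2)[of x] by linarith
  ultimately have "P (\<lambda>x. h x + B)" by blast
  from add[OF this const[of "-B"]] show ?thesis by simp
qed

section \<open>Decay of the Fourier transform of a Schwartz function\<close>

lemma
  fixes f :: "'a::euclidean_space \<Rightarrow> real \<Rightarrow> complex"
  assumes f: "\<And>b. b \<in> Basis \<Longrightarrow> integrable lborel (f b)"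
  shows integrable_lborel_prod: "integrable lborel (\<lambda>x. \<Prod>b\<in>Basis. f b (x \<bullet> b))"
    and integral_lborel_prod:
      "(LINT x|lborel. (\<Prod>b\<in>Basis. f b (x \<bullet> b))) = (\<Prod>b\<in>Basis. LINT t|lborel. f b t)"
proof -
  interpret product_sigma_finite "\<lambda>b::'a. lborel :: real measure" ..
  let ?N = "\<Pi>\<^sub>M b\<in>Basis. (lborel :: real measure)"
  have [measurable]: "f b \<in> borel_measurable borel" if "b \<in> Basis" for b
    using borel_measurable_integrable[OF f[OF that]] by simp
  have m: "(\<lambda>g. \<Sum>b\<in>Basis. g b *\<^sub>R b) \<in> ?N \<rightarrow>\<^sub>M (borel :: 'a measure)" by measurable
  have e: "(\<Prod>b\<in>Basis. f b ((\<Sum>c\<in>Basis. g c *\<^sub>R c) \<bullet> b)) = (\<Prod>b\<in>Basis. f b (g b))" for g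
    by (intro prod.cong) (auto simp: inner_sum_left_Basis)
  show "integrable lborel (\<lambda>x. \<Prod>b\<in>Basis. f b (x \<bullet> b))"
    by (subst lborel_eq, subst integrable_distr_eq[OF m])
       (simp_all add: e product_integrable_prod f)
  show "(LINT x|lborel. (\<Prod>b\<in>Basis. f b (x \<bullet> b))) = (\<Prod>b\<in>Basis. LINT t|lborel. f b t)"
    by (subst lborel_eq, subst integral_distr[OF m])
       (simp_all add: e product_integral_prod f)
qed

text \<open>One factor (1 + norm x)^2 for each coordinate dominates the one-dimensional weight 1 +
  t^2, whose inverse is integrable. This is the origin of the exponent \<open>2 * DIM('a)\<close>
  used from here on.\<close>

lemma decay_prod_bound:
  fixes x :: "'a::euclidean_space"
  shows "(\<Prod>b\<in>(Basis::'a set). 1 + (x \<bullet> b)\<^sup>2) \<le> (1 + norm x) ^ (2 * DIM('a))"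
proof -
  have "1 + (x \<bullet> b)\<^sup>2 \<le> (1 + norm x)\<^sup>2" if "b \<in> Basis" for b
  proof -
    have "(x \<bullet> b)\<^sup>2 \<le> (norm x)\<^sup>2" using Basis_le_norm[OF that, of x] by (simp add: abs_le_square_iff[symmetric])
    then show ?thesis by (simp add: power2_sum add_increasing2)
  qed
  then have "(\<Prod>b\<in>(Basis::'a set). 1 + (x \<bullet> b)\<^sup>2) \<le> (\<Prod>b\<in>(Basis::'a set). (1 + norm x)\<^sup>2)"
    by (intro prod_mono) auto
  then show ?thesis by (simp add: power_mult)
qed

lemma integrable_decay:
  fixes f :: "'a::euclidean_space \<Rightarrow> complex"
  assumes [measurable]: "f \<in> borel_measurable borel"
    and f: "\<And>x. (1 + norm x) ^ (2 * DIM('a)) * norm (f x) \<le> C"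
  shows "integrable lborel f"
proof -
  have "integrable lborel (\<lambda>t::real. inverse (1 + t\<^sup>2))"
    using integrable_inverse_1_plus_square by (simp add: set_integrable_def)
  then have 1: "integrable lborel (\<lambda>t::real. complex_of_real (inverse (1 + t\<^sup>2)))"
    by (rule integrable_of_real)
  have "integrable lborel (\<lambda>x::'a. \<Prod>b\<in>Basis. complex_of_real (inverse (1 + (x \<bullet> b)\<^sup>2)))"
    by (rule integrable_lborel_prod[OF 1])
  then have "integrable lborel (\<lambda>x::'a. complex_of_real C * (\<Prod>b\<in>Basis. complex_of_real (inverse (1 + (x \<bullet> b)\<^sup>2))))"
    by (rule integrable_mult_right)
  then show ?thesis
  proof (rule Bochner_Integration.integrable_bound, safe intro!: AE_I2)
    fix x :: 'a
    have C: "0 \<le> C" using f[of x] by (meson add_nonneg_nonneg mult_nonneg_nonneg norm_ge_zero order_trans zero_le_one zero_le_power)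
    have p: "0 < (\<Prod>b\<in>Basis. 1 + (x \<bullet> b)\<^sup>2)" by (intro prod_pos) (auto intro: add_pos_nonneg)
    have "(\<Prod>b\<in>Basis. 1 + (x \<bullet> b)\<^sup>2) * norm (f x) \<le> C"
      using mult_right_mono[OF decay_prod_bound[of x], of "norm (f x)"] f[of x] by simp
    then have "norm (f x) \<le> C * inverse (\<Prod>b\<in>Basis. 1 + (x \<bullet> b)\<^sup>2)"
      using p by (simp add: field_simps)
    also have "inverse (\<Prod>b\<in>Basis. 1 + (x \<bullet> b)\<^sup>2) = norm (\<Prod>b\<in>Basis. complex_of_real (inverse (1 + (x \<bullet> b)\<^sup>2)))"
      by (simp add: prod_norm[symmetric] prod_inversef[symmetric] norm_inverse del: of_real_inverse of_real_add)
    also have "C * \<dots> = norm (complex_of_real C * (\<Prod>b\<in>Basis. complex_of_real (inverse (1 + (x \<bullet> b)\<^sup>2))))"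
      using C by (simp add: norm_mult)
    finally show "norm (f x) \<le> norm (complex_of_real C * (\<Prod>b\<in>Basis. complex_of_real (inverse (1 + (x \<bullet> b)\<^sup>2))))" .
  qed simp
qed

lemma lborel_integral_affine:
  fixes f :: "'a::euclidean_space \<Rightarrow> complex"
  assumes [measurable]: "f \<in> borel_measurable borel" and c: "c \<noteq> 0"
  shows "(LINT x|lborel. f x) = \<bar>c\<bar> ^ DIM('a) *\<^sub>R (LINT x|lborel. f (t + c *\<^sub>R x))"
  by (subst lborel_affine[OF c, of t]) (simp add: integral_density integral_distr)

lemma lborel_integrable_affine:
  fixes f :: "'a::euclidean_space \<Rightarrow> complex"
  assumes f: "integrable lborel f" and c: "c \<noteq> 0"
  shows "integrable lborel (\<lambda>x. f (t + c *\<^sub>R x))"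
proof -
  have [measurable]: "f \<in> borel_measurable borel" using borel_measurable_integrable[OF f] by simp
  show ?thesis
  proof -
    have "integrable lborel (\<lambda>x. \<bar>c\<bar> ^ DIM('a) *\<^sub>R f (t + c *\<^sub>R x))"
      using f by (subst (asm) lborel_affine[OF c, of t]) (simp add: integrable_density integrable_distr_eq)
    from integrable_scaleR_right[OF this, of "1 / \<bar>c\<bar> ^ DIM('a)"] show ?thesis using c by simp
  qed
qed

text \<open>The difference quotients of \<open>f\<close> have integral zero by translation invariance.\<close>

lemma integral_directional_derivative_eq_0:
  fixes f :: "'a::euclidean_space \<Rightarrow> complex"
  assumes df: "\<And>x. (f has_derivative f' x) (at x)" and b: "norm b = 1"
    and f: "\<And>x. (1 + norm x) ^ (2 * DIM('a)) * norm (f x) \<le> C"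
    and f': "\<And>x. (1 + norm x) ^ (2 * DIM('a)) * norm (f' x b) \<le> C"
  shows "integrable lborel (\<lambda>x. f' x b)" "(LINT x|lborel. f' x b) = 0"
proof -
  let ?N = "2 * DIM('a)"
  define h where "h n = 1 / real (Suc n)" for n
  have h: "0 < h n" "h n \<le> 1" "h \<longlonglongrightarrow> 0" for n
    using LIMSEQ_inverse_real_of_nat by (auto simp: h_def[abs_def] inverse_eq_divide)
  define s where "s n x = (f (x + h n *\<^sub>R b) - f x) / complex_of_real (h n)" for n x
  have [measurable]: "f \<in> borel_measurable borel"
    by (intro borel_measurable_continuous_onI continuous_at_imp_continuous_on ballI has_derivative_continuous[OF df])
  have fi: "integrable lborel f" by (rule integrable_decay[OF _ f]) measurable
  have g: "((\<lambda>t. f (x + t *\<^sub>R b)) has_derivative (\<lambda>t. f' (x + u *\<^sub>R b) (t *\<^sub>R b))) (at u)" for x u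
    by (rule has_derivative_compose[OF _ df]) (auto intro!: derivative_eq_intros)
  have bl: "f' x (t *\<^sub>R b) = t *\<^sub>R f' x b" for x t
    using has_derivative_linear[OF df] by (rule linear_cmul)
  have s_lim: "(\<lambda>n. s n x) \<longlonglongrightarrow> f' x b" for x
  proof -
    have "((\<lambda>t. norm (f (x + t *\<^sub>R b) - f x - t *\<^sub>R f' x b) / norm t) \<longlongrightarrow> 0) (at 0)"
      using g[of x 0] unfolding has_derivative_at bl by simp
    moreover have "norm (f (x + t *\<^sub>R b) - f x - t *\<^sub>R f' x b) / norm t = norm ((f (x + t *\<^sub>R b) - f x) /\<^sub>R t - f' x b)"
      if "t \<noteq> 0" for t
    proof -
      have "(f (x + t *\<^sub>R b) - f x) /\<^sub>R t - f' x b = (f (x + t *\<^sub>R b) - f x - t *\<^sub>R f' x b) /\<^sub>R t"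
        using that by (simp add: scaleR_diff_right)
      then show ?thesis by (simp add: divide_inverse mult.commute)
    qed
    ultimately have "((\<lambda>t. norm ((f (x + t *\<^sub>R b) - f x) /\<^sub>R t - f' x b)) \<longlongrightarrow> 0) (at 0)"
      by (subst tendsto_cong[of _ "\<lambda>t. norm (f (x + t *\<^sub>R b) - f x - t *\<^sub>R f' x b) / norm t"])
         (auto simp: eventually_at_filter)
    then have "((\<lambda>t. (f (x + t *\<^sub>R b) - f x) /\<^sub>R t) \<longlongrightarrow> f' x b) (at 0)"
      by (simp add: tendsto_norm_zero_iff LIM_zero_iff)
    moreover have "filterlim h (at 0) sequentially"
      using h(3) less_imp_neq[OF h(1), THEN not_sym] by (auto simp: filterlim_at intro!: always_eventually)
    ultimately have "(\<lambda>n. (f (x + h n *\<^sub>R b) - f x) /\<^sub>R h n) \<longlonglongrightarrow> f' x b"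
      by (rule filterlim_compose)
    then show ?thesis by (simp add: s_def scaleR_conv_of_real divide_inverse mult.commute)
  qed
  have s_int: "(LINT x|lborel. s n x) = 0" for n
    unfolding s_def using lborel_integral_affine[of f 1 "h n *\<^sub>R b"] fi lborel_integrable_affine[OF fi, of 1 "h n *\<^sub>R b"]
    by (simp add: add.commute)
  \<comment> \<open>A bound uniform in n, for dominated convergence. The mean value inequality
    bounds the quotient by the derivative at x + u b with 0 < u < h n \<le> 1; then 1 + norm x is at
    most twice 1 + norm (x + u b), which costs the factor \<open>2 ^ ?N\<close>.\<close>
  have s_bound: "norm (s n x) * (1 + norm x) ^ ?N \<le> 2 ^ ?N * C" for n x
  proof -
    have "\<exists>u\<in>{0<..<h n}. norm (f (x + h n *\<^sub>R b) - f (x + 0 *\<^sub>R b)) \<le> norm (f' (x + u *\<^sub>R b) ((h n - 0) *\<^sub>R b))"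
      by (rule mvt_general[of 0 "h n" "\<lambda>t. f (x + t *\<^sub>R b)"])
         (use h g in \<open>auto intro!: continuous_at_imp_continuous_on has_derivative_continuous\<close>)
    then obtain u where u: "0 < u" "u < h n" and le: "norm (f (x + h n *\<^sub>R b) - f x) \<le> h n * norm (f' (x + u *\<^sub>R b) b)"
      using h(1)[of n] by (auto simp: bl)
    have 1: "norm (s n x) \<le> norm (f' (x + u *\<^sub>R b) b)"
      using le h(1)[of n] by (simp add: s_def norm_divide field_simps)
    have "norm x \<le> norm (x + u *\<^sub>R b) + norm (u *\<^sub>R b)" by (metis add_diff_cancel norm_triangle_ineq4)
    moreover have "norm (u *\<^sub>R b) = u" using u b by simp
    ultimately have "norm x \<le> norm (x + u *\<^sub>R b) + 1" using u h(2)[of n] by linarith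
    then have "1 + norm x \<le> 1 + (norm (x + u *\<^sub>R b) + 1)" by (rule add_left_mono)
    also have "\<dots> \<le> 2 * (1 + norm (x + u *\<^sub>R b))" by simp
    finally have "1 + norm x \<le> 2 * (1 + norm (x + u *\<^sub>R b))" .
    then have 2: "(1 + norm x) ^ ?N \<le> (2 * (1 + norm (x + u *\<^sub>R b))) ^ ?N"
      by (intro power_mono) auto
    have "norm (s n x) * (1 + norm x) ^ ?N \<le> norm (f' (x + u *\<^sub>R b) b) * (2 * (1 + norm (x + u *\<^sub>R b))) ^ ?N"
      using 1 2 by (intro mult_mono) auto
    also have "\<dots> = 2 ^ ?N * ((1 + norm (x + u *\<^sub>R b)) ^ ?N * norm (f' (x + u *\<^sub>R b) b))"
      by (simp add: power_mult_distrib del: distrib_left_numeral)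
    also have "\<dots> \<le> 2 ^ ?N * C" by (intro mult_left_mono f') auto
    finally show ?thesis .
  qed
  have pos: "0 < (1 + norm x) ^ ?N" for x :: 'a by (intro zero_less_power add_pos_nonneg) auto
  have w: "integrable lborel (\<lambda>x::'a. complex_of_real (2 ^ ?N * C / (1 + norm x) ^ ?N))"
  proof (rule integrable_decay)
    show "(1 + norm x) ^ ?N * norm (complex_of_real (2 ^ ?N * C / (1 + norm x) ^ ?N)) \<le> \<bar>2 ^ ?N * C\<bar>" for x :: 'a
      using pos[of x] unfolding norm_of_real by (simp add: abs_mult)
  qed measurable
  have D[measurable]: "(\<lambda>x. f' x b) \<in> borel_measurable borel"
    by (rule borel_measurable_LIMSEQ_metric[of s, OF _ s_lim]) (simp add: s_def[abs_def])
  have sm: "s n \<in> borel_measurable lborel" for n by (simp add: s_def[abs_def])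
  have *: "(\<lambda>n. LINT x|lborel. s n x) \<longlonglongrightarrow> (LINT x|lborel. f' x b)" "integrable lborel (\<lambda>x. f' x b)"
  proof -
    have nb: "norm (s n x) \<le> 2 ^ ?N * C / (1 + norm x) ^ ?N" for n x
      using s_bound[of n x] pos[of x] by (simp add: field_simps)
    have w': "integrable lborel (\<lambda>x::'a. 2 ^ ?N * C / (1 + norm x) ^ ?N)"
      using w by (simp only: complex_of_real_integrable_eq)
    show "(\<lambda>n. LINT x|lborel. s n x) \<longlonglongrightarrow> (LINT x|lborel. f' x b)"
      by (rule integral_dominated_convergence[OF _ sm w']) (use nb s_lim in auto)
    show "integrable lborel (\<lambda>x. f' x b)"
      by (rule integrable_dominated_convergence[of _ _ s, OF _ sm w']) (use nb s_lim in auto)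
  qed
  then show "integrable lborel (\<lambda>x. f' x b)" by simp
  show "(LINT x|lborel. f' x b) = 0" using *(1) by (simp add: s_int LIMSEQ_const_iff)
qed

section \<open>Schwartz functions, and the Fourier transforms of their derivatives\<close>

lemma iterated_partial_append:
  "iterated_partial bs (iterated_partial cs f) = iterated_partial (bs @ cs) f"
  by (induction bs) auto

lemma schwartz_iterated_partial:
  "schwartz \<phi> \<Longrightarrow> set cs \<subseteq> Basis \<Longrightarrow> schwartz (iterated_partial cs \<phi>)"
  unfolding schwartz_def iterated_partial_append by (metis Un_subset_iff set_append)

lemma schwartz_decay:
  assumes "schwartz \<phi>"
  obtains C where "0 < C" "\<And>x. (1 + norm x) ^ N * norm (\<phi> x) \<le> C"
proof -
  have "bdd_above (range (\<lambda>x. (1 + norm x) ^ N * norm (\<phi> x)))"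
    using assms unfolding schwartz_def by (metis empty_set empty_subsetI iterated_partial.simps(1))
  then obtain C where "\<And>x. (1 + norm x) ^ N * norm (\<phi> x) \<le> C" by (auto simp: bdd_above_def)
  then have "\<And>x. (1 + norm x) ^ N * norm (\<phi> x) \<le> max C 1" by (meson max.coboundedI1)
  then show ?thesis using that[of "max C 1"] by auto
qed

lemma schwartz_differentiable: "schwartz \<phi> \<Longrightarrow> \<phi> differentiable (at x)"
  unfolding schwartz_def by (metis empty_set empty_subsetI iterated_partial.simps(1))

lemma schwartz_continuous: "schwartz \<phi> \<Longrightarrow> continuous_on UNIV \<phi>"
  by (intro continuous_at_imp_continuous_on ballI differentiable_imp_continuous_within schwartz_differentiable)

lemma schwartz_measurable [measurable_dest]: "schwartz \<phi> \<Longrightarrow> \<phi> \<in> borel_measurable borel"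
  by (intro borel_measurable_continuous_onI schwartz_continuous)

lemma schwartz_integrable: "schwartz \<phi> \<Longrightarrow> integrable lborel \<phi>"
  by (rule schwartz_decay) (auto intro: integrable_decay schwartz_measurable)

lemma schwartz_bounded:
  assumes "schwartz \<phi>"
  obtains C where "0 < C" "\<And>x. norm (\<phi> x) \<le> C"
  by (rule schwartz_decay[OF assms, of 0]) auto

text \<open>Integration by parts: the product exp (- \<i> x \<bullet> \<xi>) * \<phi> x decays with
  its derivative, so its directional derivative has integral zero, and the product rule splits that
  integral into the two sides.\<close>

lemma fourier_partial:
  assumes \<phi>: "schwartz \<phi>" and b: "b \<in> Basis"
  shows "fourier (\<lambda>x. frechet_derivative \<phi> (at x) b) \<xi> = \<i> * complex_of_real (\<xi> \<bullet> b) * fourier \<phi> \<xi>"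
proof -
  let ?N = "2 * DIM('a)"
  let ?D = "\<lambda>x. frechet_derivative \<phi> (at x) b"
  have D: "schwartz ?D" using schwartz_iterated_partial[OF \<phi>, of "[b]"] b by simp
  let ?f' = "\<lambda>x h. exp (- \<i> * complex_of_real (x \<bullet> \<xi>)) * frechet_derivative \<phi> (at x) h
      - \<i> * complex_of_real (h \<bullet> \<xi>) * exp (- \<i> * complex_of_real (x \<bullet> \<xi>)) * \<phi> x"
  have der: "((\<lambda>x. exp (- \<i> * complex_of_real (x \<bullet> \<xi>)) * \<phi> x) has_derivative ?f' x) (at x)" for x
  proof -
    have 1: "(\<phi> has_derivative frechet_derivative \<phi> (at x)) (at x)"
      using schwartz_differentiable[OF \<phi>] by (simp add: frechet_derivative_works)
    have "bounded_linear (\<lambda>x. - \<i> * complex_of_real (x \<bullet> \<xi>))"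
      by (intro bounded_linear_intros bounded_linear_of_real bounded_linear_const_mult
          bounded_linear_compose[OF bounded_linear_of_real] bounded_linear_inner_left)
    then have "((\<lambda>x. - \<i> * complex_of_real (x \<bullet> \<xi>)) has_derivative (\<lambda>h. - \<i> * complex_of_real (h \<bullet> \<xi>))) (at x)"
      by (rule bounded_linear_imp_has_derivative)
    from has_derivative_compose[OF this DERIV_exp[unfolded has_field_derivative_def]]
    have 2: "((\<lambda>x. exp (- \<i> * complex_of_real (x \<bullet> \<xi>))) has_derivative
        (\<lambda>h. exp (- \<i> * complex_of_real (x \<bullet> \<xi>)) * (- \<i> * complex_of_real (h \<bullet> \<xi>)))) (at x)" .
    show ?thesis
      by (rule has_derivative_eq_rhs[OF has_derivative_mult[OF 2 1]]) (simp add: fun_eq_iff algebra_simps)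
  qed
  obtain C1 where C1: "0 < C1" "\<And>x. (1 + norm x) ^ ?N * norm (\<phi> x) \<le> C1" using schwartz_decay[OF \<phi>] by blast
  obtain C2 where C2: "0 < C2" "\<And>x. (1 + norm x) ^ ?N * norm (?D x) \<le> C2" using schwartz_decay[OF D] by blast
  let ?C = "C1 + C2 + norm \<xi> * C1"
  have 0: "(LINT x|lborel. ?f' x b) = 0"
  proof (rule integral_directional_derivative_eq_0[OF der])
    show "norm b = 1" using b by simp
    fix x
    show "(1 + norm x) ^ ?N * norm (exp (- \<i> * complex_of_real (x \<bullet> \<xi>)) * \<phi> x) \<le> ?C"
      using C1(1) C1(2)[of x] C2(1) by (simp add: norm_mult add_increasing2)
    have "norm (?f' x b) \<le> norm (?D x) + norm \<xi> * norm (\<phi> x)"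
    proof -
      have "norm (?f' x b) \<le> norm (exp (- \<i> * complex_of_real (x \<bullet> \<xi>)) * frechet_derivative \<phi> (at x) b)
         + norm (\<i> * complex_of_real (b \<bullet> \<xi>) * exp (- \<i> * complex_of_real (x \<bullet> \<xi>)) * \<phi> x)"
        by (rule norm_triangle_ineq4)
      also have "\<dots> = norm (?D x) + \<bar>b \<bullet> \<xi>\<bar> * norm (\<phi> x)" by (simp add: norm_mult)
      also have "\<bar>b \<bullet> \<xi>\<bar> \<le> norm \<xi>" using Basis_le_norm[OF b, of \<xi>] by (simp add: inner_commute)
      finally show ?thesis by (simp add: mult_right_mono)
    qed
    then have "(1 + norm x) ^ ?N * norm (?f' x b) \<le> (1 + norm x) ^ ?N * (norm (?D x) + norm \<xi> * norm (\<phi> x))"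
      by (rule mult_left_mono) simp
    also have "\<dots> = (1 + norm x) ^ ?N * norm (?D x) + norm \<xi> * ((1 + norm x) ^ ?N * norm (\<phi> x))"
      by (simp add: distrib_left mult.left_commute)
    also have "\<dots> \<le> C2 + norm \<xi> * C1" by (intro add_mono C2 mult_left_mono C1) auto
    finally show "(1 + norm x) ^ ?N * norm (?f' x b) \<le> ?C" using C1(1) by linarith
  qed
  have i1: "integrable lborel (\<lambda>x. exp (- \<i> * complex_of_real (x \<bullet> \<xi>)) * ?D x)"
    by (rule Bochner_Integration.integrable_bound[OF schwartz_integrable[OF D]])
       (use schwartz_measurable[OF D] in \<open>auto simp: norm_mult\<close>)
  have i2: "integrable lborel (\<lambda>x. exp (- \<i> * complex_of_real (x \<bullet> \<xi>)) * \<phi> x)"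
    by (rule Bochner_Integration.integrable_bound[OF schwartz_integrable[OF \<phi>]])
       (use schwartz_measurable[OF \<phi>] in \<open>auto simp: norm_mult\<close>)
  have "(LINT x|lborel. ?f' x b) = fourier ?D \<xi> - \<i> * complex_of_real (b \<bullet> \<xi>) * fourier \<phi> \<xi>"
    unfolding fourier_def using i1 i2 by (simp add: mult.assoc)
  then show ?thesis using 0 by (simp add: inner_commute)
qed

lemma fourier_iterated_partial:
  assumes "schwartz \<phi>" "b \<in> Basis"
  shows "fourier (iterated_partial (replicate N b) \<phi>) \<xi> = (\<i> * complex_of_real (\<xi> \<bullet> b)) ^ N * fourier \<phi> \<xi>"
proof (induction N)
  case (Suc N)
  have "schwartz (iterated_partial (replicate N b) \<phi>)"
    by (rule schwartz_iterated_partial[OF assms(1)]) (use assms(2) in auto)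
  from fourier_partial[OF this assms(2)] Suc show ?case by (simp add: mult.assoc)
qed simp

lemma norm_fourier_le: "norm (fourier f \<xi>) \<le> (LINT x|lborel. norm (f x))"
  unfolding fourier_def by (rule order_trans[OF integral_norm_bound]) (simp add: norm_mult)

lemma borel_measurable_fourier [measurable]:
  assumes [measurable]: "f \<in> borel_measurable borel"
  shows "fourier f \<in> borel_measurable borel"
  unfolding fourier_def[abs_def] by measurable

text \<open>Repeated differentiation along a single axis yields exactly the pure powers on the
  right; the largest coordinate shows that these already control the norm.\<close>

lemma one_plus_norm_power_le:
  fixes \<xi> :: "'a::euclidean_space"
  shows "(1 + norm \<xi>) ^ N \<le> (1 + DIM('a)) ^ N * (1 + (\<Sum>b\<in>Basis. \<bar>\<xi> \<bullet> b\<bar> ^ N))"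
proof -
  define m where "m = Max ((\<lambda>b. \<bar>\<xi> \<bullet> b\<bar>) ` Basis)"
  have le: "\<bar>\<xi> \<bullet> b\<bar> \<le> m" if "b \<in> Basis" for b unfolding m_def using that by (intro Max_ge) auto
  have "m \<in> (\<lambda>b. \<bar>\<xi> \<bullet> b\<bar>) ` Basis" unfolding m_def by (intro Max_in) auto
  then obtain c where c: "c \<in> Basis" "m = \<bar>\<xi> \<bullet> c\<bar>" by auto
  have "norm \<xi> \<le> (\<Sum>b\<in>Basis. \<bar>\<xi> \<bullet> b\<bar>)" by (rule norm_le_l1)
  also have "\<dots> \<le> DIM('a) * m" using sum_bounded_above[of Basis "\<lambda>b. \<bar>\<xi> \<bullet> b\<bar>" m] le by simp
  also have "\<dots> \<le> DIM('a) * max 1 m" by (intro mult_left_mono) auto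
  finally have "1 + norm \<xi> \<le> (1 + DIM('a)) * max 1 m" by (simp add: distrib_right)
  then have "(1 + norm \<xi>) ^ N \<le> ((1 + DIM('a)) * max 1 m) ^ N" by (intro power_mono) auto
  also have "\<dots> = (1 + DIM('a)) ^ N * (max 1 m) ^ N" by (simp add: power_mult_distrib)
  also have "(max 1 m) ^ N \<le> 1 + m ^ N" using c by (auto simp: max_def)
  also have "m ^ N \<le> (\<Sum>b\<in>Basis. \<bar>\<xi> \<bullet> b\<bar> ^ N)"
    unfolding c(2) by (rule member_le_sum[of c Basis "\<lambda>b. \<bar>\<xi> \<bullet> b\<bar> ^ N"]) (use c in auto)
  finally show ?thesis by simp
qed

text \<open>Derivatives of order \<open>2 * DIM('a)\<close> along each axis give decay of that
  order. Integrability is what the inversion formula and the exchanges of integrals below ask of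
  \<open>fourier \<phi>\<close>.\<close>

lemma fourier_schwartz_integrable:
  fixes \<phi> :: "'a::euclidean_space \<Rightarrow> complex"
  assumes \<phi>: "schwartz \<phi>"
  shows "integrable lborel (fourier \<phi>)"
proof -
  let ?N = "2 * DIM('a)"
  let ?I = "\<lambda>b. LINT x|lborel. norm (iterated_partial (replicate ?N b) \<phi> x)"
  let ?J = "LINT x|lborel. norm (\<phi> x)"
  show ?thesis
  proof (rule integrable_decay)
    show "fourier \<phi> \<in> borel_measurable borel" using schwartz_measurable[OF \<phi>] by measurable
    fix \<xi> :: 'a
    have b: "\<bar>\<xi> \<bullet> b\<bar> ^ ?N * norm (fourier \<phi> \<xi>) \<le> ?I b" if "b \<in> Basis" for b
      using norm_fourier_le[of "iterated_partial (replicate ?N b) \<phi>" \<xi>]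
      unfolding fourier_iterated_partial[OF \<phi> that] by (simp add: norm_mult norm_power)
    have "(1 + norm \<xi>) ^ ?N * norm (fourier \<phi> \<xi>)
        \<le> (1 + DIM('a)) ^ ?N * (1 + (\<Sum>b\<in>Basis. \<bar>\<xi> \<bullet> b\<bar> ^ ?N)) * norm (fourier \<phi> \<xi>)"
      by (intro mult_right_mono one_plus_norm_power_le) auto
    also have "\<dots> = (1 + DIM('a)) ^ ?N * (norm (fourier \<phi> \<xi>) + (\<Sum>b\<in>Basis. \<bar>\<xi> \<bullet> b\<bar> ^ ?N * norm (fourier \<phi> \<xi>)))"
      by (simp add: distrib_right sum_distrib_right mult.assoc)
    also have "\<dots> \<le> (1 + DIM('a)) ^ ?N * (?J + (\<Sum>b\<in>Basis. ?I b))"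
      by (intro mult_left_mono add_mono sum_mono b norm_fourier_le) auto
    finally show "(1 + norm \<xi>) ^ ?N * norm (fourier \<phi> \<xi>) \<le> (1 + DIM('a)) ^ ?N * (?J + (\<Sum>b\<in>Basis. ?I b))" .
  qed
qed

section \<open>Fourier inversion\<close>

text \<open>The characteristic function of the standard normal distribution, freed of the
  normalising factor of the density.\<close>

lemma fourier_gaussian_real:
  "(LINT t|lborel. iexp (t * s) * complex_of_real (exp (- t\<^sup>2 / 2)))
     = complex_of_real (sqrt (2 * pi) * exp (- s\<^sup>2 / 2))" (is "?I = _")
  and integrable_gaussian_real:
  "integrable lborel (\<lambda>t. iexp (t * s) * complex_of_real (exp (- t\<^sup>2 / 2)))"
proof -
  let ?f = "\<lambda>t. iexp (t * s) * complex_of_real (exp (- t\<^sup>2 / 2))"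
  have "integrable lborel (\<lambda>t. sqrt (2 * pi) * std_normal_density t)"
    using integrable_std_normal_moment[of 0] by simp
  moreover have "(\<lambda>t. sqrt (2 * pi) * std_normal_density t) = (\<lambda>t. exp (- t\<^sup>2 / 2))"
    by (simp add: std_normal_density_def fun_eq_iff)
  ultimately have g: "integrable lborel (\<lambda>t::real. exp (- t\<^sup>2 / 2))" by (simp only:)
  show "integrable lborel ?f"
    by (rule Bochner_Integration.integrable_bound[OF g]) (auto simp: norm_mult)
  have "char std_normal_distribution s = (LINT t|lborel. std_normal_density t *\<^sub>R iexp (s * t))"
    unfolding char_def by (subst integral_density) (auto simp: normal_density_nonneg)
  also have "\<dots> = (LINT t|lborel. complex_of_real (1 / sqrt (2 * pi)) * ?f t)"
    by (intro Bochner_Integration.integral_cong)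
       (auto simp: std_normal_density_def scaleR_conv_of_real mult_ac)
  also have "\<dots> = complex_of_real (1 / sqrt (2 * pi)) * ?I" by simp
  finally have "complex_of_real (1 / sqrt (2 * pi)) * ?I = complex_of_real (exp (- s\<^sup>2 / 2))"
    by (simp add: char_std_normal_distribution)
  then have "complex_of_real (sqrt (2 * pi)) * (complex_of_real (1 / sqrt (2 * pi)) * ?I)
      = complex_of_real (sqrt (2 * pi)) * complex_of_real (exp (- s\<^sup>2 / 2))" by simp
  then show "?I = complex_of_real (sqrt (2 * pi) * exp (- s\<^sup>2 / 2))"
    by (simp add: mult.assoc[symmetric])
qed

lemma
  fixes y :: "'a::euclidean_space"
  shows integrable_gaussian:
    "integrable lborel (\<lambda>x. iexp (x \<bullet> y) * complex_of_real (exp (- (norm x)\<^sup>2 / 2)))"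
    and fourier_gaussian:
    "(LINT x|lborel. iexp (x \<bullet> y) * complex_of_real (exp (- (norm x)\<^sup>2 / 2)))
      = complex_of_real (sqrt (2 * pi) ^ DIM('a) * exp (- (norm y)\<^sup>2 / 2))"
proof -
  let ?g = "\<lambda>b t. iexp (t * (y \<bullet> b)) * complex_of_real (exp (- t\<^sup>2 / 2))"
  have n: "(norm x)\<^sup>2 = (\<Sum>b\<in>Basis. (x \<bullet> b)\<^sup>2)" for x :: 'a
    unfolding power2_norm_eq_inner by (subst euclidean_inner) (simp add: power2_eq_square)
  have g: "exp (- (norm x)\<^sup>2 / 2) = (\<Prod>b\<in>Basis. exp (- (x \<bullet> b)\<^sup>2 / 2))" for x :: 'a
    by (simp add: n exp_sum[symmetric] sum_divide_distrib sum_negf)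
  have e: "iexp (x \<bullet> y) * complex_of_real (exp (- (norm x)\<^sup>2 / 2)) = (\<Prod>b\<in>Basis. ?g b (x \<bullet> b))" for x
    by (simp only: g prod.distrib of_real_prod)
       (simp add: euclidean_inner[of x y] exp_sum[symmetric] sum_distrib_left)
  show "integrable lborel (\<lambda>x. iexp (x \<bullet> y) * complex_of_real (exp (- (norm x)\<^sup>2 / 2)))"
    unfolding e by (intro integrable_lborel_prod integrable_gaussian_real)
  show "(LINT x|lborel. iexp (x \<bullet> y) * complex_of_real (exp (- (norm x)\<^sup>2 / 2)))
      = complex_of_real (sqrt (2 * pi) ^ DIM('a) * exp (- (norm y)\<^sup>2 / 2))"
    unfolding e by (subst integral_lborel_prod[OF integrable_gaussian_real])
      (simp only: fourier_gaussian_real, simp only: g of_real_mult prod.distrib of_real_prod prod_constant of_real_power)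
qed

lemma integrable_lborel_product:
  fixes f :: "'a::euclidean_space \<Rightarrow> complex" and g :: "'b::euclidean_space \<Rightarrow> complex"
  assumes f: "integrable lborel f" and g: "integrable lborel g"
    and [measurable]: "(F :: 'a \<times> 'b \<Rightarrow> complex) \<in> borel_measurable (lborel \<Otimes>\<^sub>M lborel)"
    and F: "\<And>x y. norm (F (x, y)) \<le> norm (f x) * norm (g y)"
  shows "integrable (lborel \<Otimes>\<^sub>M lborel) F"
proof -
  have [measurable]: "f \<in> borel_measurable borel" "g \<in> borel_measurable borel"
    using borel_measurable_integrable[OF f] borel_measurable_integrable[OF g] by auto
  have "integrable (lborel \<Otimes>\<^sub>M lborel) (\<lambda>(x, y). f x * g y)"
    by (rule lborel_pair.Fubini_integrable) (use f g in \<open>auto simp: norm_mult\<close>)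
  then show ?thesis
    by (rule Bochner_Integration.integrable_bound) (use F in \<open>auto simp: norm_mult\<close>)
qed

text \<open>A Gaussian factor of argument \<epsilon> x makes the double integral absolutely
  convergent, and Fubini turns it into an average of \<phi> around \<xi> against a Gaussian of width
  \<epsilon>. As \<epsilon> tends to 0, one form tends to the inversion integral because
  \<open>fourier \<phi>\<close> is integrable, the other to a multiple of
  \<open>\<phi> \<xi>\<close> by continuity. Of the two factors sqrt (2 pi)^d, one comes from the
  transform of the Gaussian and one from its total mass.\<close>

lemma fourier_inversion:
  fixes \<phi> :: "'a::euclidean_space \<Rightarrow> complex"
  assumes \<phi>: "schwartz \<phi>"
  shows "(LINT x|lborel. iexp (x \<bullet> \<xi>) * fourier \<phi> x) = complex_of_real ((2 * pi) ^ DIM('a)) * \<phi> \<xi>"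
proof -
  note [measurable] = schwartz_measurable[OF \<phi>]
  define \<epsilon> where "\<epsilon> n = 1 / real (Suc n)" for n
  have \<epsilon>: "0 < \<epsilon> n" "\<epsilon> \<longlonglongrightarrow> 0" for n
    using LIMSEQ_inverse_real_of_nat by (auto simp: \<epsilon>_def[abs_def] inverse_eq_divide)
  let ?s = "sqrt (2 * pi) ^ DIM('a)"
  let ?e = "\<lambda>x y::'a. iexp (x \<bullet> y)"
  let ?\<gamma> = "\<lambda>x::'a. complex_of_real (exp (- (norm x)\<^sup>2 / 2))"
  obtain B where B: "0 < B" "\<And>x. norm (\<phi> x) \<le> B" using schwartz_bounded[OF \<phi>] by blast
  have \<gamma>i: "integrable lborel ?\<gamma>" using integrable_gaussian[of 0] by simp
  define I where "I n = (LINT x|lborel. ?e x \<xi> * fourier \<phi> x * ?\<gamma> (\<epsilon> n *\<^sub>R x))" for n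
  have "I \<longlonglongrightarrow> (LINT x|lborel. ?e x \<xi> * fourier \<phi> x)"
    unfolding I_def
  proof (rule integral_dominated_convergence[where w = "\<lambda>x. norm (fourier \<phi> x)"])
    show "AE x in lborel. (\<lambda>n. ?e x \<xi> * fourier \<phi> x * ?\<gamma> (\<epsilon> n *\<^sub>R x)) \<longlonglongrightarrow> ?e x \<xi> * fourier \<phi> x"
    proof (rule AE_I2)
      fix x
      have "(\<lambda>n. ?e x \<xi> * fourier \<phi> x * ?\<gamma> (\<epsilon> n *\<^sub>R x)) \<longlonglongrightarrow> ?e x \<xi> * fourier \<phi> x * ?\<gamma> (0 *\<^sub>R x)"
        by (intro tendsto_intros \<epsilon>) auto
      then show "(\<lambda>n. ?e x \<xi> * fourier \<phi> x * ?\<gamma> (\<epsilon> n *\<^sub>R x)) \<longlonglongrightarrow> ?e x \<xi> * fourier \<phi> x" by simp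
    qed
    show "integrable lborel (\<lambda>x. norm (fourier \<phi> x))" by (rule integrable_norm[OF fourier_schwartz_integrable[OF \<phi>]])
    show "AE x in lborel. norm (?e x \<xi> * fourier \<phi> x * ?\<gamma> (\<epsilon> n *\<^sub>R x)) \<le> norm (fourier \<phi> x)" for n
      by (rule AE_I2) (simp add: norm_mult mult_left_le)
  qed measurable
  moreover have I: "I n = ?s * (LINT z|lborel. \<phi> (\<xi> + \<epsilon> n *\<^sub>R z) * ?\<gamma> z)" for n
  proof -
    let ?c = "\<epsilon> n"
    let ?k = "complex_of_real (?c ^ DIM('a))"
    have k: "?k \<noteq> 0" using \<epsilon>(1)[of n] by simp
    have abs_c: "\<bar>?c\<bar> = ?c" using \<epsilon>(1)[of n] by simp
    \<comment> \<open>The dilated Gaussian is transformed by substitution. Its Jacobian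
      \<open>?k\<close> later cancels against that of the substitution y = \<xi> + ?c z.\<close>
    have inner: "(LINT x|lborel. ?e x (\<xi> - y) * ?\<gamma> (?c *\<^sub>R x)) = complex_of_real ?s / ?k * ?\<gamma> ((1 / ?c) *\<^sub>R (y - \<xi>))" for y
    proof -
      have "(LINT x|lborel. ?e x ((1 / ?c) *\<^sub>R (\<xi> - y)) * ?\<gamma> x)
          = \<bar>?c\<bar> ^ DIM('a) *\<^sub>R (LINT x|lborel. ?e (0 + ?c *\<^sub>R x) ((1 / ?c) *\<^sub>R (\<xi> - y)) * ?\<gamma> (0 + ?c *\<^sub>R x))"
      proof (rule lborel_integral_affine)
        show "?c \<noteq> 0" using \<epsilon>(1)[of n] by simp
      qed measurable
      also have "(\<lambda>x. ?e (0 + ?c *\<^sub>R x) ((1 / ?c) *\<^sub>R (\<xi> - y)) * ?\<gamma> (0 + ?c *\<^sub>R x)) = (\<lambda>x. ?e x (\<xi> - y) * ?\<gamma> (?c *\<^sub>R x))"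
      proof -
        have "(0 + ?c *\<^sub>R x) \<bullet> ((1 / ?c) *\<^sub>R (\<xi> - y)) = x \<bullet> (\<xi> - y)" for x
          using \<epsilon>(1)[of n] by simp
        then show ?thesis by (simp only: add_0_left)
      qed
      also have "\<bar>?c\<bar> ^ DIM('a) *\<^sub>R (LINT x|lborel. ?e x (\<xi> - y) * ?\<gamma> (?c *\<^sub>R x)) = ?k * (LINT x|lborel. ?e x (\<xi> - y) * ?\<gamma> (?c *\<^sub>R x))"
        by (simp only: scaleR_conv_of_real abs_c)
      finally have "?k * (LINT x|lborel. ?e x (\<xi> - y) * ?\<gamma> (?c *\<^sub>R x)) = ?s * ?\<gamma> ((1 / ?c) *\<^sub>R (\<xi> - y))"
        by (simp only: fourier_gaussian of_real_mult)
      moreover have "?\<gamma> ((1 / ?c) *\<^sub>R (\<xi> - y)) = ?\<gamma> ((1 / ?c) *\<^sub>R (y - \<xi>))"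
        unfolding norm_scaleR by (simp only: norm_minus_commute)
      moreover have "X = a / ?k * g" if "?k * X = a * g" for X a g :: complex
        using k by (simp add: that[symmetric])
      ultimately show ?thesis by (simp only:)
    qed
    let ?F = "\<lambda>x y. ?e x \<xi> * (exp (- \<i> * complex_of_real (y \<bullet> x)) * \<phi> y) * ?\<gamma> (?c *\<^sub>R x)"
    have "integrable lborel (\<lambda>x. ?\<gamma> (?c *\<^sub>R x))"
      using lborel_integrable_affine[OF \<gamma>i, of ?c 0] \<epsilon>(1)[of n] by simp
    then have Fi: "integrable (lborel \<Otimes>\<^sub>M lborel) (case_prod ?F)"
      by (rule integrable_lborel_product[OF _ schwartz_integrable[OF \<phi>]]) (auto simp: norm_mult)
    have "I n = (LINT x|lborel. LINT y|lborel. ?F x y)"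
      unfolding I_def fourier_def
      by (simp only: integral_mult_right_zero integral_mult_left_zero)
    also have "\<dots> = (LINT y|lborel. LINT x|lborel. ?F x y)"
      by (rule lborel_pair.Fubini_integral[OF Fi, symmetric])
    also have "\<dots> = (LINT y|lborel. \<phi> y * (LINT x|lborel. ?e x (\<xi> - y) * ?\<gamma> (?c *\<^sub>R x)))"
    proof -
      have "?F x y = \<phi> y * (?e x (\<xi> - y) * ?\<gamma> (?c *\<^sub>R x))" for x y
      proof -
        have "?e x (\<xi> - y) = ?e x \<xi> * exp (- \<i> * complex_of_real (y \<bullet> x))"
          unfolding exp_add[symmetric] by (simp add: inner_diff_right right_diff_distrib inner_commute)
        then show ?thesis by (simp only: mult_ac)
      qed
      then show ?thesis by (simp only: integral_mult_right_zero)
    qed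
    also have "\<dots> = (LINT y|lborel. \<phi> y * (?s / ?k * ?\<gamma> ((1 / ?c) *\<^sub>R (y - \<xi>))))"
      unfolding inner ..
    also have "\<dots> = \<bar>?c\<bar> ^ DIM('a) *\<^sub>R (LINT z|lborel. \<phi> (\<xi> + ?c *\<^sub>R z) * (?s / ?k * ?\<gamma> ((1 / ?c) *\<^sub>R ((\<xi> + ?c *\<^sub>R z) - \<xi>))))"
    proof (rule lborel_integral_affine)
      show "?c \<noteq> 0" using \<epsilon>(1)[of n] by simp
    qed measurable
    also have "(\<lambda>z. \<phi> (\<xi> + ?c *\<^sub>R z) * (?s / ?k * ?\<gamma> ((1 / ?c) *\<^sub>R ((\<xi> + ?c *\<^sub>R z) - \<xi>))))
        = (\<lambda>z. (?s / ?k) * (\<phi> (\<xi> + ?c *\<^sub>R z) * ?\<gamma> z))"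
    proof -
      have "(1 / ?c) *\<^sub>R ((\<xi> + ?c *\<^sub>R z) - \<xi>) = z" for z
        using \<epsilon>(1)[of n] by simp
      then show ?thesis by (simp only: mult.left_commute)
    qed
    also have "(LINT z|lborel. (?s / ?k) * (\<phi> (\<xi> + ?c *\<^sub>R z) * ?\<gamma> z)) = (?s / ?k) * (LINT z|lborel. \<phi> (\<xi> + ?c *\<^sub>R z) * ?\<gamma> z)"
      by (rule integral_mult_right_zero)
    also have "\<bar>?c\<bar> ^ DIM('a) *\<^sub>R \<dots> = ?k * \<dots>" by (simp only: scaleR_conv_of_real abs_c)
    also have "\<dots> = ?s * (LINT z|lborel. \<phi> (\<xi> + ?c *\<^sub>R z) * ?\<gamma> z)"
    proof -
      have "?k * (a / ?k * b) = a * b" for a b :: complex using k by simp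
      then show ?thesis .
    qed
    finally show ?thesis .
  qed
  moreover have "(\<lambda>n. LINT z|lborel. \<phi> (\<xi> + \<epsilon> n *\<^sub>R z) * ?\<gamma> z) \<longlonglongrightarrow> (LINT z|lborel. \<phi> \<xi> * ?\<gamma> z)"
  proof (rule integral_dominated_convergence[where w = "\<lambda>x. B * norm (?\<gamma> x)"])
    show "AE z in lborel. (\<lambda>n. \<phi> (\<xi> + \<epsilon> n *\<^sub>R z) * ?\<gamma> z) \<longlonglongrightarrow> \<phi> \<xi> * ?\<gamma> z"
    proof (rule AE_I2)
      fix z
      have "isCont \<phi> \<xi>" using schwartz_differentiable[OF \<phi>] by (rule differentiable_imp_continuous_within)
      moreover
      have "(\<lambda>n. \<xi> + \<epsilon> n *\<^sub>R z) \<longlonglongrightarrow> \<xi> + 0 *\<^sub>R z" by (intro tendsto_intros \<epsilon>)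
      then have "(\<lambda>n. \<xi> + \<epsilon> n *\<^sub>R z) \<longlonglongrightarrow> \<xi>" by simp
      ultimately have "(\<lambda>n. \<phi> (\<xi> + \<epsilon> n *\<^sub>R z)) \<longlonglongrightarrow> \<phi> \<xi>" by (rule isCont_tendsto_compose)
      then show "(\<lambda>n. \<phi> (\<xi> + \<epsilon> n *\<^sub>R z) * ?\<gamma> z) \<longlonglongrightarrow> \<phi> \<xi> * ?\<gamma> z" by (intro tendsto_intros)
    qed
    show "AE z in lborel. norm (\<phi> (\<xi> + \<epsilon> n *\<^sub>R z) * ?\<gamma> z) \<le> B * norm (?\<gamma> z)" for n
      unfolding norm_mult by (intro AE_I2 mult_right_mono B) auto
    show "integrable lborel (\<lambda>x. B * norm (?\<gamma> x))" using \<gamma>i by (intro integrable_mult_right integrable_norm)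
  qed measurable
  then have "I \<longlonglongrightarrow> ?s * (LINT z|lborel. \<phi> \<xi> * ?\<gamma> z)"
    unfolding I[abs_def] by (rule tendsto_mult_left)
  moreover have "(LINT z|lborel. \<phi> \<xi> * ?\<gamma> z) = \<phi> \<xi> * ?s"
    using fourier_gaussian[of "0::'a"] by simp
  ultimately have "(LINT x|lborel. ?e x \<xi> * fourier \<phi> x) = ?s * (\<phi> \<xi> * ?s)"
    by (simp only:) (rule LIMSEQ_unique)
  also have "\<dots> = complex_of_real ((2 * pi) ^ DIM('a)) * \<phi> \<xi>"
  proof -
    have "?s * ?s = (2 * pi) ^ DIM('a)" unfolding power_mult_distrib[symmetric] by simp
    then have "complex_of_real ((2 * pi) ^ DIM('a)) = complex_of_real ?s * complex_of_real ?s"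
      by (simp only: of_real_mult[symmetric])
    then show ?thesis by (simp only: mult_ac)
  qed
  finally show ?thesis .
qed

section \<open>Functions orthogonal to all Schwartz functions\<close>

text \<open>The algebra generated by the coordinates and the Gaussian. It is closed under
  directional derivatives and grows at most polynomially, so one further Gaussian factor makes every
  member a Schwartz function; and it is large enough to contain all polynomials in the components of
  the map \<open>\<Psi>\<close> used below.\<close>

inductive gauss_poly :: "('a::euclidean_space \<Rightarrow> real) \<Rightarrow> bool" where
  const: "gauss_poly (\<lambda>x. c)"
| gauss: "gauss_poly (\<lambda>x. exp (- (x \<bullet> x)))"
| coord: "gauss_poly (\<lambda>x. x \<bullet> b)"
| add: "gauss_poly p \<Longrightarrow> gauss_poly q \<Longrightarrow> gauss_poly (\<lambda>x. p x + q x)"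
| mult: "gauss_poly p \<Longrightarrow> gauss_poly q \<Longrightarrow> gauss_poly (\<lambda>x. p x * q x)"

lemma gauss_poly_sum: "finite I \<Longrightarrow> (\<And>i. i \<in> I \<Longrightarrow> gauss_poly (f i)) \<Longrightarrow> gauss_poly (\<lambda>x. \<Sum>i\<in>I. f i x)"
  by (induction I rule: finite_induct) (auto intro: gauss_poly.intros)

lemma gauss_poly_derivative:
  assumes "gauss_poly q"
  shows "\<exists>D. (\<forall>x. (q has_derivative D x) (at x)) \<and> (\<forall>b. gauss_poly (\<lambda>x. D x b))"
  using assms
proof induction
  case (const c)
  show ?case by (rule exI[of _ "\<lambda>x h. 0"]) (auto intro: gauss_poly.intros)
next
  case gauss
  have "((\<lambda>x. exp (- (x \<bullet> x))) has_derivative (\<lambda>h. exp (- (x \<bullet> x)) * (- 2 * (x \<bullet> h)))) (at x)" for x :: 'a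
    by (auto intro!: derivative_eq_intros simp: inner_commute algebra_simps)
  moreover have "gauss_poly (\<lambda>x::'a. exp (- (x \<bullet> x)) * (- 2 * (x \<bullet> b)))" for b
    by (intro gauss_poly.intros)
  ultimately show ?case by (intro exI[of _ "\<lambda>x h. exp (- (x \<bullet> x)) * (- 2 * (x \<bullet> h))"] conjI allI)
next
  case (coord b)
  have "((\<lambda>x. x \<bullet> b) has_derivative (\<lambda>h. h \<bullet> b)) (at x)" for x :: 'a
    by (auto intro!: derivative_eq_intros)
  moreover have "gauss_poly (\<lambda>x::'a. c \<bullet> b)" for c by (rule gauss_poly.const)
  ultimately show ?case by (intro exI[of _ "\<lambda>x h. h \<bullet> b"] conjI allI)
next
  case (add p q)
  then obtain D E where "\<And>x. (p has_derivative D x) (at x)" "\<And>b. gauss_poly (\<lambda>x. D x b)"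
    "\<And>x. (q has_derivative E x) (at x)" "\<And>b. gauss_poly (\<lambda>x. E x b)" by blast
  then show ?case
    by (intro exI[of _ "\<lambda>x h. D x h + E x h"]) (auto intro: gauss_poly.add has_derivative_add)
next
  case (mult p q)
  then obtain D E where "\<And>x. (p has_derivative D x) (at x)" "\<And>b. gauss_poly (\<lambda>x. D x b)"
    "\<And>x. (q has_derivative E x) (at x)" "\<And>b. gauss_poly (\<lambda>x. E x b)" by blast
  then show ?case using mult.hyps
    by (intro exI[of _ "\<lambda>x h. p x * E x h + D x h * q x"]) (auto intro!: gauss_poly.add gauss_poly.mult has_derivative_mult)
qed

lemma gauss_poly_growth:
  assumes "gauss_poly q"
  shows "\<exists>C N. 0 \<le> C \<and> (\<forall>x. \<bar>q x\<bar> \<le> C * (1 + norm x) ^ N)"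
  using assms
proof induction
  case (const c)
  show ?case by (intro exI[of _ "\<bar>c\<bar>"] exI[of _ 0]) auto
next
  case gauss
  show ?case by (intro exI[of _ 1] exI[of _ 0]) auto
next
  case (coord b)
  have "\<bar>x \<bullet> b\<bar> \<le> norm b * (1 + norm x) ^ 1" for x :: 'a
    using Cauchy_Schwarz_ineq2[of x b] by (simp add: distrib_left mult.commute add_increasing)
  then show ?case using norm_ge_zero[of b] by blast
next
  case (add p q)
  then obtain C N D M where *: "0 \<le> C" "\<And>x. \<bar>p x\<bar> \<le> C * (1 + norm x) ^ N" "0 \<le> D" "\<And>x. \<bar>q x\<bar> \<le> D * (1 + norm x) ^ M"
    by blast
  have "\<bar>p x + q x\<bar> \<le> (C + D) * (1 + norm x) ^ (N + M)" for x
  proof -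
    have "C * (1 + norm x) ^ N \<le> C * (1 + norm x) ^ (N + M)" "D * (1 + norm x) ^ M \<le> D * (1 + norm x) ^ (N + M)"
      by (intro mult_left_mono power_increasing *; simp)+
    then show ?thesis using *(2)[of x] *(4)[of x] unfolding distrib_right by linarith
  qed
  then show ?case using *(1,3) by (metis add_nonneg_nonneg)
next
  case (mult p q)
  then obtain C N D M where *: "0 \<le> C" "\<And>x. \<bar>p x\<bar> \<le> C * (1 + norm x) ^ N" "0 \<le> D" "\<And>x. \<bar>q x\<bar> \<le> D * (1 + norm x) ^ M"
    by blast
  have "\<bar>p x * q x\<bar> \<le> (C * D) * (1 + norm x) ^ (N + M)" for x
  proof -
    have "\<bar>p x\<bar> * \<bar>q x\<bar> \<le> (C * (1 + norm x) ^ N) * (D * (1 + norm x) ^ M)"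
      using * by (intro mult_mono) auto
    then show ?thesis by (simp add: abs_mult power_add mult_ac)
  qed
  then show ?case using *(1,3) by (metis mult_nonneg_nonneg)
qed

text \<open>The term r^(2 k) / k! of the exponential series of r^2 gives the factorial; the power of
  2 comes from 1 + r \<le> 2 max 1 r.\<close>

lemma one_plus_power_exp_bound:
  fixes r :: real
  assumes "0 \<le> r"
  shows "(1 + r) ^ k * exp (- r\<^sup>2) \<le> 2 ^ k * (1 + fact k)"
proof -
  have "(1 + r) ^ k \<le> (2 * max 1 r) ^ k" using assms by (intro power_mono) auto
  also have "\<dots> = 2 ^ k * (max 1 r) ^ k" by (simp add: power_mult_distrib)
  also have "(max 1 r) ^ k \<le> 1 + r ^ (2 * k)"
  proof (cases "r \<le> 1")
    case False
    then have "r ^ k \<le> r ^ (2 * k)" by (intro power_increasing) auto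
    then have "r ^ k \<le> 1 + r ^ (2 * k)" by linarith
    then show ?thesis using False by (auto simp: max_def)
  qed (use assms in \<open>auto simp: max_def\<close>)
  also have "r ^ (2 * k) \<le> fact k * exp (r\<^sup>2)"
  proof -
    have "(\<Sum>n\<in>{k}. inverse (fact n) * (r\<^sup>2) ^ n) \<le> (\<Sum>n. inverse (fact n) * (r\<^sup>2) ^ n)"
      by (intro sum_le_suminf) (use summable_exp[of "r\<^sup>2"] in auto)
    then have "inverse (fact k) * (r\<^sup>2) ^ k \<le> exp (r\<^sup>2)" by (simp add: exp_def scaleR_conv_of_real)
    then have "(r\<^sup>2) ^ k \<le> fact k * exp (r\<^sup>2)" by (simp add: field_simps)
    then show ?thesis by (simp only: power_mult)
  qed
  finally have "(1 + r) ^ k * exp (- r\<^sup>2) \<le> 2 ^ k * (1 + fact k * exp (r\<^sup>2)) * exp (- r\<^sup>2)"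
    by (intro mult_right_mono) auto
  also have "\<dots> = 2 ^ k * (exp (- r\<^sup>2) + fact k)"
    by (simp add: distrib_left distrib_right exp_minus field_simps)
  also have "\<dots> \<le> 2 ^ k * (1 + fact k)" by (intro mult_left_mono add_right_mono) auto
  finally show ?thesis .
qed

lemma frechet_derivative_of_real:
  assumes "(q has_derivative D) (at x)"
  shows "frechet_derivative (\<lambda>x. complex_of_real (q x)) (at x) b = complex_of_real (D b)"
proof -
  have "((\<lambda>x. complex_of_real (q x)) has_derivative (\<lambda>h. complex_of_real (D h))) (at x)"
    using assms by (rule has_derivative_of_real)
  from frechet_derivative_at[OF this] show ?thesis by metis
qed

text \<open>The derivative of the Gaussian times a member of the algebra is again the Gaussian times
  a member. So every iterated derivative has the same shape, and one growth bound covers them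
  all.\<close>

lemma schwartz_gauss_poly:
  assumes q: "gauss_poly q"
  shows "schwartz (\<lambda>x. complex_of_real (exp (- (x \<bullet> x)) * q x))"
proof -
  let ?f = "\<lambda>q x. complex_of_real (exp (- (x \<bullet> x)) * q x)"
  have der: "\<exists>r. gauss_poly r \<and> (\<lambda>x. frechet_derivative (?f q) (at x) b) = ?f r"
    if q: "gauss_poly q" for q b
  proof -
    obtain D where D: "\<And>x. (q has_derivative D x) (at x)" "\<And>b. gauss_poly (\<lambda>x. D x b)"
      using gauss_poly_derivative[OF q] by blast
    have "((\<lambda>x. exp (- (x \<bullet> x)) * q x) has_derivative (\<lambda>h. exp (- (x \<bullet> x)) * (D x h + (- 2) * (x \<bullet> h) * q x))) (at x)" for x
      by (auto intro!: derivative_eq_intros D(1) simp: inner_commute algebra_simps)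
    from frechet_derivative_of_real[OF this]
    have "(\<lambda>x. frechet_derivative (?f q) (at x) b) = ?f (\<lambda>x. D x b + (- 2) * (x \<bullet> b) * q x)" by simp
    moreover have "gauss_poly (\<lambda>x. D x b + (- 2) * (x \<bullet> b) * q x)"
      by (intro gauss_poly.intros D q)
    ultimately show ?thesis by blast
  qed
  have it: "\<exists>r. gauss_poly r \<and> iterated_partial bs (?f q) = ?f r" for bs
  proof (induction bs)
    case (Cons b bs) then show ?case using der by fastforce
  qed (use q in auto)
  have diff: "?f r differentiable (at x)" if r: "gauss_poly r" for r and x :: 'a
  proof -
    obtain D where "\<And>x. (r has_derivative D x) (at x)"
      using gauss_poly_derivative[OF r] by blast
    then have "r differentiable (at x)" by (auto simp: differentiable_def)
    moreover have "(\<lambda>x::'a. exp (- (x \<bullet> x))) differentiable (at x)"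
      unfolding differentiable_def by (rule exI) (rule derivative_eq_intros refl)+
    ultimately have "(\<lambda>x. exp (- (x \<bullet> x)) * r x) differentiable (at x)" by (rule differentiable_mult[rotated])
    then obtain E where "((\<lambda>x. exp (- (x \<bullet> x)) * r x) has_derivative E) (at x)"
      by (auto simp: differentiable_def)
    then have "(?f r has_derivative (\<lambda>h. complex_of_real (E h))) (at x)" by (rule has_derivative_of_real)
    then show ?thesis unfolding differentiable_def by blast
  qed
  have bdd: "bdd_above (range (\<lambda>x. (1 + norm x) ^ N * norm (?f r x)))" if r: "gauss_poly r" for r N
  proof -
    obtain C M where C: "0 \<le> C" "\<And>x. \<bar>r x\<bar> \<le> C * (1 + norm x) ^ M" using gauss_poly_growth[OF r] by blast
    have "(1 + norm x) ^ N * norm (?f r x) \<le> C * (2 ^ (N + M) * (1 + fact (N + M)))" for x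
    proof -
      have "(1 + norm x) ^ N * norm (?f r x) = (1 + norm x) ^ N * (exp (- (x \<bullet> x)) * \<bar>r x\<bar>)"
        by (simp add: norm_mult)
      also have "\<dots> \<le> (1 + norm x) ^ N * (exp (- (x \<bullet> x)) * (C * (1 + norm x) ^ M))"
        by (intro mult_left_mono C) auto
      also have "\<dots> = C * ((1 + norm x) ^ (N + M) * exp (- (norm x)\<^sup>2))"
        by (simp add: power_add power2_norm_eq_inner mult_ac)
      also have "\<dots> \<le> C * (2 ^ (N + M) * (1 + fact (N + M)))"
        by (intro mult_left_mono one_plus_power_exp_bound C) auto
      finally show ?thesis .
    qed
    then show ?thesis by (auto simp: bdd_above_def)
  qed
  show ?thesis
    unfolding schwartz_def
  proof (intro allI impI conjI)
    fix bs :: "'a list"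
    obtain r where r: "gauss_poly r" "iterated_partial bs (?f q) = ?f r" using it by blast
    show "iterated_partial bs (?f q) differentiable (at x)" for x unfolding r(2) using diff[OF r(1)] .
    show "bdd_above (range (\<lambda>x. (1 + norm x) ^ N * norm (iterated_partial bs (?f q) x)))" for N
      unfolding r(2) using bdd[OF r(1)] .
  qed
qed

text \<open>The map \<open>\<Psi> y = (w, w y)\<close> with \<open>w = exp (- y\<^sup>2)\<close> embeds the space into a compact set; polynomials in
  \<open>\<Psi>\<close>, multiplied by \<open>w\<close>, are Schwartz functions.\<close>

lemma AE_eq_0_if_schwartz_integrals_eq_0:
  fixes g :: "'a::euclidean_space \<Rightarrow> complex"
  assumes [measurable]: "g \<in> borel_measurable borel"
    and g: "\<And>\<phi>. schwartz \<phi> \<Longrightarrow> integrable lborel (\<lambda>x. g x * \<phi> x) \<and> (LINT x|lborel. g x * \<phi> x) = 0"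
  shows "AE x in lborel. g x = 0"
proof -
  define w :: "'a \<Rightarrow> real" where "w x = exp (- (x \<bullet> x))" for x
  define G where "G x = g x * complex_of_real (w x)" for x
  define \<Psi> where "\<Psi> x = (w x, w x *\<^sub>R x)" for x
  have [measurable]: "w \<in> borel_measurable borel" unfolding w_def[abs_def] by measurable
  have [measurable]: "G \<in> borel_measurable borel" unfolding G_def[abs_def] by measurable
  have [measurable]: "\<Psi> \<in> borel \<rightarrow>\<^sub>M borel" unfolding \<Psi>_def[abs_def] borel_prod[symmetric] by measurable
  have Gq: "integrable lborel (\<lambda>x. G x * complex_of_real (q x))" "(LINT x|lborel. G x * complex_of_real (q x)) = 0"
    if "gauss_poly q" for q
    using g[OF schwartz_gauss_poly[OF that]] by (simp_all add: G_def w_def mult.assoc)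
  have Gi: "integrable lborel G" using Gq[OF gauss_poly.const[of 1]] by simp
  \<comment> \<open>Both components have norm at most 1, the second because norm x \<le> 1 + (norm
    x)^2 \<le> exp ((norm x)^2).\<close>
  have \<Psi>K: "\<Psi> x \<in> cball 0 2" for x
  proof -
    have w1: "0 < w x" "w x \<le> 1" by (auto simp: w_def)
    have "norm x \<le> 1 + (norm x)\<^sup>2" using zero_le_power2[of "norm x - 1"] by (simp add: power2_diff) (smt (verit) norm_ge_zero)
    also have "\<dots> \<le> exp ((norm x)\<^sup>2)" by (rule exp_ge_add_one_self)
    finally have "w x * norm x \<le> 1" by (simp add: w_def exp_minus power2_norm_eq_inner field_simps)
    then have "norm (w x *\<^sub>R x) \<le> 1" using w1 by simp
    moreover have "norm (w x) \<le> 1" using w1 by simp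
    moreover have "norm (w x, w x *\<^sub>R x) \<le> norm (w x) + norm (w x *\<^sub>R x)" by (rule norm_Pair_le)
    ultimately show ?thesis by (simp add: \<Psi>_def)
  qed
  let ?P = "\<lambda>h. integrable lborel (\<lambda>x. G x * complex_of_real (h (\<Psi> x))) \<and> (LINT x|lborel. G x * complex_of_real (h (\<Psi> x))) = 0"
  have P: "?P h" if h: "h \<in> borel_measurable borel" "\<And>p. \<bar>h p\<bar> \<le> 1" for h :: "real \<times> 'a \<Rightarrow> real"
    using compact_cball[of 0 2] h
  proof (induction h rule: bounded_borel_poly_induct)
    case (poly p)
    then have "gauss_poly (\<lambda>x. p (\<Psi> x))"
    proof induction
      case (linear f)
      have "f (\<Psi> x) = exp (- (x \<bullet> x)) * (f (1, 0) + (\<Sum>b\<in>Basis. (x \<bullet> b) * f (0, b)))" for x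
      proof -
        interpret bounded_linear f by fact
        have "\<Psi> x = w x *\<^sub>R ((1, 0) + (\<Sum>b\<in>Basis. (x \<bullet> b) *\<^sub>R (0, b)))"
          by (simp add: \<Psi>_def scaleR_prod_def prod_eq_iff fst_sum snd_sum euclidean_representation)
        then show ?thesis
          by (simp only: scaleR add sum w_def real_scaleR_def)
      qed
      moreover have "gauss_poly (\<lambda>x::'a. exp (- (x \<bullet> x)) * (f (1, 0) + (\<Sum>b\<in>Basis. (x \<bullet> b) * f (0, b))))"
        by (intro gauss_poly.intros gauss_poly_sum) auto
      ultimately show ?case by simp
    qed (auto intro: gauss_poly.intros)
    then show ?case using Gq by blast
  next
    case (add h k) then show ?case by (simp add: distrib_left)
  next
    case (cmult h c)
    have "(\<lambda>x. G x * complex_of_real (c * h (\<Psi> x))) = (\<lambda>x. complex_of_real c * (G x * complex_of_real (h (\<Psi> x))))"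
      by (simp add: mult_ac)
    then show ?case using cmult by simp
  next
    case (lim F f C)
    note [measurable] = lim(2,3)
    have CC: "integrable lborel (\<lambda>x. norm (G x) * C)" using Gi by simp
    have b: "AE x in lborel. norm (G x * complex_of_real (F n (\<Psi> x))) \<le> norm (G x) * C" for n
      using lim(4)[OF \<Psi>K] by (auto simp: norm_mult intro!: mult_left_mono)
    have l: "AE x in lborel. (\<lambda>n. G x * complex_of_real (F n (\<Psi> x))) \<longlonglongrightarrow> G x * complex_of_real (f (\<Psi> x))"
      using lim(5)[OF \<Psi>K] by (auto intro!: tendsto_mult tendsto_of_real)
    have "(\<lambda>n. LINT x|lborel. G x * complex_of_real (F n (\<Psi> x))) \<longlonglongrightarrow> (LINT x|lborel. G x * complex_of_real (f (\<Psi> x)))"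
      by (rule integral_dominated_convergence[OF _ _ CC l b]) auto
    moreover have "integrable lborel (\<lambda>x. G x * complex_of_real (f (\<Psi> x)))"
      by (rule integrable_dominated_convergence[OF _ _ CC l b]) auto
    ultimately show ?case using lim(1) by (simp add: LIMSEQ_const_iff)
  qed
  have Z: "(LINT x|lborel. G x * complex_of_real (f x)) = 0" "integrable lborel (\<lambda>x. G x * complex_of_real (f x))"
    if [measurable]: "f \<in> borel_measurable borel" and f: "\<And>x. \<bar>f x\<bar> \<le> 1" for f
  proof -
    have [measurable]: "(\<lambda>p::real \<times> 'a. f ((1 / fst p) *\<^sub>R snd p)) \<in> borel_measurable borel"
      unfolding borel_prod[symmetric] by measurable
    \<comment> \<open>Dividing the second component by the first recovers \<open>x\<close>, so every
      bounded Borel function of \<open>x\<close> is one of \<open>\<Psi> x\<close>.\<close>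
    have "f ((1 / fst (\<Psi> x)) *\<^sub>R snd (\<Psi> x)) = f x" for x by (simp add: \<Psi>_def w_def)
    then show "(LINT x|lborel. G x * complex_of_real (f x)) = 0" "integrable lborel (\<lambda>x. G x * complex_of_real (f x))"
      using P[of "\<lambda>p. f ((1 / fst p) *\<^sub>R snd p)"] f by auto
  qed
  have Q: "AE x in lborel. c (G x) = 0"
    if c: "bounded_linear c" "\<And>z. \<bar>c z\<bar> \<le> norm z" "\<And>z r. c (z * complex_of_real r) = c z * r" for c :: "complex \<Rightarrow> real"
  proof -
    interpret bounded_linear c by fact
    have [measurable]: "c \<in> borel_measurable borel"
      by (intro borel_measurable_continuous_onI linear_continuous_on c)
    \<comment> \<open>A bounded test function with the sign of \<open>c (G x)\<close>: the product c
      (G x) * ?f x is (c (G x))^2 / (1 + norm (G x)), which is nonnegative and has integral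
      zero.\<close>
    let ?f = "\<lambda>x. c (G x) / (1 + norm (G x))"
    have 1: "0 < 1 + norm (G x)" for x by (simp add: add_pos_nonneg)
    have f: "\<bar>?f x\<bar> \<le> 1" for x
      using c(2)[of "G x"] 1[of x] by (simp add: divide_le_eq)
    have i: "integrable lborel (\<lambda>x. G x * complex_of_real (?f x))" by (rule Z(2)) (use f in auto)
    have "c (LINT x|lborel. G x * complex_of_real (?f x)) = (LINT x|lborel. c (G x * complex_of_real (?f x)))"
      by (rule integral_bounded_linear[OF c(1) i, symmetric])
    also have "(LINT x|lborel. G x * complex_of_real (?f x)) = 0" by (rule Z(1)) (use f in auto)
    finally have 0: "(LINT x|lborel. c (G x) * ?f x) = 0" by (simp only: c(3) zero)
    have i': "integrable lborel (\<lambda>x. c (G x) * ?f x)"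
      using integrable_bounded_linear[OF c(1) i] by (simp only: c(3))
    have nn: "0 \<le> c (G x) * ?f x" for x using 1[of x] by (simp add: zero_le_divide_iff)
    have "AE x in lborel. c (G x) * ?f x = 0"
      using integral_nonneg_eq_0_iff_AE[OF i'] nn 0 by auto
    then show ?thesis
    proof eventually_elim
      case (elim x) then show ?case using 1[of x] by auto
    qed
  qed
  have "AE x in lborel. Re (G x) = 0" by (rule Q[OF bounded_linear_Re]) (auto simp: abs_Re_le_cmod)
  moreover have "AE x in lborel. Im (G x) = 0" by (rule Q[OF bounded_linear_Im]) (auto simp: abs_Im_le_cmod)
  ultimately show ?thesis
  proof eventually_elim
    case (elim x)
    then have "G x = 0" by (simp add: complex_eq_iff)
    then show ?case by (simp add: G_def w_def)
  qed
qed

section \<open>Fourier transforms of distributions\<close>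

lemma is_fourier_of_AE_unique:
  assumes g: "is_fourier_of T g" and h: "is_fourier_of T h"
  shows "AE \<xi> in lborel. g \<xi> = h \<xi>"
proof -
  have "AE \<xi> in lborel. g \<xi> - h \<xi> = 0"
  proof (rule AE_eq_0_if_schwartz_integrals_eq_0)
    show "(\<lambda>\<xi>. g \<xi> - h \<xi>) \<in> borel_measurable borel"
      using g h by (intro borel_measurable_diff) (simp_all add: is_fourier_of_def)
    fix \<phi> :: "'a \<Rightarrow> complex" assume "schwartz \<phi>"
    then show "integrable lborel (\<lambda>x. (g x - h x) * \<phi> x) \<and> (LINT x|lborel. (g x - h x) * \<phi> x) = 0"
      using g h by (auto simp: is_fourier_of_def distribution_of_def left_diff_distrib)
  qed
  then show ?thesis by simp
qed

lemma dist_fourier_AE_eq: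
  assumes "is_fourier_of T g"
  shows "AE \<xi> in lborel. dist_fourier T \<xi> = g \<xi>"
  using assms is_fourier_of_AE_unique someI[of "is_fourier_of T"] unfolding dist_fourier_def by blast

lemma sobolev_dist_fourier:
  assumes "T \<in> sobolev s"
  shows "dist_fourier T \<in> borel_measurable borel"
    and "integrable lborel (\<lambda>\<xi>. (norm ((1 + (norm \<xi>)\<^sup>2) powr (s / 2) *\<^sub>R dist_fourier T \<xi>))\<^sup>2)"
proof -
  have "is_fourier_of T (dist_fourier T)"
    using assms someI_ex[of "is_fourier_of T"] unfolding sobolev_def dist_fourier_def by blast
  then show "dist_fourier T \<in> borel_measurable borel" by (simp add: is_fourier_of_def)
  show "integrable lborel (\<lambda>\<xi>. (norm ((1 + (norm \<xi>)\<^sup>2) powr (s / 2) *\<^sub>R dist_fourier T \<xi>))\<^sup>2)"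
    using assms by (simp add: sobolev_def)
qed

lemma
  fixes g :: "'a::euclidean_space \<Rightarrow> complex"
  assumes g: "integrable lborel g"
  shows norm_inverse_fourier_le: "norm (inverse_fourier g x) \<le> (LINT \<xi>|lborel. norm (g \<xi>)) / (2 * pi) ^ DIM('a)"
    and borel_measurable_inverse_fourier: "inverse_fourier g \<in> borel_measurable borel"
proof -
  have [measurable]: "g \<in> borel_measurable borel" using borel_measurable_integrable[OF g] by simp
  have "norm (LINT \<xi>|lborel. iexp (x \<bullet> \<xi>) * g \<xi>) \<le> (LINT \<xi>|lborel. norm (iexp (x \<bullet> \<xi>) * g \<xi>))"
    by (rule integral_norm_bound)
  then show "norm (inverse_fourier g x) \<le> (LINT \<xi>|lborel. norm (g \<xi>)) / (2 * pi) ^ DIM('a)"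
    unfolding inverse_fourier_def by (simp add: norm_mult norm_divide norm_power divide_right_mono)
  show "inverse_fourier g \<in> borel_measurable borel" unfolding inverse_fourier_def[abs_def] by measurable
qed

lemma schwartz_decay_seminorm:
  fixes \<phi> :: "'a::euclidean_space \<Rightarrow> complex"
  assumes \<phi>: "schwartz \<phi>"
  shows "(1 + norm x) ^ N * norm (\<phi> x) \<le> schwartz_seminorm N \<phi>"
proof -
  let ?s = "\<lambda>bs. SUP x. (1 + norm x) ^ N * norm (iterated_partial bs \<phi> x)"
  have bdd: "bdd_above (range (\<lambda>x. (1 + norm x) ^ N * norm (iterated_partial bs \<phi> x)))" if "set bs \<subseteq> Basis" for bs
    using \<phi> that by (auto simp: schwartz_def)
  have up: "(1 + norm x) ^ N * norm (iterated_partial bs \<phi> x) \<le> ?s bs" if "set bs \<subseteq> Basis" for bs x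
    by (rule cSUP_upper[OF UNIV_I bdd[OF that]])
  have "(1 + norm x) ^ N * norm (\<phi> x) \<le> ?s []" using up[of "[]" x] by simp
  also have "\<dots> \<le> (\<Sum>bs | set bs \<subseteq> Basis \<and> length bs \<le> N. ?s bs)"
  proof (rule member_le_sum)
    show "finite {bs. set bs \<subseteq> (Basis :: 'a set) \<and> length bs \<le> N}" by (rule finite_lists_length_le) simp
    fix bs :: "'a list"
    assume "bs \<in> {bs. set bs \<subseteq> Basis \<and> length bs \<le> N} - {[]}"
    then have "set bs \<subseteq> Basis" by simp
    from up[OF this, of 0] show "0 \<le> ?s bs" by (rule order_trans[rotated]) simp
  qed simp
  finally show ?thesis by (simp add: schwartz_seminorm_def)
qed

text \<open>The seminorm of order \<open>2 * DIM('a)\<close> suffices, since this is the decay whose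
  weight is integrable by \<open>integrable_decay\<close>.\<close>

lemma tempered_distribution_of_bounded:
  fixes f :: "'a::euclidean_space \<Rightarrow> complex"
  assumes [measurable]: "f \<in> borel_measurable borel" and f: "\<And>x. norm (f x) \<le> B"
  shows "tempered (distribution_of f)"
proof -
  let ?N = "2 * DIM('a)"
  have int: "integrable lborel (\<lambda>x. f x * \<phi> x)" if \<phi>: "schwartz \<phi>" for \<phi>
  proof (rule Bochner_Integration.integrable_bound)
    show "integrable lborel (\<lambda>x. B *\<^sub>R \<phi> x)" using schwartz_integrable[OF \<phi>] by simp
    have B: "0 \<le> B" using f norm_ge_zero order_trans by blast
    show "AE x in lborel. norm (f x * \<phi> x) \<le> norm (B *\<^sub>R \<phi> x)"
      using f B by (intro AE_I2) (simp add: norm_mult mult_right_mono)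
    show "(\<lambda>x. f x * \<phi> x) \<in> borel_measurable lborel" using schwartz_measurable[OF \<phi>] by measurable
  qed
  have lin: "distribution_of f (\<lambda>x. a * \<phi> x + b * \<theta> x) = a * distribution_of f \<phi> + b * distribution_of f \<theta>"
    if "schwartz \<phi>" "schwartz \<theta>" for \<phi> \<theta> a b
  proof -
    have "f x * (a * \<phi> x + b * \<theta> x) = a * (f x * \<phi> x) + b * (f x * \<theta> x)" for x by (simp add: algebra_simps)
    then show ?thesis unfolding distribution_of_def using int[OF that(1)] int[OF that(2)] by simp
  qed
  let ?w = "\<lambda>x::'a. 1 / (1 + norm x) ^ ?N"
  have pos: "0 < (1 + norm x) ^ ?N" for x :: 'a by (intro zero_less_power add_pos_nonneg) auto
  have wi: "integrable lborel ?w"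
  proof -
    have "integrable lborel (\<lambda>x. complex_of_real (?w x))"
    proof (rule integrable_decay)
      show "(1 + norm x) ^ ?N * norm (complex_of_real (?w x)) \<le> 1" for x :: 'a
        using pos[of x] unfolding norm_of_real by simp
    qed measurable
    then show ?thesis by (simp only: complex_of_real_integrable_eq)
  qed
  have bound: "norm (distribution_of f \<phi>) \<le> (B * (LINT x|lborel. ?w x)) * schwartz_seminorm ?N \<phi>" if \<phi>: "schwartz \<phi>" for \<phi>
  proof -
    have *: "norm (f x * \<phi> x) \<le> B * schwartz_seminorm ?N \<phi> * ?w x" for x
    proof -
      have "norm (\<phi> x) \<le> schwartz_seminorm ?N \<phi> * ?w x"
        using schwartz_decay_seminorm[OF \<phi>, of x ?N] pos[of x] by (simp add: pos_le_divide_eq mult.commute)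
      then have "norm (f x) * norm (\<phi> x) \<le> B * (schwartz_seminorm ?N \<phi> * ?w x)"
        using f[of x] by (intro mult_mono) (auto intro: order_trans[OF norm_ge_zero])
      then show ?thesis by (simp add: norm_mult mult.assoc)
    qed
    have "norm (distribution_of f \<phi>) \<le> (LINT x|lborel. norm (f x * \<phi> x))"
      unfolding distribution_of_def by (rule integral_norm_bound)
    also have "\<dots> \<le> (LINT x|lborel. B * schwartz_seminorm ?N \<phi> * ?w x)"
      by (rule integral_mono[OF integrable_norm[OF int[OF \<phi>]] integrable_mult_right[OF wi] *])
    also have "\<dots> = B * schwartz_seminorm ?N \<phi> * (LINT x|lborel. ?w x)" by (rule integral_mult_right_zero)
    finally show ?thesis by (simp only: mult_ac)
  qed
  show ?thesis unfolding tempered_def using lin bound by blast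
qed

text \<open>Fubini moves the inverse transform from \<open>g\<close> onto
  \<open>fourier \<phi>\<close>, where inversion applies because \<phi> is Schwartz. Of
  \<open>g\<close> only integrability enters, which admits discontinuous functions such as the
  transforms of Shannon wavelets.\<close>

lemma is_fourier_of_inverse_fourier:
  fixes g :: "'a::euclidean_space \<Rightarrow> complex"
  assumes g: "integrable lborel g"
  shows "is_fourier_of (distribution_of (inverse_fourier g)) g"
  unfolding is_fourier_of_def
proof (intro conjI allI impI)
  show gm: "g \<in> borel_measurable lborel" using g by (rule borel_measurable_integrable)
  then have [measurable]: "g \<in> borel_measurable borel" by simp
  fix \<phi> :: "'a \<Rightarrow> complex" assume \<phi>: "schwartz \<phi>"
  note [measurable] = schwartz_measurable[OF \<phi>]
  obtain B where B: "0 < B" "\<And>x. norm (\<phi> x) \<le> B" using schwartz_bounded[OF \<phi>] by blast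
  show "integrable lborel (\<lambda>\<xi>. g \<xi> * \<phi> \<xi>)"
  proof (rule Bochner_Integration.integrable_bound)
    show "integrable lborel (\<lambda>x. B *\<^sub>R g x)" using g by simp
    show "AE x in lborel. norm (g x * \<phi> x) \<le> norm (B *\<^sub>R g x)"
      using B by (intro AE_I2) (simp add: norm_mult mult.commute mult_right_mono)
  qed measurable
  let ?c = "complex_of_real ((2 * pi) ^ DIM('a))"
  have c: "?c \<noteq> 0" by simp
  let ?F = "\<lambda>x \<xi>. iexp (x \<bullet> \<xi>) * g \<xi> * fourier \<phi> x"
  have Fi: "integrable (lborel \<Otimes>\<^sub>M lborel) (case_prod ?F)"
    by (rule integrable_lborel_product[OF fourier_schwartz_integrable[OF \<phi>] g]) (auto simp: norm_mult)
  have "distribution_of (inverse_fourier g) (fourier \<phi>) = (LINT x|lborel. inverse ?c * (LINT \<xi>|lborel. ?F x \<xi>))"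
    unfolding distribution_of_def inverse_fourier_def integral_mult_left_zero
    by (simp only: divide_inverse mult_ac)
  also have "\<dots> = inverse ?c * (LINT x|lborel. LINT \<xi>|lborel. ?F x \<xi>)" by (rule integral_mult_right_zero)
  also have "(LINT x|lborel. LINT \<xi>|lborel. ?F x \<xi>) = (LINT \<xi>|lborel. LINT x|lborel. ?F x \<xi>)"
    by (rule lborel_pair.Fubini_integral[OF Fi, symmetric])
  also have "(LINT \<xi>|lborel. LINT x|lborel. ?F x \<xi>) = (LINT \<xi>|lborel. ?c * (g \<xi> * \<phi> \<xi>))"
  proof -
    have "(LINT x|lborel. ?F x \<xi>) = (LINT x|lborel. g \<xi> * (iexp (x \<bullet> \<xi>) * fourier \<phi> x))" for \<xi>
      by (simp only: mult_ac)
    also have "\<dots> \<xi> = g \<xi> * (?c * \<phi> \<xi>)" for \<xi>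
      by (simp only: integral_mult_right_zero fourier_inversion[OF \<phi>])
    finally show ?thesis by (simp only: mult_ac)
  qed
  also have "\<dots> = ?c * (LINT \<xi>|lborel. g \<xi> * \<phi> \<xi>)" by (rule integral_mult_right_zero)
  also have "inverse ?c * (?c * (LINT \<xi>|lborel. g \<xi> * \<phi> \<xi>)) = (LINT \<xi>|lborel. g \<xi> * \<phi> \<xi>)"
    unfolding mult.assoc[symmetric] left_inverse[OF c] by (rule mult_1_left)
  finally show "distribution_of (inverse_fourier g) (fourier \<phi>) = distribution_of g \<phi>"
    by (simp add: distribution_of_def)
qed

lemma sobolevI:
  assumes T: "tempered T" "is_fourier_of T g"
    and g: "integrable lborel (\<lambda>\<xi>. (norm ((1 + (norm \<xi>)\<^sup>2) powr (s / 2) *\<^sub>R g \<xi>))\<^sup>2)"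
  shows "T \<in> sobolev s"
proof -
  have f: "is_fourier_of T (dist_fourier T)" unfolding dist_fourier_def by (rule someI[of "is_fourier_of T", OF T(2)])
  have [measurable]: "g \<in> borel_measurable borel" "dist_fourier T \<in> borel_measurable borel"
    using T(2) f by (auto simp: is_fourier_of_def)
  have "AE \<xi> in lborel. dist_fourier T \<xi> = g \<xi>" by (rule dist_fourier_AE_eq[OF T(2)])
  then have "AE \<xi> in lborel. (norm ((1 + (norm \<xi>)\<^sup>2) powr (s / 2) *\<^sub>R g \<xi>))\<^sup>2
      = (norm ((1 + (norm \<xi>)\<^sup>2) powr (s / 2) *\<^sub>R dist_fourier T \<xi>))\<^sup>2"
    by eventually_elim simp
  then have "integrable lborel (\<lambda>\<xi>. (norm ((1 + (norm \<xi>)\<^sup>2) powr (s / 2) *\<^sub>R dist_fourier T \<xi>))\<^sup>2)"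
    by (rule integrable_cong_AE_imp[OF g, rotated]) measurable
  then show ?thesis using T by (auto simp: sobolev_def)
qed

lemma inverse_fourier_sobolev:
  assumes g: "integrable lborel g"
    and "integrable lborel (\<lambda>\<xi>. (norm ((1 + (norm \<xi>)\<^sup>2) powr (s / 2) *\<^sub>R g \<xi>))\<^sup>2)"
  shows "distribution_of (inverse_fourier g) \<in> sobolev s"
  by (rule sobolevI[OF tempered_distribution_of_bounded is_fourier_of_inverse_fourier[OF g] assms(2)])
     (rule borel_measurable_inverse_fourier[OF g] norm_inverse_fourier_le[OF g])+

text \<open>The zero distribution fills the other components of \<open>unit_dist_vec\<close>. Its
  \<open>dist_fourier\<close> is a choice like any other, hence zero only almost everywhere.\<close>

lemma
  shows zero_sobolev: "(\<lambda>\<phi>. 0) \<in> sobolev s"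
    and dist_fourier_zero_AE: "AE \<xi> in lborel. dist_fourier (\<lambda>\<phi>. 0) \<xi> = 0"
proof -
  have z: "is_fourier_of (\<lambda>\<phi>. 0) (\<lambda>\<xi>. 0)" by (simp add: is_fourier_of_def distribution_of_def)
  have "tempered (\<lambda>\<phi>. 0)" unfolding tempered_def by (auto intro!: exI[of _ 0])
  then show "(\<lambda>\<phi>. 0) \<in> sobolev s" using z by (rule sobolevI) simp
  show "AE \<xi> in lborel. dist_fourier (\<lambda>\<phi>. 0) \<xi> = 0" by (rule dist_fourier_AE_eq[OF z])
qed

section \<open>Orthogonal bases of square-integrable functions\<close>

definition square_integrable :: "'a measure \<Rightarrow> ('a \<Rightarrow> complex) \<Rightarrow> bool" where
  "square_integrable M f \<longleftrightarrow> f \<in> borel_measurable M \<and> integrable M (\<lambda>x. (norm (f x))\<^sup>2)"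

definition l2_inner :: "'a measure \<Rightarrow> ('a \<Rightarrow> complex) \<Rightarrow> ('a \<Rightarrow> complex) \<Rightarrow> complex" where
  "l2_inner M f g = (LINT x|M. f x * cnj (g x))"

definition l2_sq :: "'a measure \<Rightarrow> ('a \<Rightarrow> complex) \<Rightarrow> real" where
  "l2_sq M f = (LINT x|M. (norm (f x))\<^sup>2)"

lemma square_integrable_measurable: "square_integrable M f \<Longrightarrow> f \<in> borel_measurable M"
  by (simp add: square_integrable_def)

lemma norm_add_sq_le: "(norm (a + b :: complex))\<^sup>2 \<le> 2 * (norm a)\<^sup>2 + 2 * (norm b)\<^sup>2"
proof -
  have "(norm (a + b))\<^sup>2 \<le> (norm a + norm b)\<^sup>2" by (intro power_mono norm_triangle_ineq) auto
  also have "\<dots> \<le> 2 * (norm a)\<^sup>2 + 2 * (norm b)\<^sup>2"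
    using zero_le_power2[of "norm a - norm b"] by (simp add: power2_sum power2_diff)
  finally show ?thesis .
qed

lemma square_integrable_add:
  assumes f: "square_integrable M f" and g: "square_integrable M g"
  shows "square_integrable M (\<lambda>x. f x + g x)"
proof -
  have [measurable]: "f \<in> borel_measurable M" "g \<in> borel_measurable M"
    using assms by (auto simp: square_integrable_def)
  have "integrable M (\<lambda>x. 2 * (norm (f x))\<^sup>2 + 2 * (norm (g x))\<^sup>2)"
    using assms by (auto simp: square_integrable_def)
  then have "integrable M (\<lambda>x. (norm (f x + g x))\<^sup>2)"
    by (rule Bochner_Integration.integrable_bound) (auto intro!: AE_I2 simp: norm_add_sq_le)
  then show ?thesis by (auto simp: square_integrable_def)
qed

lemma square_integrable_bounded_mult:
  assumes f: "square_integrable M f" and [measurable]: "m \<in> borel_measurable M"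
    and m: "AE x in M. norm (m x) \<le> C"
  shows "square_integrable M (\<lambda>x. m x * f x)"
proof -
  have [measurable]: "f \<in> borel_measurable M" using f by (auto simp: square_integrable_def)
  have "integrable M (\<lambda>x. C\<^sup>2 * (norm (f x))\<^sup>2)" using f by (auto simp: square_integrable_def)
  then have "integrable M (\<lambda>x. (norm (m x * f x))\<^sup>2)"
  proof (rule Bochner_Integration.integrable_bound)
    show "AE x in M. norm ((norm (m x * f x))\<^sup>2) \<le> norm (C\<^sup>2 * (norm (f x))\<^sup>2)"
      using m
    proof eventually_elim
      case (elim x)
      then have "norm (m x * f x) \<le> C * norm (f x)" unfolding norm_mult by (intro mult_right_mono) auto
      then have "(norm (m x * f x))\<^sup>2 \<le> (C * norm (f x))\<^sup>2" by (intro power_mono) auto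
      then show "norm ((norm (m x * f x))\<^sup>2) \<le> norm (C\<^sup>2 * (norm (f x))\<^sup>2)" by (simp add: power_mult_distrib)
    qed
  qed measurable
  then show ?thesis by (auto simp: square_integrable_def)
qed

lemma square_integrable_cmult: "square_integrable M f \<Longrightarrow> square_integrable M (\<lambda>x. c * f x)"
  by (rule square_integrable_bounded_mult[where C = "norm c"]) auto

lemma square_integrable_zero: "square_integrable M (\<lambda>x. 0)"
  by (simp add: square_integrable_def)

lemma square_integrable_diff:
  "square_integrable M f \<Longrightarrow> square_integrable M g \<Longrightarrow> square_integrable M (\<lambda>x. f x - g x)"
  using square_integrable_add[of M f "\<lambda>x. (-1) * g x"] square_integrable_cmult[of M g "-1"] by simp

lemma square_integrable_sum:
  "finite F \<Longrightarrow> (\<And>k. k \<in> F \<Longrightarrow> square_integrable M (f k)) \<Longrightarrow> square_integrable M (\<lambda>x. \<Sum>k\<in>F. f k x)"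
  by (induction F rule: finite_induct) (auto intro: square_integrable_add square_integrable_zero)

lemma square_integrable_bounded:
  assumes "finite_measure M" and [measurable]: "f \<in> borel_measurable M"
    and f: "\<And>x. x \<in> space M \<Longrightarrow> norm (f x) \<le> C"
  shows "square_integrable M f"
proof -
  have "integrable M (\<lambda>x. 1 :: real)" using assms(1) by (rule finite_measure.integrable_const)
  then have "square_integrable M (\<lambda>x. 1)" by (simp add: square_integrable_def)
  from square_integrable_bounded_mult[OF this assms(2) AE_I2[OF f]] show ?thesis by simp
qed

lemma square_integrable_integrable_mult:
  assumes f: "square_integrable M f" and g: "square_integrable M g"
  shows "integrable M (\<lambda>x. f x * g x)"
proof -
  have [measurable]: "f \<in> borel_measurable M" "g \<in> borel_measurable M"
    using assms by (auto simp: square_integrable_def)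
  have "integrable M (\<lambda>x. (norm (f x))\<^sup>2 + (norm (g x))\<^sup>2)"
    using assms by (auto simp: square_integrable_def)
  then show ?thesis
  proof (rule Bochner_Integration.integrable_bound)
    have "norm (f x) * norm (g x) \<le> (norm (f x))\<^sup>2 + (norm (g x))\<^sup>2" for x
      using sum_squares_bound[of "norm (f x)" "norm (g x)"] zero_le_power2[of "norm (f x)"] zero_le_power2[of "norm (g x)"]
        mult_nonneg_nonneg[of "norm (f x)" "norm (g x)"] by linarith
    then show "AE x in M. norm (f x * g x) \<le> norm ((norm (f x))\<^sup>2 + (norm (g x))\<^sup>2)"
      by (auto simp: norm_mult)
  qed measurable
qed

lemma borel_measurable_cnj [measurable]: "cnj \<in> borel_measurable borel"
  by (intro borel_measurable_continuous_onI continuous_intros)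

lemma square_integrable_cnj: "square_integrable M f \<Longrightarrow> square_integrable M (\<lambda>x. cnj (f x))"
  by (auto simp: square_integrable_def intro: measurable_compose[OF _ borel_measurable_cnj])

lemma square_integrable_inner:
  "square_integrable M f \<Longrightarrow> square_integrable M g \<Longrightarrow> integrable M (\<lambda>x. f x * cnj (g x))"
  by (intro square_integrable_integrable_mult square_integrable_cnj)

lemma l2_inner_commute: "l2_inner M g f = cnj (l2_inner M f g)"
proof -
  have "(\<lambda>x. g x * cnj (f x)) = (\<lambda>x. cnj (f x * cnj (g x)))" by (simp add: mult.commute)
  then show ?thesis unfolding l2_inner_def by (simp only: Bochner_Integration.integral_cnj)
qed

lemma l2_inner_self: "l2_inner M f f = complex_of_real (l2_sq M f)"
  unfolding l2_inner_def l2_sq_def complex_norm_square[symmetric]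
  by (simp only: integral_complex_of_real)

lemma l2_inner_add_left:
  "square_integrable M f \<Longrightarrow> square_integrable M g \<Longrightarrow> square_integrable M h \<Longrightarrow>
    l2_inner M (\<lambda>x. f x + g x) h = l2_inner M f h + l2_inner M g h"
  unfolding l2_inner_def by (simp add: distrib_right square_integrable_inner)

lemma l2_inner_diff_left:
  "square_integrable M f \<Longrightarrow> square_integrable M g \<Longrightarrow> square_integrable M h \<Longrightarrow>
    l2_inner M (\<lambda>x. f x - g x) h = l2_inner M f h - l2_inner M g h"
  unfolding l2_inner_def by (simp add: left_diff_distrib square_integrable_inner)

lemma l2_inner_cmult_left: "l2_inner M (\<lambda>x. c * f x) h = c * l2_inner M f h"
  unfolding l2_inner_def by (simp add: mult.assoc)

lemma l2_inner_sum_left: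
  assumes "finite F" "\<And>k. k \<in> F \<Longrightarrow> square_integrable M (f k)" "square_integrable M h"
  shows "l2_inner M (\<lambda>x. \<Sum>k\<in>F. f k x) h = (\<Sum>k\<in>F. l2_inner M (f k) h)"
  using assms(1,2)
proof (induction F rule: finite_induct)
  case (insert k F)
  then show ?case
    using l2_inner_add_left[of M "f k" "\<lambda>x. \<Sum>k\<in>F. f k x" h] assms(3) by (simp add: square_integrable_sum)
qed (simp add: l2_inner_def)

lemma l2_sq_nonneg: "0 \<le> l2_sq M f"
  by (simp add: l2_sq_def)

lemma l2_sq_add_le:
  assumes f: "square_integrable M f" and g: "square_integrable M g"
  shows "l2_sq M (\<lambda>x. f x + g x) \<le> 2 * l2_sq M f + 2 * l2_sq M g"
proof -
  have "l2_sq M (\<lambda>x. f x + g x) \<le> (LINT x|M. 2 * (norm (f x))\<^sup>2 + 2 * (norm (g x))\<^sup>2)"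
    unfolding l2_sq_def using square_integrable_add[OF f g] f g
    by (intro integral_mono norm_add_sq_le) (auto simp: square_integrable_def)
  also have "\<dots> = 2 * l2_sq M f + 2 * l2_sq M g"
    unfolding l2_sq_def using f g by (simp add: square_integrable_def)
  finally show ?thesis .
qed

section \<open>Finite linear combinations of a family of functions\<close>

inductive lincomb :: "('k \<Rightarrow> 'a \<Rightarrow> complex) \<Rightarrow> ('a \<Rightarrow> complex) \<Rightarrow> bool" for e where
  zero: "lincomb e (\<lambda>x. 0)"
| step: "lincomb e T \<Longrightarrow> lincomb e (\<lambda>x. a * e k x + T x)"

lemma lincomb_add: "lincomb e S \<Longrightarrow> lincomb e T \<Longrightarrow> lincomb e (\<lambda>x. S x + T x)"
  by (induction rule: lincomb.induct) (auto simp: add.assoc intro: lincomb.step)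

lemma lincomb_cmult: "lincomb e S \<Longrightarrow> lincomb e (\<lambda>x. c * S x)"
proof (induction rule: lincomb.induct)
  case zero then show ?case by (simp add: lincomb.zero)
next
  case (step T a k)
  from lincomb.step[OF this(2), of "c * a" k] show ?case by (simp add: distrib_left mult.assoc)
qed

lemma lincomb_base: "lincomb e (e k)"
  using lincomb.step[OF lincomb.zero, of e 1 k] by simp

lemma lincomb_scale: "lincomb e T \<Longrightarrow> lincomb (\<lambda>k x. s x * e k x) (\<lambda>x. s x * T x)"
proof (induction rule: lincomb.induct)
  case zero then show ?case by (simp add: lincomb.zero)
next
  case (step T a k)
  from lincomb.step[OF this(2), of a k] show ?case by (simp add: distrib_left mult.left_commute)
qed

lemma lincomb_mult:
  assumes e: "\<And>k l. lincomb e (\<lambda>x. e k x * e l x)"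
    and "lincomb e S" "lincomb e T"
  shows "lincomb e (\<lambda>x. S x * T x)"
proof -
  have base: "lincomb e (\<lambda>x. e k x * T x)" for k
    using assms(3)
  proof (induction rule: lincomb.induct)
    case (step T a l)
    from lincomb_add[OF lincomb_cmult[OF e[of k l], of a] this(2)] show ?case
      by (simp add: distrib_left mult_ac)
  qed (simp add: lincomb.zero)
  show ?thesis
    using assms(2)
  proof (induction rule: lincomb.induct)
    case (step S a l)
    from lincomb_add[OF lincomb_cmult[OF base[of l], of a] this(2)] show ?case
      by (simp add: distrib_right distrib_left mult_ac)
  qed (simp add: lincomb.zero)
qed

text \<open>The inductive form lets an index recur, so sums and products need no merging of index
  sets. Here the coefficients are collected, because the expansion in an orthogonal family needs one
  coefficient per index.\<close>

lemma lincomb_as_sum: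
  assumes "lincomb e T"
  obtains F a where "finite F" "T = (\<lambda>x. \<Sum>k\<in>F. a k * e k x)"
proof -
  have "\<exists>F a. finite F \<and> T = (\<lambda>x. \<Sum>k\<in>F. a k * e k x)"
    using assms
  proof (induction rule: lincomb.induct)
    case zero then show ?case by (intro exI[of _ "{}"]) auto
  next
    case (step T b l)
    then obtain F a where F: "finite F" "T = (\<lambda>x. \<Sum>k\<in>F. a k * e k x)" by blast
    let ?a = "\<lambda>k. (if k \<in> F then a k else 0) + (if k = l then b else 0)"
    have "(\<Sum>k\<in>insert l F. ?a k * e k x) = b * e l x + T x" for x
    proof -
      have "(\<Sum>k\<in>insert l F. ?a k * e k x)
        = (\<Sum>k\<in>insert l F. (if k \<in> F then a k * e k x else 0)) + (\<Sum>k\<in>insert l F. (if k = l then b * e k x else 0))"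
        by (subst sum.distrib[symmetric]) (intro sum.cong, auto simp: distrib_right)
      also have "(\<Sum>k\<in>insert l F. (if k \<in> F then a k * e k x else 0)) = (\<Sum>k\<in>F. a k * e k x)"
        by (rule sum.mono_neutral_cong_right) (use F in auto)
      also have "(\<Sum>k\<in>insert l F. (if k = l then b * e k x else 0)) = b * e l x"
        using F(1) by (simp add: sum.delta)
      finally show ?thesis using F(2) by simp
    qed
    then have "(\<lambda>x. b * e l x + T x) = (\<lambda>x. \<Sum>k\<in>insert l F. ?a k * e k x)" by (simp only:)
    then show ?case using F(1) by (intro exI[of _ "insert l F"] exI[of _ ?a]) simp
  qed
  then show ?thesis using that by blast
qed

section \<open>Bessel's inequality and Parseval's identity\<close>

locale orthogonal_basis =
  fixes M :: "'a measure" and e :: "'k \<Rightarrow> 'a \<Rightarrow> complex" and c :: real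
  assumes sq: "\<And>k. square_integrable M (e k)"
    and c_pos: "0 < c"
    and orth: "\<And>k l. l2_inner M (e k) (e l) = (if k = l then complex_of_real c else 0)"
    and dense: "\<And>f \<epsilon>. square_integrable M f \<Longrightarrow> 0 < \<epsilon> \<Longrightarrow> \<exists>T. lincomb e T \<and> l2_sq M (\<lambda>x. f x - T x) \<le> \<epsilon>"
begin

text \<open>Completing the square in each coefficient. With a k = l2_inner M f (e k) / c the last
  sum vanishes, which gives Bessel's inequality; for other coefficients it is nonnegative, so any
  good approximation bounds the Bessel defect from above.\<close>

lemma best_approximation:
  fixes a :: "'k \<Rightarrow> complex"
  assumes f: "square_integrable M f" and F: "finite F"
  shows "c * l2_sq M (\<lambda>x. f x - (\<Sum>k\<in>F. a k * e k x))
    = c * l2_sq M f - (\<Sum>k\<in>F. (norm (l2_inner M f (e k)))\<^sup>2) + (\<Sum>k\<in>F. (norm (c * a k - l2_inner M f (e k)))\<^sup>2)"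
proof -
  let ?g = "\<lambda>x. \<Sum>k\<in>F. a k * e k x"
  let ?I = "\<lambda>k. l2_inner M f (e k)"
  have ak: "square_integrable M (\<lambda>x. a k * e k x)" for k by (rule square_integrable_cmult[OF sq])
  have g: "square_integrable M ?g" by (intro square_integrable_sum F ak)
  have fg: "square_integrable M (\<lambda>x. f x - ?g x)" by (intro square_integrable_diff f g)
  have gh: "l2_inner M ?g h = (\<Sum>k\<in>F. a k * l2_inner M (e k) h)" if "square_integrable M h" for h
    by (subst l2_inner_sum_left[OF F ak that]) (simp add: l2_inner_cmult_left)
  have gf: "l2_inner M ?g f = (\<Sum>k\<in>F. a k * cnj (?I k))"
    unfolding gh[OF f] by (simp only: l2_inner_commute[of M _ f])
  have fg': "l2_inner M f ?g = (\<Sum>k\<in>F. cnj (a k) * ?I k)"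
    unfolding l2_inner_commute[of M f ?g] gf by simp
  have ge: "l2_inner M (e k) ?g = (if k \<in> F then cnj (a k) * c else 0)" for k
  proof -
    have "l2_inner M (e k) ?g = cnj (l2_inner M ?g (e k))" by (rule l2_inner_commute)
    also have "l2_inner M ?g (e k) = (\<Sum>l\<in>F. if l = k then a l * c else 0)"
      unfolding gh[OF sq] by (intro sum.cong) (auto simp: orth)
    also have "\<dots> = (if k \<in> F then a k * c else 0)" using F by (simp add: sum.delta)
    finally show ?thesis by simp
  qed
  have gg: "l2_inner M ?g ?g = (\<Sum>k\<in>F. a k * cnj (a k) * c)"
    unfolding gh[OF g] ge by (intro sum.cong) (auto simp: mult.assoc)
  have "complex_of_real (l2_sq M (\<lambda>x. f x - ?g x)) = l2_inner M f (\<lambda>x. f x - ?g x) - l2_inner M ?g (\<lambda>x. f x - ?g x)"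
    unfolding l2_inner_self[symmetric] by (rule l2_inner_diff_left[OF f g fg])
  also have "l2_inner M f (\<lambda>x. f x - ?g x) = l2_inner M f f - l2_inner M f ?g"
    by (subst (1 2 3) l2_inner_commute) (simp add: l2_inner_diff_left[OF f g f])
  also have "l2_inner M ?g (\<lambda>x. f x - ?g x) = l2_inner M ?g f - l2_inner M ?g ?g"
    by (subst (1 2 3) l2_inner_commute) (simp add: l2_inner_diff_left[OF f g g])
  finally have eq: "complex_of_real (l2_sq M (\<lambda>x. f x - ?g x)) = complex_of_real (l2_sq M f)
      - (\<Sum>k\<in>F. cnj (a k) * ?I k) - ((\<Sum>k\<in>F. a k * cnj (?I k)) - (\<Sum>k\<in>F. a k * cnj (a k) * c))"
    unfolding gf fg' gg l2_inner_self[of M f] .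
  have "complex_of_real (c * l2_sq M (\<lambda>x. f x - ?g x)) = complex_of_real (c * l2_sq M f)
      - (\<Sum>k\<in>F. ?I k * cnj (?I k)) + (\<Sum>k\<in>F. (c * a k - ?I k) * cnj (c * a k - ?I k))"
    unfolding of_real_mult eq
    by (simp add: left_diff_distrib right_diff_distrib sum_distrib_left sum.distrib sum_subtractf mult_ac)
  also have "\<dots> = complex_of_real (c * l2_sq M f - (\<Sum>k\<in>F. (norm (?I k))\<^sup>2) + (\<Sum>k\<in>F. (norm (c * a k - ?I k))\<^sup>2))"
    by (simp only: of_real_add of_real_diff of_real_sum complex_norm_square)
  finally show ?thesis by (simp only: of_real_eq_iff)
qed

lemma parseval:
  assumes f: "square_integrable M f"
  shows "((\<lambda>k. (norm (l2_inner M f (e k)))\<^sup>2) has_sum c * l2_sq M f) UNIV"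
proof -
  let ?S = "\<lambda>F. \<Sum>k\<in>F. (norm (l2_inner M f (e k)))\<^sup>2"
  have bessel: "?S F \<le> c * l2_sq M f" if F: "finite F" for F
  proof -
    let ?a = "\<lambda>k. l2_inner M f (e k) / c"
    have "0 \<le> c * l2_sq M (\<lambda>x. f x - (\<Sum>k\<in>F. ?a k * e k x))"
      using c_pos by (intro mult_nonneg_nonneg l2_sq_nonneg) simp
    then show ?thesis unfolding best_approximation[OF f F] using c_pos by simp
  qed
  have approx: "\<exists>F. finite F \<and> c * l2_sq M f - \<epsilon> < ?S F" if e: "0 < \<epsilon>" for \<epsilon>
  proof -
    \<comment> \<open>The factor 2 makes the final inequality strict, as the order characterisation
      of the limit requires; \<open>c\<close> undoes the scaling in
      \<open>best_approximation\<close>.\<close>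
    have "0 < \<epsilon> / (2 * c)" using e c_pos by simp
    from dense[OF f this] obtain T where T: "lincomb e T" "l2_sq M (\<lambda>x. f x - T x) \<le> \<epsilon> / (2 * c)" by blast
    from T(1) obtain F a where F: "finite F" "T = (\<lambda>x. \<Sum>k\<in>F. a k * e k x)" by (rule lincomb_as_sum)
    have "c * l2_sq M f - ?S F \<le> c * l2_sq M (\<lambda>x. f x - T x)"
      unfolding F(2) best_approximation[OF f F(1)] by (simp add: sum_nonneg)
    also have "\<dots> \<le> c * (\<epsilon> / (2 * c))" using T(2) c_pos by (intro mult_left_mono) auto
    also have "\<dots> < \<epsilon>" using c_pos e by simp
    finally show ?thesis using F(1) by (intro exI[of _ F]) auto
  qed
  show ?thesis
    unfolding has_sum_def
  proof (rule order_tendstoI)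
    fix y assume "y < c * l2_sq M f"
    then obtain F where F: "finite F" "y < ?S F" using approx[of "c * l2_sq M f - y"] by auto
    have "y < ?S G" if "finite G" "F \<subseteq> G" for G
      using F sum_mono2[OF that, of "\<lambda>k. (norm (l2_inner M f (e k)))\<^sup>2"] by simp
    then show "\<forall>\<^sub>F G in finite_subsets_at_top UNIV. y < ?S G"
      unfolding eventually_finite_subsets_at_top using F(1) by blast
  next
    fix y assume "c * l2_sq M f < y"
    then have "?S G < y" if "finite G" for G using bessel[OF that] by simp
    then show "\<forall>\<^sub>F G in finite_subsets_at_top UNIV. ?S G < y"
      unfolding eventually_finite_subsets_at_top by blast
  qed
qed

text \<open>Polarisation over the four fourth roots of unity reduces inner products to the squared
  norms treated by \<open>parseval\<close>.\<close>

lemma parseval_inner: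
  assumes f: "square_integrable M f" and g: "square_integrable M g"
  shows "((\<lambda>k. l2_inner M f (e k) * cnj (l2_inner M g (e k))) has_sum c * l2_inner M f g) UNIV"
proof -
  \<comment> \<open>The factors 1, -1, \<i> and -\<i> are kept explicit so that all four terms are
    instances of one family in \<open>u\<close>.\<close>
  have pol: "z * cnj w = (complex_of_real ((norm (z + 1 * w))\<^sup>2) + (-1) * complex_of_real ((norm (z + (-1) * w))\<^sup>2)
      + \<i> * complex_of_real ((norm (z + \<i> * w))\<^sup>2) + (- \<i>) * complex_of_real ((norm (z + (- \<i>) * w))\<^sup>2)) / 4" for z w
    unfolding complex_norm_square by (simp add: algebra_simps)
  let ?N = "\<lambda>u k. complex_of_real ((norm (l2_inner M f (e k) + u * l2_inner M g (e k)))\<^sup>2)"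
  let ?L = "\<lambda>u. complex_of_real (c * l2_sq M (\<lambda>x. f x + u * g x))"
  have N: "(?N u has_sum ?L u) UNIV" for u
  proof -
    have ug: "square_integrable M (\<lambda>x. u * g x)" by (rule square_integrable_cmult[OF g])
    have "l2_inner M (\<lambda>x. f x + u * g x) (e k) = l2_inner M f (e k) + u * l2_inner M g (e k)" for k
      using l2_inner_add_left[OF f ug sq] by (simp add: l2_inner_cmult_left)
    then show ?thesis
      using has_sum_of_real[OF parseval[OF square_integrable_add[OF f ug]]] by (simp only:)
  qed
  have "((\<lambda>k. (?N 1 k + (-1) * ?N (-1) k + \<i> * ?N \<i> k + (- \<i>) * ?N (- \<i>) k) / 4)
      has_sum ((?L 1 + (-1) * ?L (-1) + \<i> * ?L \<i> + (- \<i>) * ?L (- \<i>)) / 4)) UNIV"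
    by (intro has_sum_divide_const has_sum_add has_sum_cmult_right N)
  also have "(\<lambda>k. (?N 1 k + (-1) * ?N (-1) k + \<i> * ?N \<i> k + (- \<i>) * ?N (- \<i>) k) / 4)
      = (\<lambda>k. l2_inner M f (e k) * cnj (l2_inner M g (e k)))"
    by (rule ext) (simp only: pol[symmetric])
  also have "(?L 1 + (-1) * ?L (-1) + \<i> * ?L \<i> + (- \<i>) * ?L (- \<i>)) / 4 = c * l2_inner M f g"
  proof -
    have i: "integrable M (\<lambda>x. complex_of_real ((norm (f x + u * g x))\<^sup>2))" for u
      using square_integrable_add[OF f square_integrable_cmult[OF g, of u]]
      by (intro integrable_of_real) (simp add: square_integrable_def)
    let ?J = "\<lambda>u. LINT x|M. complex_of_real ((norm (f x + u * g x))\<^sup>2)"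
    have "l2_inner M f g = (LINT x|M. (complex_of_real ((norm (f x + 1 * g x))\<^sup>2) + (-1) * complex_of_real ((norm (f x + (-1) * g x))\<^sup>2)
      + \<i> * complex_of_real ((norm (f x + \<i> * g x))\<^sup>2) + (- \<i>) * complex_of_real ((norm (f x + (- \<i>) * g x))\<^sup>2)) / 4)"
      unfolding l2_inner_def by (subst pol) simp
    also have "\<dots> = (?J 1 + (-1) * ?J (-1) + \<i> * ?J \<i> + (- \<i>) * ?J (- \<i>)) / 4"
      by (simp only: integral_divide_zero Bochner_Integration.integral_add Bochner_Integration.integrable_add
          integrable_mult_right integral_mult_right_zero i)
    finally have *: "l2_inner M f g = (?J 1 + (-1) * ?J (-1) + \<i> * ?J \<i> + (- \<i>) * ?J (- \<i>)) / 4" .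
    have J: "?J u = complex_of_real (l2_sq M (\<lambda>x. f x + u * g x))" for u
      unfolding l2_sq_def by (rule integral_complex_of_real)
    show ?thesis unfolding * J by (simp add: algebra_simps)
  qed
  finally show ?thesis .
qed

end

section \<open>Fourier transforms of the Shannon wavelets\<close>

abbreviation dyadic :: "int \<Rightarrow> real" where
  "dyadic j \<equiv> 2 powr real_of_int j"

lemma
  fixes f :: "'d::finite \<Rightarrow> real \<Rightarrow> complex"
  assumes f: "\<And>i. integrable lborel (f i)"
  shows integrable_lborel_vec_prod: "integrable lborel (\<lambda>x::real ^ 'd. \<Prod>i\<in>UNIV. f i (x $ i))"
    and integral_lborel_vec_prod:
      "(LINT x|lborel. (\<Prod>i\<in>UNIV. f i ((x :: real ^ 'd) $ i))) = (\<Prod>i\<in>UNIV. LINT t|lborel. f i t)"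
proof -
  have bij: "bij_betw (\<lambda>i. axis i 1 :: real ^ 'd) UNIV Basis"
    by (auto simp: bij_betw_def inj_on_def Basis_vec_def axis_eq_axis)
  let ?i = "inv_into UNIV (\<lambda>i. axis i 1 :: real ^ 'd)"
  have i: "?i (axis i 1) = i" for i :: 'd by (rule inv_f_f) (use bij in \<open>auto simp: bij_betw_def\<close>)
  have *: "(\<Prod>b\<in>Basis. h (?i b) b) = (\<Prod>i\<in>UNIV. h i (axis i 1))" for h :: "'d \<Rightarrow> real ^ 'd \<Rightarrow> complex"
    unfolding prod.reindex_bij_betw[OF bij, symmetric] i ..
  have e: "(\<Prod>i\<in>UNIV. f i (x $ i)) = (\<Prod>b\<in>Basis. f (?i b) (x \<bullet> b))" for x :: "real ^ 'd"
    using *[of "\<lambda>i b. f i (x \<bullet> b)"] by (simp add: inner_axis)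
  show "integrable lborel (\<lambda>x::real ^ 'd. \<Prod>i\<in>UNIV. f i (x $ i))"
    unfolding e by (rule integrable_lborel_prod) (rule f)
  show "(LINT x|lborel. (\<Prod>i\<in>UNIV. f i ((x :: real ^ 'd) $ i))) = (\<Prod>i\<in>UNIV. LINT t|lborel. f i t)"
    unfolding e using integral_lborel_prod[of "\<lambda>b. f (?i b)"] f *[of "\<lambda>i b. LINT t|lborel. f i t"] by simp
qed

abbreviation shannon_support :: "real set" where
  "shannon_support \<equiv> {- 2 * pi .. - pi} \<union> {pi .. 2 * pi}"

lemma norm_shannon_hat: "norm (shannon_hat \<xi>) = indicator shannon_support \<xi>"
proof -
  have "norm (exp (- \<i> * complex_of_real \<xi> / 2)) = 1" by simp
  then show ?thesis unfolding shannon_hat_def norm_mult by (auto simp: indicator_def)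
qed

lemma shannon_hat_cnj: "shannon_hat \<xi> * cnj (shannon_hat \<xi>) = indicator shannon_support \<xi>"
  unfolding complex_norm_square[symmetric] norm_shannon_hat by (auto simp: indicator_def)

lemma shannon_hat_measurable [measurable]: "shannon_hat \<in> borel_measurable borel"
  unfolding shannon_hat_def[abs_def] by measurable

lemma integrable_shannon_hat: "integrable lborel shannon_hat"
proof (rule Bochner_Integration.integrable_bound)
  show "integrable lborel (indicator {- 2 * pi .. 2 * pi} :: real \<Rightarrow> real)"
    by (rule integrable_real_indicator) auto
  show "AE x in lborel. norm (shannon_hat x) \<le> norm (indicator {- 2 * pi .. 2 * pi} x :: real)"
    unfolding norm_shannon_hat using pi_gt_zero by (intro AE_I2) (auto simp: indicator_def)
qed measurable

text \<open>Shifted by 2 pi, the negative interval becomes [0, pi], so the two intervals form one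
  full period. For nonzero \<open>n\<close> the antiderivative is periodic: it agrees at -pi and pi
  and at -2 pi and 2 pi, and the boundary terms cancel.\<close>

lemma integral_exp_shannon_support:
  fixes n :: int
  shows "(LINT t|lborel. iexp (of_int n * t) * indicator shannon_support t) = (if n = 0 then 2 * pi else 0)"
proof -
  let ?f = "\<lambda>t. iexp (of_int n * t)"
  define F where "F t = (if n = 0 then complex_of_real t else iexp (of_int n * t) / (\<i> * of_int n))" for t
  have F: "(F has_vector_derivative ?f t) (at t within S)" for t S
  proof (cases "n = 0")
    case True
    then show ?thesis by (auto simp: F_def[abs_def] intro!: derivative_eq_intros has_vector_derivative_of_real)
  next
    case False
    have "((\<lambda>z. exp (\<i> * (of_int n * z)) / (\<i> * of_int n)) has_field_derivative ?f t) (at (complex_of_real t))"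
      using False by (auto intro!: derivative_eq_intros simp: field_simps)
    from has_vector_derivative_real_field[OF this, of S] show ?thesis using False by (simp add: F_def[abs_def])
  qed
  have c: "continuous_on S ?f" for S by (intro continuous_intros)
  have I: "has_bochner_integral lborel (\<lambda>t. indicator {a..b} t *\<^sub>R ?f t) (F b - F a)" if "a \<le> b" for a b
    by (rule has_bochner_integral_FTC_Icc[OF that F c])
  have "has_bochner_integral lborel (\<lambda>t. indicator {- 2 * pi..- pi} t *\<^sub>R ?f t + indicator {pi..2 * pi} t *\<^sub>R ?f t)
      ((F (- pi) - F (- 2 * pi)) + (F (2 * pi) - F pi))"
    by (intro has_bochner_integral_add I) auto
  also have "(\<lambda>t. indicator {- 2 * pi..- pi} t *\<^sub>R ?f t + indicator {pi..2 * pi} t *\<^sub>R ?f t)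
      = (\<lambda>t. ?f t * indicator shannon_support t)"
  proof
    fix t
    have "\<not> (t \<le> - pi \<and> pi \<le> t)" using pi_gt_zero by linarith
    then show "indicator {- 2 * pi..- pi} t *\<^sub>R ?f t + indicator {pi..2 * pi} t *\<^sub>R ?f t = ?f t * indicator shannon_support t"
      by (auto simp: indicator_def)
  qed
  also have "(F (- pi) - F (- 2 * pi)) + (F (2 * pi) - F pi) = (if n = 0 then 2 * pi else 0)"
  proof (cases "n = 0")
    case False
    have per: "F (t + 2 * pi) = F t" for t
    proof -
      have "iexp (of_int n * (t + 2 * pi)) = iexp (of_int n * t) * exp (2 * of_int n * pi * \<i>)"
        unfolding exp_add[symmetric] by (simp add: algebra_simps)
      also have "exp (2 * of_int n * pi * \<i>) = 1" by (rule exp_integer_2pi) simp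
      finally show ?thesis using False by (simp add: F_def)
    qed
    have "F pi = F (- pi)" using per[of "- pi"] by simp
    moreover have "F (2 * pi) = F (- 2 * pi)" using per[of "- 2 * pi"] per[of 0] by simp
    ultimately show ?thesis using False by simp
  qed (simp add: F_def)
  finally show ?thesis by (rule has_bochner_integral_integral_eq)
qed

text \<open>The transform that the scaling and translation rules predict for
  \<open>shannon_wavelet j k\<close>.\<close>

definition wavelet_hat1 :: "int \<Rightarrow> int \<Rightarrow> real \<Rightarrow> complex" where
  "wavelet_hat1 j k \<xi> = complex_of_real (2 powr (- (real_of_int j / 2))) *
     exp (- \<i> * complex_of_real (of_int k * (\<xi> / dyadic j))) * shannon_hat (\<xi> / dyadic j)"

lemma integrable_wavelet_hat1: "integrable lborel (wavelet_hat1 j k)"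
proof -
  have "integrable lborel (\<lambda>\<xi>. shannon_hat (0 + (1 / dyadic j) * \<xi>))"
    by (rule lborel_integrable_real_affine[OF integrable_shannon_hat]) simp
  then have "integrable lborel (\<lambda>\<xi>. complex_of_real (2 powr (- (real_of_int j / 2))) * shannon_hat (\<xi> / dyadic j))"
    by simp
  then show ?thesis
    by (rule Bochner_Integration.integrable_bound) (auto simp: wavelet_hat1_def[abs_def] norm_mult)
qed

lemma wavelet_hat1_measurable [measurable]: "wavelet_hat1 j k \<in> borel_measurable borel"
  using borel_measurable_integrable[OF integrable_wavelet_hat1] by simp

lemma norm_wavelet_hat1:
  "norm (wavelet_hat1 j k \<xi>) = 2 powr (- (real_of_int j / 2)) * indicator shannon_support (\<xi> / dyadic j)"
  by (simp add: wavelet_hat1_def norm_mult norm_shannon_hat)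

text \<open>The identification goes through the inverse transform because the wavelet, whose
  transform is discontinuous, is not integrable, while \<open>wavelet_hat1\<close> is. The
  substitution \<xi> = 2^j \<eta> leads back to the integral that defines
  \<open>shannon\<close>.\<close>

lemma inverse_fourier_wavelet_hat1: "inverse_fourier (wavelet_hat1 j k) = shannon_wavelet j k"
proof
  fix x :: real
  let ?a = "dyadic j"
  let ?h = "2 powr (real_of_int j / 2)"
  have ah: "?a = ?h * ?h" by (simp add: powr_add[symmetric])
  have h: "2 powr (- (real_of_int j / 2)) = 1 / ?h" by (simp add: powr_minus_divide)
  have "(LINT \<xi>|lborel. iexp (x * \<xi>) * wavelet_hat1 j k \<xi>)
      = \<bar>?a\<bar> *\<^sub>R (LINT \<eta>|lborel. iexp (x * (0 + ?a * \<eta>)) * wavelet_hat1 j k (0 + ?a * \<eta>))"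
    by (rule lborel_integral_real_affine) simp
  also have "(\<lambda>\<eta>. iexp (x * (0 + ?a * \<eta>)) * wavelet_hat1 j k (0 + ?a * \<eta>))
     = (\<lambda>\<eta>. complex_of_real (1 / ?h) * (iexp ((?a * x - of_int k) * \<eta>) * shannon_hat \<eta>))"
  proof
    fix \<eta>
    have "iexp ((?a * x - of_int k) * \<eta>) = iexp (x * (?a * \<eta>)) * exp (- \<i> * complex_of_real (of_int k * \<eta>))"
      unfolding exp_add[symmetric] by (simp add: algebra_simps)
    then show "iexp (x * (0 + ?a * \<eta>)) * wavelet_hat1 j k (0 + ?a * \<eta>)
      = complex_of_real (1 / ?h) * (iexp ((?a * x - of_int k) * \<eta>) * shannon_hat \<eta>)"
      by (simp add: wavelet_hat1_def h)
  qed
  also have "\<bar>?a\<bar> *\<^sub>R (LINT \<eta>|lborel. complex_of_real (1 / ?h) * (iexp ((?a * x - of_int k) * \<eta>) * shannon_hat \<eta>))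
     = ?h * (LINT \<eta>|lborel. iexp ((?a * x - of_int k) * \<eta>) * shannon_hat \<eta>)"
  proof -
    have "complex_of_real ?a * (complex_of_real (1 / ?h) * z) = complex_of_real ?h * z" for z
      unfolding ah by simp
    then show ?thesis unfolding integral_mult_right_zero scaleR_conv_of_real by simp
  qed
  finally show "inverse_fourier (wavelet_hat1 j k) x = shannon_wavelet j k x"
    unfolding inverse_fourier_def shannon_wavelet_def shannon_def by (simp add: inner_real_def)
qed

lemma wavelet_hat1_orthogonal:
  "(LINT \<xi>|lborel. wavelet_hat1 j k \<xi> * cnj (wavelet_hat1 j l \<xi>)) = (if k = l then 2 * pi else 0)"
proof -
  let ?a = "dyadic j"
  let ?h = "2 powr (- (real_of_int j / 2))"
  have ah: "?a * (?h * ?h) = 1" by (simp add: powr_add[symmetric])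
  have "(LINT \<xi>|lborel. wavelet_hat1 j k \<xi> * cnj (wavelet_hat1 j l \<xi>))
    = \<bar>?a\<bar> *\<^sub>R (LINT t|lborel. wavelet_hat1 j k (0 + ?a * t) * cnj (wavelet_hat1 j l (0 + ?a * t)))"
    by (rule lborel_integral_real_affine) simp
  also have "(\<lambda>t. wavelet_hat1 j k (0 + ?a * t) * cnj (wavelet_hat1 j l (0 + ?a * t)))
    = (\<lambda>t. complex_of_real (?h * ?h) * (iexp (of_int (l - k) * t) * indicator shannon_support t))"
  proof
    fix t
    have e: "iexp (of_int (l - k) * t) = exp (- \<i> * complex_of_real (of_int k * t)) * cnj (exp (- \<i> * complex_of_real (of_int l * t)))"
      unfolding exp_cnj exp_add[symmetric] by (simp add: algebra_simps)
    have "wavelet_hat1 j k (0 + ?a * t) * cnj (wavelet_hat1 j l (0 + ?a * t))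
      = complex_of_real (?h * ?h) * ((exp (- \<i> * complex_of_real (of_int k * t)) * cnj (exp (- \<i> * complex_of_real (of_int l * t))))
         * (shannon_hat t * cnj (shannon_hat t)))"
      by (simp add: wavelet_hat1_def del: exp_cnj mult_minus_left)
    then show "wavelet_hat1 j k (0 + ?a * t) * cnj (wavelet_hat1 j l (0 + ?a * t))
      = complex_of_real (?h * ?h) * (iexp (of_int (l - k) * t) * indicator shannon_support t)"
      unfolding e shannon_hat_cnj .
  qed
  also have "\<bar>?a\<bar> *\<^sub>R (LINT t|lborel. complex_of_real (?h * ?h) * (iexp (of_int (l - k) * t) * indicator shannon_support t))
     = complex_of_real (?a * (?h * ?h)) * (LINT t|lborel. iexp (of_int (l - k) * t) * indicator shannon_support t)"
    unfolding integral_mult_right_zero scaleR_conv_of_real by simp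
  also have "\<dots> = (if k = l then 2 * pi else 0)"
    unfolding ah integral_exp_shannon_support by simp
  finally show ?thesis .
qed

definition wavelet_hat :: "'d::finite wavelet_index \<Rightarrow> real ^ 'd \<Rightarrow> complex" where
  "wavelet_hat q \<xi> = (\<Prod>i\<in>UNIV. wavelet_hat1 (fst q $ i) (snd q $ i) (\<xi> $ i))"

lemma integrable_wavelet_hat: "integrable lborel (wavelet_hat q)"
  unfolding wavelet_hat_def[abs_def] by (rule integrable_lborel_vec_prod[OF integrable_wavelet_hat1])

lemma wavelet_hat_measurable [measurable]: "wavelet_hat q \<in> borel_measurable borel"
  using borel_measurable_integrable[OF integrable_wavelet_hat] by simp

lemma inverse_fourier_wavelet_hat:
  "inverse_fourier (wavelet_hat q) = tensor_wavelet (fst q) (snd q)" for q :: "'d::finite wavelet_index"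
proof
  fix x :: "real ^ 'd"
  let ?f = "\<lambda>i t. iexp (x $ i * t) * wavelet_hat1 (fst q $ i) (snd q $ i) t"
  have int: "integrable lborel (?f i)" for i
    by (rule Bochner_Integration.integrable_bound[OF integrable_wavelet_hat1[of "fst q $ i" "snd q $ i"]])
       (auto simp: norm_mult)
  have "(LINT \<xi>|lborel. iexp (x \<bullet> \<xi>) * wavelet_hat q \<xi>) = (LINT \<xi>|lborel. (\<Prod>i\<in>UNIV. ?f i (\<xi> $ i)))"
    unfolding prod.distrib wavelet_hat_def
    by (simp add: inner_vec_def exp_sum[symmetric] sum_distrib_left)
  also have "\<dots> = (\<Prod>i\<in>UNIV. LINT t|lborel. ?f i t)" by (rule integral_lborel_vec_prod[OF int])
  finally have "inverse_fourier (wavelet_hat q) x = (\<Prod>i\<in>UNIV. LINT t|lborel. ?f i t) / (\<Prod>i::'d\<in>UNIV. complex_of_real (2 * pi))"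
    unfolding inverse_fourier_def by simp
  also have "\<dots> = (\<Prod>i\<in>UNIV. inverse_fourier (wavelet_hat1 (fst q $ i) (snd q $ i)) (x $ i))"
    unfolding prod_dividef[symmetric] inverse_fourier_def by (simp add: inner_real_def)
  finally show "inverse_fourier (wavelet_hat q) x = tensor_wavelet (fst q) (snd q) x"
    unfolding inverse_fourier_wavelet_hat1 tensor_wavelet_def .
qed

lemma wavelet_hat_orthogonal:
  "(LINT \<xi>|lborel. wavelet_hat (j, k) \<xi> * cnj (wavelet_hat (j, l) \<xi>))
    = (if k = l then complex_of_real ((2 * pi) ^ CARD('d)) else 0)" for j k l :: "int ^ 'd::finite"
proof -
  have int: "integrable lborel (\<lambda>t. wavelet_hat1 j k t * cnj (wavelet_hat1 j l t))" for j k l :: int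
  proof (rule Bochner_Integration.integrable_bound)
    show "integrable lborel (\<lambda>t. complex_of_real (2 powr (- (real_of_int j / 2))) * wavelet_hat1 j k t)"
      using integrable_wavelet_hat1 by simp
    show "AE t in lborel. norm (wavelet_hat1 j k t * cnj (wavelet_hat1 j l t)) \<le> norm (complex_of_real (2 powr (- (real_of_int j / 2))) * wavelet_hat1 j k t)"
      by (auto simp: norm_mult norm_wavelet_hat1 indicator_def)
  qed measurable
  have "(LINT \<xi>|lborel. wavelet_hat (j, k) \<xi> * cnj (wavelet_hat (j, l) \<xi>))
     = (LINT \<xi>|lborel. (\<Prod>i\<in>UNIV. wavelet_hat1 (j $ i) (k $ i) (\<xi> $ i) * cnj (wavelet_hat1 (j $ i) (l $ i) (\<xi> $ i))))"
    unfolding wavelet_hat_def prod.distrib by simp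
  also have "\<dots> = (\<Prod>i\<in>UNIV. complex_of_real (if k $ i = l $ i then 2 * pi else 0))"
    by (subst integral_lborel_vec_prod[OF int]) (simp add: wavelet_hat1_orthogonal)
  also have "\<dots> = (if k = l then complex_of_real ((2 * pi) ^ CARD('d)) else 0)"
  proof (cases "k = l")
    case False
    then obtain i where "k $ i \<noteq> l $ i" by (auto simp: vec_eq_iff)
    then have "(\<Prod>i\<in>UNIV. complex_of_real (if k $ i = l $ i then 2 * pi else 0)) = 0"
      by (intro prod_zero) auto
    then show ?thesis using False by simp
  qed simp
  finally show ?thesis .
qed

section \<open>Frequency boxes, and the wavelets as elements of every Sobolev space\<close>

lemma shannon_support_scaled:
  "t / dyadic j \<in> shannon_support \<longleftrightarrow>
   t \<in> {- (dyadic (j + 1) * pi) .. - (dyadic j * pi)} \<union> {dyadic j * pi .. dyadic (j + 1) * pi}"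
proof -
  have "dyadic (j + 1) = 2 * dyadic j" by (simp add: powr_add)
  moreover have "(0::real) < dyadic j" by simp
  ultimately show ?thesis by (simp add: field_simps)
qed

lemma mem_frequency_box: "\<xi> \<in> frequency_box j \<longleftrightarrow> (\<forall>i. \<xi> $ i / dyadic (j $ i) \<in> shannon_support)"
  unfolding frequency_box_def shannon_support_scaled by simp

text \<open>The modulus on the frequency box, which is constant there, of every wavelet transform of
  level \<open>j\<close>.\<close>

definition wavelet_amplitude :: "int ^ 'd::finite \<Rightarrow> real" where
  "wavelet_amplitude j = (\<Prod>i\<in>UNIV. 2 powr (- (real_of_int (j $ i) / 2)))"

lemma wavelet_amplitude_pos: "0 < wavelet_amplitude j"
  unfolding wavelet_amplitude_def by (intro prod_pos) simp

lemma prod_indicator_all: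
  "(\<Prod>i\<in>UNIV. indicator S (x i)) = (of_bool (\<forall>i. x (i :: 'd::finite) \<in> S) :: real)"
  by (auto simp: indicator_def intro!: prod_zero)

lemma norm_wavelet_hat: "norm (wavelet_hat q \<xi>) = wavelet_amplitude (fst q) * indicator (frequency_box (fst q)) \<xi>"
proof -
  have "norm (wavelet_hat q \<xi>) = wavelet_amplitude (fst q) * (\<Prod>i\<in>UNIV. indicator shannon_support (\<xi> $ i / dyadic (fst q $ i)))"
    unfolding wavelet_hat_def prod_norm[symmetric] norm_wavelet_hat1 prod.distrib wavelet_amplitude_def ..
  also have "(\<Prod>i\<in>UNIV. indicator shannon_support (\<xi> $ i / dyadic (fst q $ i))) = (indicator (frequency_box (fst q)) \<xi> :: real)"
    unfolding prod_indicator_all unfolding indicator_def mem_frequency_box by simp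
  finally show ?thesis .
qed

lemma vec_nth_measurable [measurable]: "(\<lambda>x::real ^ 'd. x $ i) \<in> borel_measurable borel"
  by (intro borel_measurable_continuous_onI continuous_intros)

lemma frequency_box_measurable [measurable]: "frequency_box j \<in> sets borel"
proof -
  have "{\<xi> \<in> space borel. \<forall>i. \<xi> $ i / dyadic (j $ i) \<in> shannon_support} \<in> sets borel" by measurable
  then show ?thesis unfolding mem_frequency_box[symmetric] by simp
qed

lemma bounded_frequency_box: "bounded (frequency_box j)" for j :: "int ^ 'd::finite"
proof -
  have "norm \<xi> \<le> (\<Sum>i\<in>UNIV. dyadic (j $ i + 1) * pi)" if "\<xi> \<in> frequency_box j" for \<xi>
  proof -
    have c: "\<bar>\<xi> $ i\<bar> \<le> dyadic (j $ i + 1) * pi" for i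
    proof -
      have "0 < dyadic (j $ i) * pi" by simp
      moreover have "\<xi> $ i \<in> {- (dyadic (j $ i + 1) * pi) .. - (dyadic (j $ i) * pi)} \<union>
         {dyadic (j $ i) * pi .. dyadic (j $ i + 1) * pi}"
        using that by (auto simp: frequency_box_def)
      ultimately show ?thesis unfolding abs_le_iff Un_iff atLeastAtMost_iff by linarith
    qed
    show ?thesis by (rule order_trans[OF norm_le_l1_cart sum_mono[OF c]])
  qed
  then show ?thesis unfolding bounded_iff by blast
qed

lemma emeasure_frequency_box: "emeasure lborel (frequency_box j) < \<infinity>"
  by (rule emeasure_bounded_finite[OF bounded_frequency_box])

text \<open>The box has compact closure and the weight is continuous. As the exponent may have
  either sign, this puts each wavelet in every Sobolev space and also makes every Sobolev
  distribution square integrable on a box.\<close>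

lemma sobolev_weight_bounded: "\<exists>C. \<forall>\<xi>\<in>frequency_box j. (1 + (norm \<xi>)\<^sup>2) powr s \<le> C"
proof -
  have pos: "1 + (norm x)\<^sup>2 \<noteq> 0" for x :: "real ^ 'a" using zero_le_power2[of "norm x"] by linarith
  have "continuous_on (closure (frequency_box j)) (\<lambda>\<xi>. (1 + (norm \<xi>)\<^sup>2) powr s)"
    by (intro continuous_intros) (use pos in auto)
  moreover have "compact (closure (frequency_box j))" using bounded_frequency_box by (simp add: compact_closure)
  ultimately have "bounded ((\<lambda>\<xi>. (1 + (norm \<xi>)\<^sup>2) powr s) ` closure (frequency_box j))"
    by (intro compact_imp_bounded compact_continuous_image)
  then show ?thesis
    using closure_subset[of "frequency_box j"] unfolding bounded_iff by (auto simp: subset_iff)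
qed

lemma
  fixes q :: "'d::finite wavelet_index"
  shows wavelet_dist_sobolev: "wavelet_dist q \<in> sobolev s"
    and dist_fourier_wavelet: "AE \<xi> in lborel. dist_fourier (wavelet_dist q) \<xi> = wavelet_hat q \<xi>"
proof -
  have w: "wavelet_dist q = distribution_of (inverse_fourier (wavelet_hat q))"
    unfolding wavelet_dist_def inverse_fourier_wavelet_hat ..
  let ?B = "frequency_box (fst q)"
  let ?w = "\<lambda>\<xi>. (1 + (norm \<xi>)\<^sup>2) powr (s / 2)"
  obtain C where C: "\<And>\<xi>. \<xi> \<in> ?B \<Longrightarrow> ?w \<xi> \<le> C" using sobolev_weight_bounded by blast
  show "wavelet_dist q \<in> sobolev s"
    unfolding w
  proof (rule inverse_fourier_sobolev[OF integrable_wavelet_hat])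
    have "integrable lborel (\<lambda>\<xi>. (C * wavelet_amplitude (fst q))\<^sup>2 * indicator ?B \<xi>)"
      using emeasure_frequency_box by (intro integrable_mult_right integrable_real_indicator) auto
    then show "integrable lborel (\<lambda>\<xi>. (norm (?w \<xi> *\<^sub>R wavelet_hat q \<xi>))\<^sup>2)"
    proof (rule Bochner_Integration.integrable_bound)
      have "(norm (?w \<xi> *\<^sub>R wavelet_hat q \<xi>))\<^sup>2 \<le> (C * wavelet_amplitude (fst q))\<^sup>2 * indicator ?B \<xi>" for \<xi>
      proof (cases "\<xi> \<in> ?B")
        case True
        have "(norm (?w \<xi> *\<^sub>R wavelet_hat q \<xi>))\<^sup>2 = (\<bar>?w \<xi>\<bar> * wavelet_amplitude (fst q))\<^sup>2"
          using True by (simp only: norm_scaleR norm_wavelet_hat indicator_simps mult_1_right real_norm_def)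
        also have "\<dots> \<le> (C * wavelet_amplitude (fst q))\<^sup>2"
          using C[OF True] wavelet_amplitude_pos[of "fst q"] by (intro power_mono mult_right_mono) auto
        finally show ?thesis using True by simp
      next
        case False
        then have "norm (wavelet_hat q \<xi>) = 0" by (simp add: norm_wavelet_hat)
        then show ?thesis using False by simp
      qed
      then show "AE \<xi> in lborel. norm ((norm (?w \<xi> *\<^sub>R wavelet_hat q \<xi>))\<^sup>2) \<le> norm ((C * wavelet_amplitude (fst q))\<^sup>2 * indicator ?B \<xi>)"
        by (auto simp: indicator_def)
    qed measurable
  qed
  show "AE \<xi> in lborel. dist_fourier (wavelet_dist q) \<xi> = wavelet_hat q \<xi>"
    unfolding w by (rule dist_fourier_AE_eq[OF is_fourier_of_inverse_fourier[OF integrable_wavelet_hat]])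
qed

section \<open>Completeness of the trigonometric system on a frequency box\<close>

text \<open>Membership in the closed linear span of \<open>e\<close> in L2.\<close>

definition l2_approximable :: "'a measure \<Rightarrow> ('k \<Rightarrow> 'a \<Rightarrow> complex) \<Rightarrow> ('a \<Rightarrow> complex) \<Rightarrow> bool" where
  "l2_approximable M e f \<longleftrightarrow> square_integrable M f \<and> (\<forall>\<epsilon>>0. \<exists>T. lincomb e T \<and> l2_sq M (\<lambda>x. f x - T x) \<le> \<epsilon>)"

lemma lincomb_square_integrable:
  assumes "\<And>k. square_integrable M (e k)" "lincomb e T"
  shows "square_integrable M T"
  using assms(2)
proof induction
  case (step T a k)
  show ?case by (rule square_integrable_add[OF square_integrable_cmult[OF assms(1)] step.IH])
qed (rule square_integrable_zero)

lemma square_integrable_cong_AE: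
  assumes f: "square_integrable M f" and [measurable]: "g \<in> borel_measurable M" and eq: "AE x in M. f x = g x"
  shows "square_integrable M g"
proof -
  have [measurable]: "f \<in> borel_measurable M" using f by (rule square_integrable_measurable)
  have "integrable M (\<lambda>x. (norm (g x))\<^sup>2)"
  proof (rule integrable_cong_AE_imp)
    show "integrable M (\<lambda>x. (norm (f x))\<^sup>2)" using f by (simp add: square_integrable_def)
    show "AE x in M. (norm (f x))\<^sup>2 = (norm (g x))\<^sup>2" using eq by eventually_elim simp
  qed measurable
  then show ?thesis by (simp add: square_integrable_def)
qed

lemma l2_inner_cong_AE:
  assumes "AE x in M. f x = g x"
    and [measurable]: "f \<in> borel_measurable M" "g \<in> borel_measurable M" "h \<in> borel_measurable M"
  shows "l2_inner M f h = l2_inner M g h"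
  unfolding l2_inner_def
proof (rule integral_cong_AE)
  show "AE x in M. f x * cnj (h x) = g x * cnj (h x)" using assms(1) by eventually_elim simp
qed measurable

lemma l2_sq_cong_AE:
  assumes "AE x in M. f x = g x" "square_integrable M f" "square_integrable M g"
  shows "l2_sq M f = l2_sq M g"
  unfolding l2_sq_def
proof (rule integral_cong_AE)
  show "AE x in M. (norm (f x))\<^sup>2 = (norm (g x))\<^sup>2" using assms(1) by eventually_elim simp
qed (use assms in \<open>auto simp: square_integrable_def\<close>)

lemma l2_sq_cmult: "l2_sq M (\<lambda>x. c * f x) = (norm c)\<^sup>2 * l2_sq M f"
  unfolding l2_sq_def by (simp add: norm_mult power_mult_distrib)

context
  fixes M :: "'a measure" and e :: "'k \<Rightarrow> 'a \<Rightarrow> complex"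
  assumes e: "\<And>k. square_integrable M (e k)"
begin

lemma l2_approximable_lincomb: "lincomb e T \<Longrightarrow> l2_approximable M e T"
  unfolding l2_approximable_def
  by (auto simp: l2_sq_def lincomb_square_integrable[OF e] intro!: exI[of _ T])

lemma l2_approximable_closure:
  assumes f: "square_integrable M f"
    and g: "\<And>\<epsilon>. 0 < \<epsilon> \<Longrightarrow> \<exists>g. l2_approximable M e g \<and> l2_sq M (\<lambda>x. f x - g x) \<le> \<epsilon>"
  shows "l2_approximable M e f"
  unfolding l2_approximable_def
proof (intro conjI allI impI f)
  fix \<epsilon> :: real assume "0 < \<epsilon>"
  \<comment> \<open>Squared distances satisfy the triangle inequality only up to a factor 2, so each
    of the two errors may use a quarter of \<epsilon>.\<close>
  then have \<epsilon>: "0 < \<epsilon> / 4" by simp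
  obtain g where g: "l2_approximable M e g" "l2_sq M (\<lambda>x. f x - g x) \<le> \<epsilon> / 4" using g[OF \<epsilon>] by blast
  then obtain T where T: "lincomb e T" "l2_sq M (\<lambda>x. g x - T x) \<le> \<epsilon> / 4"
    using \<epsilon> unfolding l2_approximable_def by blast
  have gs: "square_integrable M g" using g(1) by (simp add: l2_approximable_def)
  have "l2_sq M (\<lambda>x. f x - T x) = l2_sq M (\<lambda>x. (f x - g x) + (g x - T x))" by simp
  also have "\<dots> \<le> 2 * l2_sq M (\<lambda>x. f x - g x) + 2 * l2_sq M (\<lambda>x. g x - T x)"
    by (intro l2_sq_add_le square_integrable_diff f gs lincomb_square_integrable[OF e T(1)])
  also have "\<dots> \<le> \<epsilon>" using g(2) T(2) by simp
  finally show "\<exists>T. lincomb e T \<and> l2_sq M (\<lambda>x. f x - T x) \<le> \<epsilon>" using T(1) by blast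
qed

lemma l2_approximable_add:
  assumes f: "l2_approximable M e f" and g: "l2_approximable M e g"
  shows "l2_approximable M e (\<lambda>x. f x + g x)"
  unfolding l2_approximable_def
proof (intro conjI allI impI)
  have fs: "square_integrable M f" and gs: "square_integrable M g" using f g by (auto simp: l2_approximable_def)
  then show "square_integrable M (\<lambda>x. f x + g x)" by (rule square_integrable_add)
  fix \<epsilon> :: real assume "0 < \<epsilon>"
  then have \<epsilon>: "0 < \<epsilon> / 4" by simp
  obtain S where S: "lincomb e S" "l2_sq M (\<lambda>x. f x - S x) \<le> \<epsilon> / 4"
    using \<epsilon> f unfolding l2_approximable_def by blast
  obtain T where T: "lincomb e T" "l2_sq M (\<lambda>x. g x - T x) \<le> \<epsilon> / 4"
    using \<epsilon> g unfolding l2_approximable_def by blast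
  have "l2_sq M (\<lambda>x. f x + g x - (S x + T x)) = l2_sq M (\<lambda>x. (f x - S x) + (g x - T x))"
    by (simp add: algebra_simps)
  also have "\<dots> \<le> 2 * l2_sq M (\<lambda>x. f x - S x) + 2 * l2_sq M (\<lambda>x. g x - T x)"
    by (intro l2_sq_add_le square_integrable_diff fs gs lincomb_square_integrable[OF e S(1)]
        lincomb_square_integrable[OF e T(1)])
  also have "\<dots> \<le> \<epsilon>" using S(2) T(2) by simp
  finally show "\<exists>T. lincomb e T \<and> l2_sq M (\<lambda>x. f x + g x - T x) \<le> \<epsilon>"
    using lincomb_add[OF S(1) T(1)] by blast
qed

lemma l2_approximable_cmult:
  assumes f: "l2_approximable M e f"
  shows "l2_approximable M e (\<lambda>x. c * f x)"
  unfolding l2_approximable_def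
proof (intro conjI allI impI)
  show "square_integrable M (\<lambda>x. c * f x)" using f by (auto simp: l2_approximable_def intro: square_integrable_cmult)
  fix \<epsilon> :: real assume \<epsilon>: "0 < \<epsilon>"
  \<comment> \<open>The summand 1 keeps the divisor positive when \<open>c\<close> is zero.\<close>
  have p: "0 < 1 + (norm c)\<^sup>2" using zero_le_power2[of "norm c"] by linarith
  then have "0 < \<epsilon> / (1 + (norm c)\<^sup>2)" using \<epsilon> by simp
  then obtain T where T: "lincomb e T" "l2_sq M (\<lambda>x. f x - T x) \<le> \<epsilon> / (1 + (norm c)\<^sup>2)"
    using f unfolding l2_approximable_def by blast
  have "l2_sq M (\<lambda>x. c * f x - c * T x) = (norm c)\<^sup>2 * l2_sq M (\<lambda>x. f x - T x)"
    unfolding right_diff_distrib[symmetric] l2_sq_cmult ..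
  also have "\<dots> \<le> (1 + (norm c)\<^sup>2) * (\<epsilon> / (1 + (norm c)\<^sup>2))"
    using T(2) p by (intro mult_mono) (auto simp: l2_sq_nonneg)
  also have "\<dots> = \<epsilon>" using p by simp
  finally show "\<exists>T. lincomb e T \<and> l2_sq M (\<lambda>x. c * f x - T x) \<le> \<epsilon>"
    using lincomb_cmult[OF T(1)] by blast
qed

text \<open>Dominated convergence for the squared differences, with majorant 4 w. Below,
  \<open>w\<close> is a constant in the monotone class argument and the squared modulus of the limit
  when functions are truncated.\<close>

lemma l2_approximable_lim:
  assumes F: "\<And>n::nat. l2_approximable M e (F n)" and [measurable]: "f \<in> borel_measurable M"
    and w: "integrable M w"
    and bd: "\<And>n x. x \<in> space M \<Longrightarrow> (norm (F n x))\<^sup>2 \<le> w x" "\<And>x. x \<in> space M \<Longrightarrow> (norm (f x))\<^sup>2 \<le> w x"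
    and lim: "\<And>x. x \<in> space M \<Longrightarrow> (\<lambda>n. F n x) \<longlonglongrightarrow> f x"
  shows "l2_approximable M e f"
proof (rule l2_approximable_closure)
  have [measurable]: "F n \<in> borel_measurable M" for n
    using F[of n] by (auto simp: l2_approximable_def square_integrable_def)
  have "integrable M (\<lambda>x. (norm (f x))\<^sup>2)"
    by (rule Bochner_Integration.integrable_bound[OF w]) (use bd(2) in \<open>auto intro!: AE_I2 simp: abs_of_nonneg intro: order_trans[OF _ abs_ge_self]\<close>)
  then show "square_integrable M f" by (simp add: square_integrable_def)
  fix \<epsilon> :: real assume \<epsilon>: "0 < \<epsilon>"
  have w4: "integrable M (\<lambda>x. 4 * w x)" using w by simp
  have "(\<lambda>n. LINT x|M. (norm (f x - F n x))\<^sup>2) \<longlonglongrightarrow> (LINT x|M. 0)"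
  proof (rule integral_dominated_convergence[OF _ _ w4])
    show "AE x in M. (\<lambda>n. (norm (f x - F n x))\<^sup>2) \<longlonglongrightarrow> 0"
    proof (rule AE_I2)
      fix x assume "x \<in> space M"
      then have "(\<lambda>n. (norm (f x - F n x))\<^sup>2) \<longlonglongrightarrow> (norm (f x - f x))\<^sup>2" by (intro tendsto_intros lim)
      then show "(\<lambda>n. (norm (f x - F n x))\<^sup>2) \<longlonglongrightarrow> 0" by simp
    qed
    show "AE x in M. norm ((norm (f x - F n x))\<^sup>2) \<le> 4 * w x" for n
    proof (rule AE_I2)
      fix x assume x: "x \<in> space M"
      have "(norm (f x - F n x))\<^sup>2 \<le> 2 * (norm (f x))\<^sup>2 + 2 * (norm (F n x))\<^sup>2"
        using norm_add_sq_le[of "f x" "- F n x"] by simp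
      also have "\<dots> \<le> 4 * w x" using bd(1)[OF x, of n] bd(2)[OF x] by simp
      finally show "norm ((norm (f x - F n x))\<^sup>2) \<le> 4 * w x" by simp
    qed
  qed measurable
  then have "(\<lambda>n. l2_sq M (\<lambda>x. f x - F n x)) \<longlonglongrightarrow> 0" by (simp add: l2_sq_def)
  then have "\<forall>\<^sub>F n in sequentially. l2_sq M (\<lambda>x. f x - F n x) < \<epsilon>" using \<epsilon> by (rule order_tendstoD)
  then obtain n where "l2_sq M (\<lambda>x. f x - F n x) < \<epsilon>" by (auto simp: eventually_sequentially)
  then show "\<exists>g. l2_approximable M e g \<and> l2_sq M (\<lambda>x. f x - g x) \<le> \<epsilon>" using F[of n] by (intro exI[of _ "F n"]) auto
qed

lemma l2_approximable_cong_AE: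
  assumes f: "l2_approximable M e f" and g: "g \<in> borel_measurable M" and eq: "AE x in M. f x = g x"
  shows "l2_approximable M e g"
proof (rule l2_approximable_closure)
  have fs: "square_integrable M f" using f by (simp add: l2_approximable_def)
  show gs: "square_integrable M g" by (rule square_integrable_cong_AE[OF fs g eq])
  have "l2_sq M (\<lambda>x. g x - f x) = l2_sq M (\<lambda>x. 0)"
    by (rule l2_sq_cong_AE) (use eq in \<open>auto intro!: square_integrable_diff fs gs square_integrable_zero\<close>)
  then show "\<exists>h. l2_approximable M e h \<and> l2_sq M (\<lambda>x. g x - h x) \<le> \<epsilon>" if "0 < \<epsilon>" for \<epsilon>
    using f that by (intro exI[of _ f]) (simp add: l2_sq_def)
qed

end

section \<open>Trigonometric polynomials on a frequency box\<close>

definition box_measure :: "int ^ 'd::finite \<Rightarrow> (real ^ 'd) measure" where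
  "box_measure j = restrict_space lborel (frequency_box j)"

lemma space_box_measure [simp]: "space (box_measure j) = frequency_box j"
  by (simp add: box_measure_def space_restrict_space)

lemma borel_measurable_box_measure: "f \<in> borel_measurable borel \<Longrightarrow> f \<in> borel_measurable (box_measure j)"
  unfolding box_measure_def by (intro measurable_restrict_space1) simp

lemma integral_box_measure:
  fixes f :: "real ^ 'd \<Rightarrow> 'b::{banach, second_countable_topology}"
  shows "(LINT \<xi>|box_measure j. f \<xi>) = (LINT \<xi>|lborel. indicator (frequency_box j) \<xi> *\<^sub>R f \<xi>)"
  unfolding box_measure_def by (subst integral_restrict_space) (auto simp: set_lebesgue_integral_def)

lemma integrable_box_measure:
  fixes f :: "real ^ 'd \<Rightarrow> 'b::{banach, second_countable_topology}"
  shows "integrable (box_measure j) f \<longleftrightarrow> integrable lborel (\<lambda>\<xi>. indicator (frequency_box j) \<xi> *\<^sub>R f \<xi>)"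
  unfolding box_measure_def by (subst integrable_restrict_space) (auto simp: set_integrable_def)

lemma AE_box_measure:
  "(AE \<xi> in box_measure j. P \<xi>) \<longleftrightarrow> (AE \<xi> in lborel. \<xi> \<in> frequency_box j \<longrightarrow> P \<xi>)"
  unfolding box_measure_def by (subst AE_restrict_space_iff) auto

lemma finite_box_measure: "finite_measure (box_measure j)"
  using emeasure_frequency_box[of j] unfolding box_measure_def
  by (intro finite_measureI) (simp add: emeasure_restrict_space space_restrict_space)

definition trig :: "int ^ 'd::finite \<Rightarrow> int ^ 'd \<Rightarrow> real ^ 'd \<Rightarrow> complex" where
  "trig j k \<xi> = (\<Prod>i\<in>UNIV. exp (- \<i> * complex_of_real (of_int (k $ i) * (\<xi> $ i / dyadic (j $ i)))))"

lemma trig_mult: "trig j k \<xi> * trig j l \<xi> = trig j (k + l) \<xi>"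
  unfolding trig_def prod.distrib[symmetric] exp_add[symmetric]
  by (simp add: algebra_simps add_divide_distrib diff_divide_distrib)

lemma trig_zero: "trig j 0 \<xi> = 1"
  by (simp add: trig_def)

lemma norm_trig: "norm (trig j k \<xi>) = 1"
  unfolding trig_def prod_norm[symmetric] by simp

lemma trig_measurable [measurable]: "trig j k \<in> borel_measurable borel"
  unfolding trig_def[abs_def] by measurable

lemma trig_axis: "trig j (axis i n) \<xi> = exp (- \<i> * complex_of_real (of_int n * (\<xi> $ i / dyadic (j $ i))))"
proof -
  have "trig j (axis i n) \<xi> = (\<Prod>i'\<in>UNIV. if i' = i then exp (- \<i> * complex_of_real (of_int n * (\<xi> $ i' / dyadic (j $ i')))) else 1)"
    unfolding trig_def by (intro prod.cong) (auto simp: axis_def)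
  then show ?thesis by simp
qed

lemma square_integrable_trig: "square_integrable (box_measure j) (trig j k)"
  by (rule square_integrable_bounded[OF finite_box_measure, where C = 1])
     (simp_all add: norm_trig borel_measurable_box_measure)

text \<open>Real polynomials in the coordinates of this map are trigonometric polynomials. Since
  \<open>shannon_support\<close> is a period up to endpoints, the map is injective on the box off a
  null set, so it loses no measurable information.\<close>

definition torus_map :: "int ^ 'd::finite \<Rightarrow> real ^ 'd \<Rightarrow> complex ^ 'd" where
  "torus_map j \<xi> = (\<chi> i. iexp (\<xi> $ i / dyadic (j $ i)))"

text \<open>On the frequencies of the Shannon wavelet the angle is determined by its cosine and the sign of
  its sine.\<close>

definition shannon_angle :: "complex \<Rightarrow> real" where
  "shannon_angle z = (if 0 < Im z then arccos (max (- 1) (min 1 (Re z))) - 2 * pi else 2 * pi - arccos (max (- 1) (min 1 (Re z))))"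

text \<open>The excluded points -pi and -2 pi have the same images on the circle as pi and 2 pi, and
  there \<open>shannon_angle\<close> returns the positive preimage. Elsewhere a shift by 2 pi or a
  reflection moves \<open>t\<close> into [0, pi], where the arc cosine inverts the cosine.\<close>

lemma shannon_angle_exp:
  assumes t: "t \<in> shannon_support" and ne: "t \<noteq> - pi" "t \<noteq> - 2 * pi"
  shows "shannon_angle (exp (\<i> * complex_of_real t)) = t"
proof -
  have c: "max (- 1) (min 1 (cos t)) = cos t" using cos_le_one[of t] cos_ge_minus_one[of t] by linarith
  have re: "Re (exp (\<i> * complex_of_real t)) = cos t" "Im (exp (\<i> * complex_of_real t)) = sin t"
    by (simp_all add: Re_exp Im_exp)
  show ?thesis
  proof (cases "t < 0")
    case True
    then have s: "0 < t + 2 * pi" "t + 2 * pi < pi" using t ne pi_gt_zero by auto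
    then have "0 < sin (t + 2 * pi)" by (rule sin_gt_zero)
    moreover have "arccos (cos (t + 2 * pi)) = t + 2 * pi" using s by (intro arccos_cos) auto
    ultimately show ?thesis unfolding shannon_angle_def re c by simp
  next
    case False
    then have s: "0 \<le> 2 * pi - t" "2 * pi - t \<le> pi" using t pi_gt_zero by auto
    then have "0 \<le> sin (2 * pi - t)" by (rule sin_ge_zero)
    moreover have "arccos (cos (2 * pi - t)) = 2 * pi - t" using s by (intro arccos_cos) auto
    ultimately show ?thesis unfolding shannon_angle_def re c by (simp add: sin_diff cos_diff)
  qed
qed

lemma shannon_angle_measurable [measurable]: "shannon_angle \<in> borel_measurable borel"
proof -
  \<comment> \<open>The clamping to [-1, 1] in the definition serves this step: it makes the
    composite continuous on the whole line, hence Borel.\<close>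
  have "continuous_on UNIV (\<lambda>x. arccos (max (- 1) (min 1 x)))" by (intro continuous_intros) auto
  then have [measurable]: "(\<lambda>x. arccos (max (- 1) (min 1 x))) \<in> borel_measurable borel"
    by (rule borel_measurable_continuous_onI)
  have [measurable]: "(\<lambda>z. arccos (max (- 1) (min 1 (Re z)))) \<in> borel_measurable borel"
    by (rule measurable_compose[of Re borel borel "\<lambda>x. arccos (max (- 1) (min 1 x))"]) measurable
  show ?thesis unfolding shannon_angle_def[abs_def] by measurable
qed

definition torus_inverse :: "int ^ 'd::finite \<Rightarrow> complex ^ 'd \<Rightarrow> real ^ 'd" where
  "torus_inverse j z = (\<chi> i. dyadic (j $ i) * shannon_angle (z $ i))"

lemma vec_lambda_measurable:
  fixes f :: "'a \<Rightarrow> 'd::finite \<Rightarrow> 'b::euclidean_space"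
  assumes "\<And>i. (\<lambda>x. f x i) \<in> borel_measurable M"
  shows "(\<lambda>x. \<chi> i. f x i) \<in> borel_measurable M"
proof (subst borel_measurable_euclidean_space, intro ballI)
  fix b :: "'b ^ 'd" assume "b \<in> Basis"
  then obtain i u where "b = axis i u" by (auto simp: Basis_vec_def)
  then show "(\<lambda>x. (\<chi> i. f x i) \<bullet> b) \<in> borel_measurable M"
    using assms[of i] by (simp add: inner_axis)
qed

lemma vec_nth_measurable_complex [measurable]: "(\<lambda>x::complex ^ 'd. x $ i) \<in> borel_measurable borel"
  by (intro borel_measurable_continuous_onI continuous_intros)

lemma torus_inverse_measurable [measurable]: "torus_inverse j \<in> borel \<rightarrow>\<^sub>M borel"
  unfolding torus_inverse_def[abs_def] by (intro vec_lambda_measurable) measurable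

lemma torus_map_measurable [measurable]: "torus_map j \<in> borel \<rightarrow>\<^sub>M borel"
  unfolding torus_map_def[abs_def] by (intro vec_lambda_measurable) measurable

lemma AE_vec_nth_neq: "AE \<xi> in lborel. (\<xi> :: real ^ 'd) $ i \<noteq> c"
proof -
  have "axis i 1 \<in> (Basis :: (real ^ 'd) set)" by (auto simp: Basis_vec_def)
  from negligible_standard_hyperplane[OF this, of c]
  have "{\<xi> :: real ^ 'd. \<xi> $ i = c} \<in> null_sets lebesgue" by (simp add: inner_axis negligible_iff_null_sets)
  then have "AE \<xi> in lebesgue. (\<xi> :: real ^ 'd) $ i \<noteq> c" by (rule AE_I') auto
  then show ?thesis by (simp add: AE_completion_iff)
qed

lemma torus_inverse_torus_map: "AE \<xi> in box_measure j. torus_inverse j (torus_map j \<xi>) = \<xi>"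
proof -
  have "AE \<xi> in lborel. \<forall>i. \<xi> $ i \<noteq> - pi * dyadic (j $ i) \<and> \<xi> $ i \<noteq> - 2 * pi * dyadic (j $ i)"
    unfolding AE_all_countable by (intro allI AE_conjI AE_vec_nth_neq)
  then show ?thesis
    unfolding AE_box_measure
  proof eventually_elim
    case (elim \<xi>)
    show ?case
    proof
      assume B: "\<xi> \<in> frequency_box j"
      have "dyadic (j $ i) * shannon_angle (iexp (\<xi> $ i / dyadic (j $ i))) = \<xi> $ i" for i
      proof (subst shannon_angle_exp)
        show "\<xi> $ i / dyadic (j $ i) \<in> shannon_support" using B unfolding mem_frequency_box by blast
        show "\<xi> $ i / dyadic (j $ i) \<noteq> - pi" "\<xi> $ i / dyadic (j $ i) \<noteq> - 2 * pi"
          using elim by (auto simp: divide_eq_eq)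
      qed simp
      then show "torus_inverse j (torus_map j \<xi>) = \<xi>" by (simp add: torus_inverse_def torus_map_def vec_eq_iff)
    qed
  qed
qed

lemma norm_torus_map: "norm (torus_map j \<xi>) \<le> CARD('d)" for \<xi> :: "real ^ 'd::finite"
proof -
  have "norm (torus_map j \<xi>) \<le> (\<Sum>i\<in>UNIV. norm (torus_map j \<xi> $ i))"
    unfolding norm_vec_def by (rule L2_set_le_sum) simp
  also have "\<dots> = CARD('d)" by (simp add: torus_map_def)
  finally show ?thesis .
qed

text \<open>Real and imaginary parts of a coordinate are combinations of two characters, and a
  product of characters is a character, so the span of the characters is an algebra that contains
  the coordinates.\<close>

lemma real_polynomial_torus_map:
  assumes "real_polynomial_function p"
  shows "lincomb (trig j) (\<lambda>\<xi>. complex_of_real (p (torus_map j \<xi>)))"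
  using assms
proof induction
  case (linear f)
  interpret bounded_linear f by fact
  let ?E = "\<lambda>i n. trig j (axis i n)"
  \<comment> \<open>The characters of \<open>trig\<close> carry the factor -\<i>, so it is the index
    -1 that gives the exponential with positive sign.\<close>
  have re: "complex_of_real (Re (torus_map j \<xi> $ i)) = (1/2) * ?E i (- 1) \<xi> + (1/2) * ?E i 1 \<xi>" for \<xi> i
    unfolding trig_axis by (simp add: torus_map_def Re_exp cos_exp_eq flip: cos_of_real)
  have im: "complex_of_real (Im (torus_map j \<xi> $ i)) = (1 / (2 * \<i>)) * ?E i (- 1) \<xi> + (- 1 / (2 * \<i>)) * ?E i 1 \<xi>" for \<xi> i
    unfolding trig_axis by (simp add: torus_map_def Im_exp sin_exp_eq diff_divide_distrib right_diff_distrib flip: sin_of_real)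
  \<comment> \<open>The functional \<open>f\<close> is only real-linear, so its values at
    \<open>axis i 1\<close> and at \<open>axis i \<i>\<close> are independent data.\<close>
  have dec: "z = (\<Sum>i\<in>UNIV. Re (z $ i) *\<^sub>R axis i 1 + Im (z $ i) *\<^sub>R axis i \<i>)" for z :: "complex ^ 'd"
  proof -
    have "(\<Sum>i\<in>UNIV. Re (z $ i) *\<^sub>R axis i 1 + Im (z $ i) *\<^sub>R axis i \<i>) $ l
      = (\<Sum>i\<in>UNIV. if i = l then z $ l else 0)" for l
      unfolding sum_component by (intro sum.cong) (auto simp: axis_def complex_eq_iff)
    then show ?thesis by (simp add: vec_eq_iff)
  qed
  have fz: "f z = (\<Sum>i\<in>UNIV. Re (z $ i) * f (axis i 1) + Im (z $ i) * f (axis i \<i>))" for z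
    by (subst dec[of z]) (simp add: sum add scaleR)
  have eq: "complex_of_real (f (torus_map j \<xi>)) = (\<Sum>i\<in>UNIV.
      complex_of_real (f (axis i 1)) * ((1/2) * ?E i (- 1) \<xi> + (1/2) * ?E i 1 \<xi>)
    + complex_of_real (f (axis i \<i>)) * ((1 / (2 * \<i>)) * ?E i (- 1) \<xi> + (- 1 / (2 * \<i>)) * ?E i 1 \<xi>))" for \<xi>
    unfolding re[symmetric] im[symmetric] fz[of "torus_map j \<xi>"]
    by (simp only: of_real_sum of_real_add of_real_mult mult.commute)
  have s: "lincomb (trig j) (\<lambda>\<xi>. \<Sum>i\<in>I. g i \<xi>)" if "finite I" "\<And>i. lincomb (trig j) (g i)" for I :: "'d set" and g
    using that by (induction I rule: finite_induct) (auto intro: lincomb.zero lincomb_add)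
  show ?case unfolding eq by (intro s lincomb_add lincomb_cmult lincomb_base) simp
next
  case (const c)
  show ?case using lincomb_cmult[OF lincomb_base[of "trig j" 0], of "complex_of_real c"] by (simp add: trig_zero)
next
  case (add f g) then show ?case using lincomb_add by simp
next
  case (mult f g)
  have "lincomb (trig j) (\<lambda>\<xi>. trig j k \<xi> * trig j l \<xi>)" for k l unfolding trig_mult by (rule lincomb_base)
  from lincomb_mult[OF this mult.IH] show ?case by simp
qed

text \<open>A bounded Borel function of \<xi> agrees almost everywhere on the box with one of
  \<open>torus_map j \<xi>\<close>, to which the monotone class induction applies. Real and
  imaginary parts and then truncation extend this to all of L2.\<close>

lemma trig_dense:
  assumes f: "square_integrable (box_measure j) f"
  shows "l2_approximable (box_measure j) (trig j) f"
proof -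
  let ?M = "box_measure j"
  let ?A = "l2_approximable ?M (trig j)"
  note tr = square_integrable_trig[of j]
  have fin: "integrable ?M (\<lambda>x. c)" for c :: real using finite_box_measure by (rule finite_measure.integrable_const)
  have tm: "(\<lambda>\<xi>. complex_of_real (h (torus_map j \<xi>))) \<in> borel_measurable ?M" if h: "h \<in> borel_measurable borel" for h
    by (intro borel_measurable_box_measure measurable_compose[OF measurable_compose[OF torus_map_measurable h] borel_measurable_continuous_onI])
       (intro continuous_intros)
  have P: "?A (\<lambda>\<xi>. complex_of_real (h (torus_map j \<xi>)))" if "h \<in> borel_measurable borel" "\<And>z. \<bar>h z\<bar> \<le> B" for h B
    using compact_cball[of "0 :: complex ^ 'a" "real CARD('a)"] that
  proof (induction h rule: bounded_borel_poly_induct)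
    case (poly p)
    then show ?case by (intro l2_approximable_lincomb tr real_polynomial_torus_map)
  next
    case (add f g) then show ?case using l2_approximable_add[OF tr] by simp
  next
    case (cmult f c) then show ?case using l2_approximable_cmult[OF tr, of _ _ "complex_of_real c"] by simp
  next
    case (lim F f C)
    have K: "torus_map j \<xi> \<in> cball 0 (real CARD('a))" for \<xi> using norm_torus_map[of j \<xi>] by simp
    have FC: "(F n (torus_map j \<xi>))\<^sup>2 \<le> C\<^sup>2" for n \<xi>
      using lim(4)[OF K, of n \<xi>] by (metis abs_ge_zero power2_abs power_mono)
    have fC: "(f (torus_map j \<xi>))\<^sup>2 \<le> C\<^sup>2" for \<xi>
    proof -
      have "(\<lambda>n. (F n (torus_map j \<xi>))\<^sup>2) \<longlonglongrightarrow> (f (torus_map j \<xi>))\<^sup>2" by (intro tendsto_intros lim(5) K)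
      then show ?thesis by (rule LIMSEQ_le_const2) (use FC in auto)
    qed
    have l: "(\<lambda>n. complex_of_real (F n (torus_map j \<xi>))) \<longlonglongrightarrow> complex_of_real (f (torus_map j \<xi>))" for \<xi>
      by (intro tendsto_of_real lim(5) K)
    show ?case
      by (rule l2_approximable_lim[OF tr lim(1) tm[OF lim(3)] fin[of "C\<^sup>2"] _ _ l]) (use FC fC in auto)
  qed
  have R: "?A (\<lambda>\<xi>. complex_of_real (h \<xi>))" if [measurable]: "h \<in> borel_measurable borel" and h: "\<And>\<xi>. \<bar>h \<xi>\<bar> \<le> B" for h B
  proof (rule l2_approximable_cong_AE[OF tr P])
    show "(\<lambda>z. h (torus_inverse j z)) \<in> borel_measurable borel" by measurable
    show "\<bar>h (torus_inverse j z)\<bar> \<le> B" for z by (rule h)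
    show "(\<lambda>\<xi>. complex_of_real (h \<xi>)) \<in> borel_measurable ?M" by (rule borel_measurable_box_measure) measurable
    show "AE \<xi> in ?M. complex_of_real (h (torus_inverse j (torus_map j \<xi>))) = complex_of_real (h \<xi>)"
      using torus_inverse_torus_map[of j] by eventually_elim simp
  qed
  have C: "?A h" if [measurable]: "h \<in> borel_measurable borel" and h: "\<And>\<xi>. norm (h \<xi>) \<le> B" for h B
  proof -
    have "?A (\<lambda>\<xi>. complex_of_real (Re (h \<xi>)) + \<i> * complex_of_real (Im (h \<xi>)))"
      by (intro l2_approximable_add[OF tr] l2_approximable_cmult[OF tr] R[of _ B])
         (use h in \<open>auto intro: order_trans[OF abs_Re_le_cmod] order_trans[OF abs_Im_le_cmod]\<close>)
    then show ?thesis by (simp flip: complex_eq)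
  qed
  let ?B = "frequency_box j"
  \<comment> \<open>\<open>f\<close> is measurable on the box only; its extension by zero is a Borel
    function on the whole space, as \<open>C\<close> requires of its argument.\<close>
  define g where "g \<xi> = indicator ?B \<xi> *\<^sub>R f \<xi>" for \<xi>
  have [measurable]: "g \<in> borel_measurable borel"
    using square_integrable_measurable[OF f] unfolding g_def box_measure_def
    by (subst (asm) borel_measurable_restrict_space_iff) auto
  \<comment> \<open>Cutting off to zero where the modulus exceeds n keeps the sequence below the
    modulus of \<open>f\<close>; at each point it becomes equal to \<open>f\<close>
    eventually.\<close>
  define F where "F n \<xi> = (if norm (g \<xi>) \<le> real n then g \<xi> else 0)" for n \<xi>
  have F_meas: "F n \<in> borel_measurable borel" for n unfolding F_def[abs_def] by measurable
  have F_bd: "norm (F n \<xi>) \<le> real n" for n \<xi> by (simp add: F_def)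
  show ?thesis
  proof (rule l2_approximable_lim[OF tr])
    show "?A (F n)" for n by (rule C[OF F_meas F_bd])
    show "f \<in> borel_measurable ?M" by (rule square_integrable_measurable[OF f])
    show "integrable ?M (\<lambda>x. (norm (f x))\<^sup>2)" using f by (simp add: square_integrable_def)
    fix \<xi> assume "\<xi> \<in> space ?M"
    then have g: "g \<xi> = f \<xi>" by (simp add: g_def)
    show "(norm (F n \<xi>))\<^sup>2 \<le> (norm (f \<xi>))\<^sup>2" for n by (simp add: F_def g)
    have "F n \<xi> = f \<xi>" if "nat \<lceil>norm (f \<xi>)\<rceil> \<le> n" for n
      using that g by (simp add: F_def)
    then show "(\<lambda>n. F n \<xi>) \<longlonglongrightarrow> f \<xi>"
      by (intro tendsto_eventually) (unfold eventually_sequentially, blast)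
  qed simp
qed

section \<open>Orthogonality of the wavelets\<close>

text \<open>The factor shared by all wavelet transforms of level \<open>j\<close> on their box. Its
  modulus is constant and nonzero, so multiplication by it carries completeness of the characters
  over to the wavelets.\<close>

definition wavelet_phase :: "int ^ 'd::finite \<Rightarrow> real ^ 'd \<Rightarrow> complex" where
  "wavelet_phase j \<xi> = complex_of_real (wavelet_amplitude j) *
     (\<Prod>i\<in>UNIV. exp (- \<i> * complex_of_real (\<xi> $ i / dyadic (j $ i)) / 2))"

lemma norm_wavelet_phase: "norm (wavelet_phase j \<xi>) = wavelet_amplitude j"
  using wavelet_amplitude_pos[of j] by (simp add: wavelet_phase_def norm_mult prod_norm[symmetric])

lemma wavelet_phase_measurable [measurable]: "wavelet_phase j \<in> borel_measurable borel"
  unfolding wavelet_phase_def[abs_def] by measurable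

lemma wavelet_hat_outside: "\<xi> \<notin> frequency_box (fst q) \<Longrightarrow> wavelet_hat q \<xi> = 0"
  using norm_wavelet_hat[of q \<xi>] by simp

lemma wavelet_hat_eq_trig: "wavelet_hat (j, k) \<xi> = (indicator (frequency_box j) \<xi> * wavelet_phase j \<xi>) * trig j k \<xi>"
proof (cases "\<xi> \<in> frequency_box j")
  case True
  then have "indicator shannon_support (\<xi> $ i / dyadic (j $ i)) = (1 :: complex)" for i
    unfolding mem_frequency_box by (simp only: indicator_simps)
  then have "wavelet_hat (j, k) \<xi> = (\<Prod>i\<in>UNIV. complex_of_real (2 powr (- (real_of_int (j $ i) / 2))) *
      (exp (- \<i> * complex_of_real (of_int (k $ i) * (\<xi> $ i / dyadic (j $ i)))) *
       exp (- \<i> * complex_of_real (\<xi> $ i / dyadic (j $ i)) / 2)))"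
    unfolding wavelet_hat_def wavelet_hat1_def shannon_hat_def by (simp only: fst_conv snd_conv mult_1_right mult.assoc)
  then show ?thesis
    using True unfolding prod.distrib wavelet_phase_def trig_def wavelet_amplitude_def of_real_prod
    by (simp only: indicator_simps mult_ac mult_1_left mult_1_right)
qed (use wavelet_hat_outside[of \<xi> "(j, k)"] in simp)

lemma l2_inner_box_wavelet:
  "l2_inner (box_measure j) f (wavelet_hat (j, k)) = (LINT \<xi>|lborel. f \<xi> * cnj (wavelet_hat (j, k) \<xi>))"
  unfolding l2_inner_def integral_box_measure
  by (intro Bochner_Integration.integral_cong) (auto simp: indicator_def wavelet_hat_outside)

lemma square_integrable_wavelet_hat: "square_integrable (box_measure j) (wavelet_hat q)"
  by (rule square_integrable_bounded[OF finite_box_measure, where C = "wavelet_amplitude (fst q)"])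
     (use wavelet_amplitude_pos[of "fst q"] in \<open>auto simp: norm_wavelet_hat borel_measurable_box_measure indicator_def\<close>)

lemma orthogonal_basis_wavelet_hat:
  fixes j :: "int ^ 'd::finite"
  shows "orthogonal_basis (box_measure j) (\<lambda>k. wavelet_hat (j, k)) ((2 * pi) ^ CARD('d))"
proof
  let ?M = "box_measure j"
  show "square_integrable ?M (wavelet_hat (j, k))" for k by (rule square_integrable_wavelet_hat)
  show "0 < (2 * pi) ^ CARD('d)" by simp
  show "l2_inner ?M (wavelet_hat (j, k)) (wavelet_hat (j, l)) = (if k = l then complex_of_real ((2 * pi) ^ CARD('d)) else 0)" for k l
    unfolding l2_inner_box_wavelet by (rule wavelet_hat_orthogonal)
  fix f and \<epsilon> :: real
  assume f: "square_integrable ?M f" and \<epsilon>: "0 < \<epsilon>"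
  let ?s = "wavelet_phase j"
  let ?a = "wavelet_amplitude j"
  have a: "0 < ?a" by (rule wavelet_amplitude_pos)
  have s0: "?s \<xi> \<noteq> 0" for \<xi> using norm_wavelet_phase[of j \<xi>] a by auto
  \<comment> \<open>The quotient by the phase is approximated by characters and then multiplied
    back. This scales squared errors by the square of the amplitude, whence the tolerance \<epsilon>
    / ?a^2.\<close>
  have "square_integrable ?M (\<lambda>\<xi>. inverse (?s \<xi>) * f \<xi>)"
    by (rule square_integrable_bounded_mult[OF f, where C = "inverse ?a"])
       (auto intro!: borel_measurable_box_measure simp: norm_inverse norm_wavelet_phase)
  from trig_dense[OF this] \<epsilon> a obtain T where T: "lincomb (trig j) T"
    "l2_sq ?M (\<lambda>\<xi>. inverse (?s \<xi>) * f \<xi> - T \<xi>) \<le> \<epsilon> / ?a\<^sup>2"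
    unfolding l2_approximable_def by (meson divide_pos_pos zero_less_power)
  let ?S = "\<lambda>\<xi>. (indicator (frequency_box j) \<xi> * ?s \<xi>) * T \<xi>"
  have "lincomb (\<lambda>k. wavelet_hat (j, k)) ?S"
    unfolding wavelet_hat_eq_trig[abs_def] by (rule lincomb_scale[OF T(1)])
  moreover have "l2_sq ?M (\<lambda>\<xi>. f \<xi> - ?S \<xi>) \<le> \<epsilon>"
  proof -
    have "l2_sq ?M (\<lambda>\<xi>. f \<xi> - ?S \<xi>) = (LINT \<xi>|?M. ?a\<^sup>2 * (norm (inverse (?s \<xi>) * f \<xi> - T \<xi>))\<^sup>2)"
      unfolding l2_sq_def
    proof (rule Bochner_Integration.integral_cong[OF refl])
      fix \<xi> assume "\<xi> \<in> space ?M"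
      then have "f \<xi> - ?S \<xi> = ?s \<xi> * (inverse (?s \<xi>) * f \<xi> - T \<xi>)"
        using s0[of \<xi>] by (simp add: right_diff_distrib)
      then show "(norm (f \<xi> - ?S \<xi>))\<^sup>2 = ?a\<^sup>2 * (norm (inverse (?s \<xi>) * f \<xi> - T \<xi>))\<^sup>2"
        by (simp only: norm_mult norm_wavelet_phase power_mult_distrib)
    qed
    also have "\<dots> = ?a\<^sup>2 * l2_sq ?M (\<lambda>\<xi>. inverse (?s \<xi>) * f \<xi> - T \<xi>)"
      unfolding l2_sq_def by simp
    also have "\<dots> \<le> ?a\<^sup>2 * (\<epsilon> / ?a\<^sup>2)" by (intro mult_left_mono T) auto
    also have "\<dots> = \<epsilon>" using a by simp
    finally show ?thesis .
  qed
  ultimately show "\<exists>T. lincomb (\<lambda>k. wavelet_hat (j, k)) T \<and> l2_sq ?M (\<lambda>\<xi>. f \<xi> - T \<xi>) \<le> \<epsilon>" by blast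
qed

lemma sobolev_square_integrable_box:
  assumes T: "T \<in> sobolev s"
  shows "square_integrable (box_measure j) (dist_fourier T)"
proof -
  let ?w = "\<lambda>\<xi>. (1 + (norm \<xi>)\<^sup>2) powr (s / 2)"
  have pos: "0 < 1 + (norm x)\<^sup>2" for x :: "real ^ 'a" using zero_le_power2[of "norm x"] by linarith
  note [measurable] = sobolev_dist_fourier(1)[OF T]
  obtain C where C: "\<And>\<xi>. \<xi> \<in> frequency_box j \<Longrightarrow> (1 + (norm \<xi>)\<^sup>2) powr (- (s / 2)) \<le> C"
    using sobolev_weight_bounded by blast
  have "integrable lborel (\<lambda>\<xi>. C\<^sup>2 * (norm (?w \<xi> *\<^sub>R dist_fourier T \<xi>))\<^sup>2)"
    using sobolev_dist_fourier(2)[OF T] by (rule integrable_mult_right)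
  then have "integrable lborel (\<lambda>\<xi>. indicator (frequency_box j) \<xi> *\<^sub>R (norm (dist_fourier T \<xi>))\<^sup>2)"
  proof (rule Bochner_Integration.integrable_bound)
    show "AE \<xi> in lborel. norm (indicator (frequency_box j) \<xi> *\<^sub>R (norm (dist_fourier T \<xi>))\<^sup>2) \<le> norm (C\<^sup>2 * (norm (?w \<xi> *\<^sub>R dist_fourier T \<xi>))\<^sup>2)"
    proof (rule AE_I2)
      fix \<xi>
      show "norm (indicator (frequency_box j) \<xi> *\<^sub>R (norm (dist_fourier T \<xi>))\<^sup>2) \<le> norm (C\<^sup>2 * (norm (?w \<xi> *\<^sub>R dist_fourier T \<xi>))\<^sup>2)"
      proof (cases "\<xi> \<in> frequency_box j")
        case True
        have "norm (dist_fourier T \<xi>) = (1 + (norm \<xi>)\<^sup>2) powr (- (s / 2)) * norm (?w \<xi> *\<^sub>R dist_fourier T \<xi>)"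
          using pos[of \<xi>] by (simp add: mult.assoc[symmetric] powr_add[symmetric])
        also have "\<dots> \<le> C * norm (?w \<xi> *\<^sub>R dist_fourier T \<xi>)" by (intro mult_right_mono C True) simp
        finally have "(norm (dist_fourier T \<xi>))\<^sup>2 \<le> (C * norm (?w \<xi> *\<^sub>R dist_fourier T \<xi>))\<^sup>2"
          by (rule power_mono) simp
        also have "\<dots> = C\<^sup>2 * (norm (?w \<xi> *\<^sub>R dist_fourier T \<xi>))\<^sup>2" by (rule power_mult_distrib)
        also have "\<dots> = norm (C\<^sup>2 * (norm (?w \<xi> *\<^sub>R dist_fourier T \<xi>))\<^sup>2)"
          unfolding real_norm_def by (rule abs_of_nonneg[symmetric]) simp
        finally show ?thesis using True by simp
      qed simp
    qed
  qed measurable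
  then show ?thesis
    unfolding square_integrable_def integrable_box_measure by (simp add: borel_measurable_box_measure)
qed

text \<open>The global pairing becomes an inner product on a single box; this is what makes the
  levels independent.\<close>

lemma pairing_wavelet_dist:
  fixes j k :: "int ^ 'd::finite"
  assumes "S \<in> sobolev s"
  shows "pairing S (wavelet_dist (j, k)) =
    l2_inner (box_measure j) (dist_fourier S) (wavelet_hat (j, k)) / complex_of_real ((2 * pi) ^ CARD('d))"
proof -
  have [measurable]: "dist_fourier S \<in> borel_measurable borel" "dist_fourier (wavelet_dist (j, k)) \<in> borel_measurable borel"
    using sobolev_dist_fourier(1)[OF assms] sobolev_dist_fourier(1)[OF wavelet_dist_sobolev] by auto
  have "(LINT \<xi>|lborel. dist_fourier S \<xi> * cnj (dist_fourier (wavelet_dist (j, k)) \<xi>))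
      = (LINT \<xi>|lborel. dist_fourier S \<xi> * cnj (wavelet_hat (j, k) \<xi>))"
  proof (rule integral_cong_AE)
    show "AE \<xi> in lborel. dist_fourier S \<xi> * cnj (dist_fourier (wavelet_dist (j, k)) \<xi>) = dist_fourier S \<xi> * cnj (wavelet_hat (j, k) \<xi>)"
      using dist_fourier_wavelet[of "(j, k)"] by eventually_elim simp
  qed measurable
  then show ?thesis unfolding pairing_def l2_inner_box_wavelet by simp
qed

text \<open>In a coordinate where the levels differ, a common point has modulus 2^n pi for some
  integer n. These values give countably many hyperplanes.\<close>

lemma AE_frequency_box_disjoint:
  fixes i j :: "int ^ 'd::finite"
  assumes "i \<noteq> j"
  shows "AE \<xi> in lborel. \<xi> \<in> frequency_box i \<longrightarrow> \<xi> \<notin> frequency_box j"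
proof -
  have *: "AE \<xi> in lborel. \<forall>l. \<forall>n::int. \<xi> $ l \<noteq> dyadic n * pi \<and> \<xi> $ l \<noteq> - (dyadic n * pi)" for l :: 'd
    unfolding AE_all_countable by (intro allI AE_conjI AE_vec_nth_neq)
  have low: "dyadic (j $ l) * pi \<le> \<bar>\<xi> $ l\<bar>" "\<bar>\<xi> $ l\<bar> \<le> dyadic (j $ l + 1) * pi"
    if "\<xi> \<in> frequency_box j" for \<xi> l and j :: "int ^ 'd"
  proof -
    have "0 < dyadic (j $ l) * pi" by simp
    moreover have "\<xi> $ l \<in> {- (dyadic (j $ l + 1) * pi) .. - (dyadic (j $ l) * pi)} \<union>
         {dyadic (j $ l) * pi .. dyadic (j $ l + 1) * pi}"
      using that by (auto simp: frequency_box_def)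
    ultimately show "dyadic (j $ l) * pi \<le> \<bar>\<xi> $ l\<bar>" "\<bar>\<xi> $ l\<bar> \<le> dyadic (j $ l + 1) * pi"
      unfolding Un_iff atLeastAtMost_iff by linarith+
  qed
  have lt: False if "i $ l < j $ l" "\<xi> \<in> frequency_box i" "\<xi> \<in> frequency_box j"
    and ne: "\<And>l n. \<xi> $ l \<noteq> dyadic n * pi \<and> \<xi> $ l \<noteq> - (dyadic n * pi)"
    for i j :: "int ^ 'd" and l \<xi>
  proof -
    have "\<bar>\<xi> $ l\<bar> \<noteq> dyadic (i $ l + 1) * pi" using ne[of l "i $ l + 1"] by linarith
    then have "\<bar>\<xi> $ l\<bar> < dyadic (i $ l + 1) * pi" using low(2)[OF that(2), of l] by linarith
    also have "\<dots> \<le> dyadic (j $ l) * pi" using that(1) by (intro mult_right_mono powr_mono) auto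
    finally show False using low(1)[OF that(3), of l] by linarith
  qed
  from assms obtain l where l: "i $ l \<noteq> j $ l" by (auto simp: vec_eq_iff)
  from * show ?thesis
  proof eventually_elim
    case (elim \<xi>)
    show ?case
    proof (intro impI notI)
      assume "\<xi> \<in> frequency_box i" "\<xi> \<in> frequency_box j"
      then show False using lt[of i l j \<xi>] lt[of j l i \<xi>] l elim by (meson linorder_neqE_linordered_idom)
    qed
  qed
qed

section \<open>The iteration on one level\<close>

lemma matrix_vector_mult_norm_le:
  fixes N :: "complex ^ 'm ^ 'n"
  shows "norm (N *v x) \<le> matrix_norm N * norm x"
proof -
  have "linear (\<lambda>x. N *v x)"
    by (rule linearI)
       (simp_all add: vec_eq_iff matrix_vector_mult_def distrib_left sum.distrib scaleR_sum_right)
  then have "bounded_linear (\<lambda>x. N *v x)" by (simp add: linear_conv_bounded_linear)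
  then show ?thesis unfolding matrix_norm_def by (rule onorm)
qed

lemma matrix_entry_norm_le:
  fixes N :: "complex ^ 'm ^ 'n"
  shows "norm (N $ a $ b) \<le> matrix_norm N"
proof -
  have "(N *v axis b 1) $ a = (\<Sum>b'\<in>UNIV. if b' = b then N $ a $ b else 0)"
    unfolding matrix_vector_mult_def vec_lambda_beta by (intro sum.cong) (auto simp: axis_def)
  then have "norm (N $ a $ b) = norm ((N *v axis b 1) $ a)" by simp
  also have "\<dots> \<le> norm (N *v axis b 1)" by (rule Finite_Cartesian_Product.norm_nth_le)
  also have "\<dots> \<le> matrix_norm N" using matrix_vector_mult_norm_le[of N "axis b 1"] by simp
  finally show ?thesis .
qed

lemma norm_vec_sq: "(norm x)\<^sup>2 = (\<Sum>a\<in>UNIV. (norm (x $ a))\<^sup>2)" for x :: "complex ^ 'n"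
  by (simp add: norm_vec_def L2_set_def sum_nonneg)

lemma has_sum_vec:
  fixes f :: "'k \<Rightarrow> complex ^ 'n"
  assumes "\<And>a. ((\<lambda>k. f k $ a) has_sum S $ a) I"
  shows "(f has_sum S) I"
  using assms unfolding has_sum_def by (intro vec_tendstoI) (simp add: sum_component)

lemma has_sum_sum_finite:
  fixes f :: "'b \<Rightarrow> 'k \<Rightarrow> 'c::{topological_comm_monoid_add}"
  assumes "finite F" "\<And>a. a \<in> F \<Longrightarrow> ((f a) has_sum S a) I"
  shows "((\<lambda>k. \<Sum>a\<in>F. f a k) has_sum (\<Sum>a\<in>F. S a)) I"
  using assms by (induction F rule: finite_induct) (auto intro: has_sum_add has_sum_0)

text \<open>One level is fixed throughout, so \<open>P\<close> is a constant matrix and all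
  functions live on one box. The variable \<open>c\<close> keeps the constant (2 pi)^d folded when
  the facts on orthogonal bases are inherited.\<close>

locale wavelet_level =
  fixes t \<rho> :: real
    and M :: "real ^ 'd \<Rightarrow> complex ^ 'm ^ 'n"
    and A :: "(real ^ 'd) distribution ^ 'm \<Rightarrow> (real ^ 'd) distribution ^ 'n"
    and M\<omega> :: "int ^ 'd \<Rightarrow> real ^ 'm ^ 'n"
    and j :: "int ^ 'd"
    and c :: real
  assumes op: "operator_with_symbol t M A"
    and contr: "\<And>\<xi>. \<xi> \<in> frequency_box j \<Longrightarrow>
      matrix_norm (mat 1 - M \<xi> ** pseudo_inverse (complex_matrix (M\<omega> j))) \<le> \<rho>"
    and c_eq: "c = (2 * pi) ^ CARD('d)"
begin

abbreviation "P \<equiv> pseudo_inverse (complex_matrix (M\<omega> j))"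
abbreviation "B \<equiv> box_measure j"
abbreviation "e k \<equiv> wavelet_hat (j, k)"

sublocale orthogonal_basis B e c
  unfolding c_eq by (rule orthogonal_basis_wavelet_hat)

section \<open>Images of wavelets under \<open>A\<close>, and the blocks of the wavelet
  matrix\<close>

lemma
  shows operator_wavelet_AE: "AE \<xi> in lborel. dist_fourier (A (unit_dist_vec b (wavelet_dist q)) $ a) \<xi> = M \<xi> $ a $ b * wavelet_hat q \<xi>"
    and operator_wavelet_sobolev: "A (unit_dist_vec b (wavelet_dist q)) $ a \<in> sobolev (- t / 2)"
proof -
  let ?u = "unit_dist_vec b (wavelet_dist q) :: (real ^ 'd) distribution ^ 'm"
  have u: "?u \<in> sobolev_vec (t / 2)"
    by (simp add: sobolev_vec_def unit_dist_vec_def wavelet_dist_sobolev zero_sobolev)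
  then have "A ?u \<in> sobolev_vec (- t / 2)" using op by (auto simp: operator_with_symbol_def)
  then show "A ?u $ a \<in> sobolev (- t / 2)" by (auto simp: sobolev_vec_def)
  have 1: "AE \<xi> in lborel. dist_fourier_vec (A ?u) \<xi> = M \<xi> *v dist_fourier_vec ?u \<xi>"
    using op u by (auto simp: operator_with_symbol_def)
  have 2: "AE \<xi> in lborel. dist_fourier (wavelet_dist q) \<xi> = wavelet_hat q \<xi>" by (rule dist_fourier_wavelet)
  have 3: "AE \<xi> in lborel. dist_fourier (\<lambda>\<phi>. 0) (\<xi> :: real ^ 'd) = 0" by (rule dist_fourier_zero_AE)
  from 1 2 3 show "AE \<xi> in lborel. dist_fourier (A ?u $ a) \<xi> = M \<xi> $ a $ b * wavelet_hat q \<xi>"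
  proof eventually_elim
    case (elim \<xi>)
    have "dist_fourier (A ?u $ a) \<xi> = dist_fourier_vec (A ?u) \<xi> $ a" by (simp add: dist_fourier_vec_def)
    also have "\<dots> = (\<Sum>b'\<in>UNIV. M \<xi> $ a $ b' * dist_fourier_vec ?u \<xi> $ b')"
      unfolding elim(1) by (simp add: matrix_vector_mult_def)
    also have "\<dots> = (\<Sum>b'\<in>UNIV. if b' = b then M \<xi> $ a $ b * wavelet_hat q \<xi> else 0)"
      by (intro sum.cong) (auto simp: dist_fourier_vec_def unit_dist_vec_def elim)
    finally show ?case by simp
  qed
qed

text \<open>A Borel measurable version of the symbol on the frequency box; \<open>M\<close> itself need not be
  measurable.\<close>

definition symbol_entry :: "'n \<Rightarrow> 'm \<Rightarrow> real ^ 'd \<Rightarrow> complex" where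
  "symbol_entry a b \<xi> = dist_fourier (A (unit_dist_vec b (wavelet_dist (j, 0))) $ a) \<xi> / wavelet_hat (j, 0) \<xi>"

lemma symbol_entry_measurable [measurable]: "symbol_entry a b \<in> borel_measurable borel"
  unfolding symbol_entry_def[abs_def]
  by (intro borel_measurable_divide sobolev_dist_fourier(1)[OF operator_wavelet_sobolev] wavelet_hat_measurable)

text \<open>The wavelet transform at position 0 has constant nonzero modulus on the box, so dividing
  by it recovers the symbol.\<close>

lemma symbol_entry_AE: "AE \<xi> in lborel. \<xi> \<in> frequency_box j \<longrightarrow> symbol_entry a b \<xi> = M \<xi> $ a $ b"
  using operator_wavelet_AE[of b "(j, 0)" a]
proof eventually_elim
  case (elim \<xi>)
  show ?case
  proof
    assume "\<xi> \<in> frequency_box j"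
    then have "wavelet_hat (j, 0) \<xi> \<noteq> 0"
      using norm_wavelet_hat[of "(j, 0)" \<xi>] wavelet_amplitude_pos[of j] by auto
    then show "symbol_entry a b \<xi> = M \<xi> $ a $ b" unfolding symbol_entry_def elim by simp
  qed
qed

lemma operator_wavelet_box_AE:
  "AE \<xi> in B. dist_fourier (A (unit_dist_vec b (wavelet_dist (j, k))) $ a) \<xi> = symbol_entry a b \<xi> * e k \<xi>"
  unfolding AE_box_measure using operator_wavelet_AE[of b "(j, k)" a] symbol_entry_AE[of a b]
  by eventually_elim simp

lemma e_measurable: "e k \<in> borel_measurable B"
  by (rule square_integrable_measurable[OF sq])

lemma symbol_entry_e_measurable: "(\<lambda>\<xi>. symbol_entry a b \<xi> * e k \<xi>) \<in> borel_measurable B"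
  by (rule borel_measurable_box_measure) measurable

text \<open>This comes from the mapping property of the operator: \<open>A\<close> sends the wavelet
  into a Sobolev space, whose members have square-integrable transforms on the box.\<close>

lemma square_integrable_symbol_entry: "square_integrable B (\<lambda>\<xi>. symbol_entry a b \<xi> * e k \<xi>)"
  by (rule square_integrable_cong_AE[OF sobolev_square_integrable_box[OF operator_wavelet_sobolev]
        symbol_entry_e_measurable operator_wavelet_box_AE])

lemma wavelet_matrix_same_level:
  "wavelet_matrix A (j, k) (j, k') $ a $ b = l2_inner B (\<lambda>\<xi>. symbol_entry a b \<xi> * e k' \<xi>) (e k) / c"
proof -
  have "l2_inner B (dist_fourier (A (unit_dist_vec b (wavelet_dist (j, k'))) $ a)) (e k) = l2_inner B (\<lambda>\<xi>. symbol_entry a b \<xi> * e k' \<xi>) (e k)"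
    by (rule l2_inner_cong_AE[OF operator_wavelet_box_AE
          square_integrable_measurable[OF sobolev_square_integrable_box[OF operator_wavelet_sobolev]]
          symbol_entry_e_measurable e_measurable])
  then show ?thesis
    by (simp add: wavelet_matrix_def pairing_wavelet_dist[OF operator_wavelet_sobolev] c_eq)
qed

lemma wavelet_matrix_other_level:
  assumes "j' \<noteq> j"
  shows "wavelet_matrix A (j, k) (j', k') = 0"
proof -
  have "l2_inner B (dist_fourier (A (unit_dist_vec b (wavelet_dist (j', k'))) $ a)) (e k) = 0" for a b
    unfolding l2_inner_def
  proof (rule integral_eq_zero_AE)
    show "AE \<xi> in B. dist_fourier (A (unit_dist_vec b (wavelet_dist (j', k'))) $ a) \<xi> * cnj (e k \<xi>) = 0"
      unfolding AE_box_measure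
      using operator_wavelet_AE[of b "(j', k')" a] AE_frequency_box_disjoint[OF assms]
      by eventually_elim (use wavelet_hat_outside[of _ "(j', k')"] in auto)
  qed
  then show ?thesis
    by (simp add: wavelet_matrix_def pairing_wavelet_dist[OF operator_wavelet_sobolev] vec_eq_iff)
qed

text \<open>A measurable version of the entries of \<open>M P\<close>, the multiplier through which
  \<open>A\<close> acts on vectors with \<open>P\<close> in front.\<close>

definition product_entry :: "'n \<Rightarrow> 'n \<Rightarrow> real ^ 'd \<Rightarrow> complex" where
  "product_entry a d \<xi> = (\<Sum>b\<in>UNIV. symbol_entry a b \<xi> * P $ b $ d)"

lemma product_entry_measurable [measurable]: "product_entry a d \<in> borel_measurable borel"
  unfolding product_entry_def[abs_def] by measurable

lemma product_entry_AE: "AE \<xi> in B. product_entry a d \<xi> = (M \<xi> ** P) $ a $ d"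
proof -
  have "AE \<xi> in lborel. \<forall>b. \<xi> \<in> frequency_box j \<longrightarrow> symbol_entry a b \<xi> = M \<xi> $ a $ b"
    unfolding AE_all_countable using symbol_entry_AE by blast
  then show ?thesis
    unfolding AE_box_measure by eventually_elim (simp add: product_entry_def matrix_matrix_mult_def)
qed

text \<open>An entry of the identity contributes at most 1 and an entry of the defect at most its
  operator norm, hence at most \<rho>. Multiplication by \<open>product_entry\<close> is therefore
  bounded on L2.\<close>

lemma product_entry_bound: "AE \<xi> in B. norm (product_entry a d \<xi>) \<le> 1 + \<rho>"
proof -
  have "norm ((M \<xi> ** P) $ a $ d) \<le> 1 + \<rho>" if \<xi>: "\<xi> \<in> frequency_box j" for \<xi>
  proof -
    have "(M \<xi> ** P) $ a $ d = (mat 1 :: complex ^ 'n ^ 'n) $ a $ d - (mat 1 - M \<xi> ** P) $ a $ d" by simp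
    then have "norm ((M \<xi> ** P) $ a $ d) \<le> norm ((mat 1 :: complex ^ 'n ^ 'n) $ a $ d) + norm ((mat 1 - M \<xi> ** P) $ a $ d)"
      by (metis norm_triangle_ineq4)
    moreover have "norm ((mat 1 :: complex ^ 'n ^ 'n) $ a $ d) \<le> 1" by (simp add: mat_def)
    moreover have "norm ((mat 1 - M \<xi> ** P) $ a $ d) \<le> \<rho>"
      using matrix_entry_norm_le contr[OF \<xi>] by (rule order_trans)
    ultimately show ?thesis by linarith
  qed
  then show ?thesis using product_entry_AE[of a d] unfolding AE_box_measure by (auto elim: eventually_mono)
qed

section \<open>Square-integrable vector functions on the box, and the iterates in terms of
  them\<close>

definition l2_vec :: "(real ^ 'd \<Rightarrow> complex ^ 'n) \<Rightarrow> bool" where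
  "l2_vec F \<longleftrightarrow> (\<forall>a. square_integrable B (\<lambda>\<xi>. F \<xi> $ a))"

text \<open>Division by \<open>c\<close> is the normalisation in \<open>pairing\<close>; since each
  \<open>e k\<close> has squared norm \<open>c\<close>, these are also the expansion coefficients of
  \<open>F\<close> in the basis.\<close>

definition coef :: "(real ^ 'd \<Rightarrow> complex ^ 'n) \<Rightarrow> int ^ 'd \<Rightarrow> complex ^ 'n" where
  "coef F k = (\<chi> a. l2_inner B (\<lambda>\<xi>. F \<xi> $ a) (e k) / c)"

text \<open>The Fourier side of the preconditioner followed by \<open>A\<close>: multiplication by
  \<open>M P\<close>, in its measurable version.\<close>

definition preconditioned :: "(real ^ 'd \<Rightarrow> complex ^ 'n) \<Rightarrow> real ^ 'd \<Rightarrow> complex ^ 'n" where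
  "preconditioned W \<xi> = (\<chi> a. \<Sum>d\<in>UNIV. product_entry a d \<xi> * W \<xi> $ d)"

lemma square_integrable_product_entry: "square_integrable B f \<Longrightarrow> square_integrable B (\<lambda>\<xi>. product_entry a d \<xi> * f \<xi>)"
  by (rule square_integrable_bounded_mult[OF _ borel_measurable_box_measure[OF product_entry_measurable] product_entry_bound])

lemma l2_vec_preconditioned: "l2_vec W \<Longrightarrow> l2_vec (preconditioned W)"
  by (auto simp: l2_vec_def preconditioned_def intro!: square_integrable_sum square_integrable_product_entry)

lemma l2_vec_add: "l2_vec F \<Longrightarrow> l2_vec H \<Longrightarrow> l2_vec (\<lambda>\<xi>. F \<xi> + H \<xi>)"
  by (auto simp: l2_vec_def intro!: square_integrable_add)

lemma l2_vec_diff: "l2_vec F \<Longrightarrow> l2_vec H \<Longrightarrow> l2_vec (\<lambda>\<xi>. F \<xi> - H \<xi>)"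
  by (auto simp: l2_vec_def intro!: square_integrable_diff)

lemma coef_add: "l2_vec F \<Longrightarrow> l2_vec H \<Longrightarrow> coef (\<lambda>\<xi>. F \<xi> + H \<xi>) k = coef F k + coef H k"
  by (auto simp: l2_vec_def coef_def vec_eq_iff l2_inner_add_left[OF _ _ sq] add_divide_distrib)

lemma coef_diff: "l2_vec F \<Longrightarrow> l2_vec H \<Longrightarrow> coef (\<lambda>\<xi>. F \<xi> - H \<xi>) k = coef F k - coef H k"
  by (auto simp: l2_vec_def coef_def vec_eq_iff l2_inner_diff_left[OF _ _ sq] diff_divide_distrib)

text \<open>The product of an infinite matrix row with a coefficient vector. Moving the multiplier
  to the other argument as its conjugate turns the row into coefficients of a square-integrable
  function, so the sum is an instance of \<open>parseval_inner\<close>.\<close>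

lemma l2_inner_product_entry:
  assumes f: "square_integrable B f"
  shows "((\<lambda>k'. (l2_inner B (\<lambda>\<xi>. product_entry a d \<xi> * e k' \<xi>) (e k) / c) * (l2_inner B f (e k') / c))
    has_sum l2_inner B (\<lambda>\<xi>. product_entry a d \<xi> * f \<xi>) (e k) / c) UNIV"
proof -
  let ?g = "\<lambda>\<xi>. cnj (product_entry a d \<xi>) * e k \<xi>"
  have g: "square_integrable B ?g"
  proof (rule square_integrable_bounded_mult[OF sq])
    show "(\<lambda>\<xi>. cnj (product_entry a d \<xi>)) \<in> borel_measurable B" by (rule borel_measurable_box_measure) measurable
    show "AE \<xi> in B. norm (cnj (product_entry a d \<xi>)) \<le> 1 + \<rho>" using product_entry_bound by simp
  qed
  have adj: "l2_inner B (\<lambda>\<xi>. product_entry a d \<xi> * h \<xi>) (e k) = l2_inner B h ?g" for h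
    unfolding l2_inner_def by (simp add: mult_ac)
  have "((\<lambda>k'. inverse (complex_of_real c * complex_of_real c) * (l2_inner B f (e k') * cnj (l2_inner B ?g (e k'))))
      has_sum inverse (complex_of_real c * complex_of_real c) * (complex_of_real c * l2_inner B f ?g)) UNIV"
    by (intro has_sum_cmult_right parseval_inner f g)
  also have "inverse (complex_of_real c * complex_of_real c) * (complex_of_real c * l2_inner B f ?g) = l2_inner B f ?g / c"
    using c_pos by (simp add: field_simps)
  also have "(\<lambda>k'. inverse (complex_of_real c * complex_of_real c) * (l2_inner B f (e k') * cnj (l2_inner B ?g (e k'))))
     = (\<lambda>k'. (l2_inner B (e k') ?g / c) * (l2_inner B f (e k') / c))"
    unfolding l2_inner_commute[of B _ ?g] by (simp add: divide_inverse mult_ac)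
  finally show ?thesis unfolding adj .
qed

text \<open>By associativity \<open>P\<close> is absorbed into the block of \<open>A\<close>, which
  becomes a block of multiplication by \<open>product_entry\<close>. For that multiplier the sum
  over positions is covered by \<open>l2_inner_product_entry\<close>.\<close>

lemma wavelet_matrix_precond:
  "(wavelet_matrix A (j, k) (j, k') *v (P *v x)) $ a
    = (\<Sum>d\<in>UNIV. (l2_inner B (\<lambda>\<xi>. product_entry a d \<xi> * e k' \<xi>) (e k) / c) * x $ d)"
proof -
  have product_entry: "l2_inner B (\<lambda>\<xi>. product_entry a d \<xi> * e k' \<xi>) (e k) = (\<Sum>b\<in>UNIV. P $ b $ d * l2_inner B (\<lambda>\<xi>. symbol_entry a b \<xi> * e k' \<xi>) (e k))" for d
  proof -
    have "(\<lambda>\<xi>. product_entry a d \<xi> * e k' \<xi>) = (\<lambda>\<xi>. \<Sum>b\<in>UNIV. P $ b $ d * (symbol_entry a b \<xi> * e k' \<xi>))"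
      by (simp add: product_entry_def sum_distrib_right sum_distrib_left mult_ac)
    then have "l2_inner B (\<lambda>\<xi>. product_entry a d \<xi> * e k' \<xi>) (e k) = l2_inner B (\<lambda>\<xi>. \<Sum>b\<in>UNIV. P $ b $ d * (symbol_entry a b \<xi> * e k' \<xi>)) (e k)"
      by (simp only:)
    also have "\<dots> = (\<Sum>b\<in>UNIV. l2_inner B (\<lambda>\<xi>. P $ b $ d * (symbol_entry a b \<xi> * e k' \<xi>)) (e k))"
      by (rule l2_inner_sum_left) (auto intro: square_integrable_cmult square_integrable_symbol_entry sq)
    finally show ?thesis unfolding l2_inner_cmult_left .
  qed
  have "(wavelet_matrix A (j, k) (j, k') *v (P *v x)) $ a = ((wavelet_matrix A (j, k) (j, k') ** P) *v x) $ a"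
    by (simp add: matrix_vector_mul_assoc)
  also have "\<dots> = (\<Sum>d\<in>UNIV. (\<Sum>b\<in>UNIV. (l2_inner B (\<lambda>\<xi>. symbol_entry a b \<xi> * e k' \<xi>) (e k) / c) * P $ b $ d) * x $ d)"
    by (simp add: matrix_vector_mult_def matrix_matrix_mult_def wavelet_matrix_same_level)
  also have "\<dots> = (\<Sum>d\<in>UNIV. (l2_inner B (\<lambda>\<xi>. product_entry a d \<xi> * e k' \<xi>) (e k) / c) * x $ d)"
    unfolding product_entry sum_divide_distrib by (simp add: mult_ac)
  finally show ?thesis .
qed

lemma apply_wavelet_matrix_level:
  assumes W: "l2_vec W" and u: "\<And>k. u (j, k) = P *v coef W k"
  shows "apply_wavelet_matrix A u (j, k) = coef (preconditioned W) k"
proof -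
  \<comment> \<open>Convergence is part of the claim: the infinite sum in
    \<open>apply_wavelet_matrix\<close> takes the default value zero when the family is not
    summable.\<close>
  have "((\<lambda>k'. wavelet_matrix A (j, k) (j, k') *v (P *v coef W k')) has_sum coef (preconditioned W) k) UNIV"
  proof (rule has_sum_vec)
    fix a
    have sqW: "square_integrable B (\<lambda>\<xi>. W \<xi> $ d)" for d using W by (simp add: l2_vec_def)
    have "coef (preconditioned W) k $ a = l2_inner B (\<lambda>\<xi>. \<Sum>d\<in>UNIV. product_entry a d \<xi> * W \<xi> $ d) (e k) / c"
      by (simp add: coef_def preconditioned_def)
    also have "\<dots> = (\<Sum>d\<in>UNIV. l2_inner B (\<lambda>\<xi>. product_entry a d \<xi> * W \<xi> $ d) (e k) / c)"
      unfolding sum_divide_distrib[symmetric]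
      by (subst l2_inner_sum_left) (auto intro: square_integrable_product_entry sqW sq)
    finally have s: "coef (preconditioned W) k $ a = (\<Sum>d\<in>UNIV. l2_inner B (\<lambda>\<xi>. product_entry a d \<xi> * W \<xi> $ d) (e k) / c)" .
    show "((\<lambda>k'. (wavelet_matrix A (j, k) (j, k') *v (P *v coef W k')) $ a) has_sum coef (preconditioned W) k $ a) UNIV"
      unfolding wavelet_matrix_precond s unfolding coef_def vec_lambda_beta
      by (intro has_sum_sum_finite l2_inner_product_entry sqW) simp
  qed
  \<comment> \<open>From the positions of one level to all indices: the remaining blocks in this row
    vanish.\<close>
  then have "((\<lambda>q. wavelet_matrix A (j, k) q *v u q) \<circ> Pair j has_sum coef (preconditioned W) k) UNIV"
    by (simp add: o_def u)
  then have "((\<lambda>q. wavelet_matrix A (j, k) q *v u q) has_sum coef (preconditioned W) k) (range (Pair j))"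
    by (subst has_sum_reindex) (auto simp: inj_on_def)
  then have "((\<lambda>q. wavelet_matrix A (j, k) q *v u q) has_sum coef (preconditioned W) k) UNIV"
  proof (rule has_sum_cong_neutral[THEN iffD1, rotated -1])
    fix q :: "'d wavelet_index" assume "q \<in> UNIV - range (Pair j)"
    then have "fst q \<noteq> j" by (metis DiffD2 prod.collapse rangeI)
    then have "wavelet_matrix A (j, k) q = 0" using wavelet_matrix_other_level[of "fst q" k "snd q"] by simp
    then show "wavelet_matrix A (j, k) q *v u q = 0" by simp
  qed auto
  then show ?thesis unfolding apply_wavelet_matrix_def by (rule infsumI)
qed

text \<open>Parseval contributes one factor \<open>c\<close> and the normalisation of
  \<open>coef\<close> two factors 1 / c, which leaves the division by \<open>c\<close>.\<close>

lemma parseval_coef: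
  assumes F: "l2_vec F"
  shows "((\<lambda>k. \<Sum>a\<in>UNIV. (cmod (coef F k $ a))\<^sup>2) has_sum (LINT \<xi>|B. (norm (F \<xi>))\<^sup>2) / c) UNIV"
proof -
  have sqF: "square_integrable B (\<lambda>\<xi>. F \<xi> $ a)" for a using F by (simp add: l2_vec_def)
  have "((\<lambda>k. (cmod (coef F k $ a))\<^sup>2) has_sum l2_sq B (\<lambda>\<xi>. F \<xi> $ a) / c) UNIV" for a
  proof -
    have "((\<lambda>k. inverse (c\<^sup>2) * (norm (l2_inner B (\<lambda>\<xi>. F \<xi> $ a) (e k)))\<^sup>2) has_sum inverse (c\<^sup>2) * (c * l2_sq B (\<lambda>\<xi>. F \<xi> $ a))) UNIV"
      by (intro has_sum_cmult_right parseval sqF)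
    also have "(\<lambda>k. inverse (c\<^sup>2) * (norm (l2_inner B (\<lambda>\<xi>. F \<xi> $ a) (e k)))\<^sup>2) = (\<lambda>k. (cmod (coef F k $ a))\<^sup>2)"
      using c_pos by (simp add: coef_def norm_divide power_divide divide_inverse mult.commute norm_mult norm_inverse power_mult_distrib power_inverse)
    also have "inverse (c\<^sup>2) * (c * l2_sq B (\<lambda>\<xi>. F \<xi> $ a)) = l2_sq B (\<lambda>\<xi>. F \<xi> $ a) / c"
      using c_pos by (simp add: power2_eq_square field_simps)
    finally show ?thesis .
  qed
  then have "((\<lambda>k. \<Sum>a\<in>UNIV. (cmod (coef F k $ a))\<^sup>2) has_sum (\<Sum>a\<in>UNIV. l2_sq B (\<lambda>\<xi>. F \<xi> $ a) / c)) UNIV"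
    by (intro has_sum_sum_finite) auto
  also have "(\<Sum>a\<in>UNIV. l2_sq B (\<lambda>\<xi>. F \<xi> $ a) / c) = (LINT \<xi>|B. (norm (F \<xi>))\<^sup>2) / c"
    unfolding sum_divide_distrib[symmetric] norm_vec_sq l2_sq_def
    by (subst Bochner_Integration.integral_sum) (use sqF in \<open>auto simp: square_integrable_def\<close>)
  finally show ?thesis .
qed

lemma integrable_norm_sq_vec: "l2_vec F \<Longrightarrow> integrable B (\<lambda>\<xi>. (norm (F \<xi>))\<^sup>2)"
  unfolding norm_vec_sq by (auto simp: l2_vec_def square_integrable_def intro!: Bochner_Integration.integrable_sum)

lemma defect_contracts:
  assumes R: "l2_vec R"
  shows "(LINT \<xi>|B. (norm (R \<xi> - preconditioned R \<xi>))\<^sup>2) \<le> \<rho>\<^sup>2 * (LINT \<xi>|B. (norm (R \<xi>))\<^sup>2)"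
proof -
  \<comment> \<open>All entries are treated at once, so that off a single null set the true product
    \<open>M P\<close> is available and its operator-norm bound can be applied at the point.\<close>
  have "AE \<xi> in B. \<forall>a d. product_entry a d \<xi> = (M \<xi> ** P) $ a $ d"
    unfolding AE_all_countable using product_entry_AE by blast
  moreover have "AE \<xi> in B. \<xi> \<in> frequency_box j" unfolding AE_box_measure by simp
  ultimately have "AE \<xi> in B. (norm (R \<xi> - preconditioned R \<xi>))\<^sup>2 \<le> \<rho>\<^sup>2 * (norm (R \<xi>))\<^sup>2"
  proof eventually_elim
    case (elim \<xi>)
    have "preconditioned R \<xi> = (M \<xi> ** P) *v R \<xi>" using elim(1) by (simp add: preconditioned_def vec_eq_iff matrix_vector_mult_def)
    then have "R \<xi> - preconditioned R \<xi> = (mat 1 - M \<xi> ** P) *v R \<xi>"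
      by (simp add: matrix_vector_mult_diff_rdistrib)
    then have "norm (R \<xi> - preconditioned R \<xi>) \<le> matrix_norm (mat 1 - M \<xi> ** P) * norm (R \<xi>)"
      using matrix_vector_mult_norm_le by metis
    also have "\<dots> \<le> \<rho> * norm (R \<xi>)" using contr[OF elim(2)] by (rule mult_right_mono) simp
    finally have "(norm (R \<xi> - preconditioned R \<xi>))\<^sup>2 \<le> (\<rho> * norm (R \<xi>))\<^sup>2" by (rule power_mono) simp
    then show ?case by (simp add: power_mult_distrib)
  qed
  then have "(LINT \<xi>|B. (norm (R \<xi> - preconditioned R \<xi>))\<^sup>2) \<le> (LINT \<xi>|B. \<rho>\<^sup>2 * (norm (R \<xi>))\<^sup>2)"
    by (intro integral_mono_AE integrable_norm_sq_vec l2_vec_diff l2_vec_preconditioned R integrable_mult_right)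
  then show ?thesis by simp
qed

lemma
  assumes v: "v \<in> sobolev_vec (- t / 2)"
  defines "V \<equiv> (\<lambda>\<xi>. \<chi> a. dist_fourier (v $ a) \<xi>)"
  shows l2_vec_data: "l2_vec V" and wavelet_coeffs_level: "wavelet_coeffs v (j, k) = coef V k"
proof -
  have va: "v $ a \<in> sobolev (- t / 2)" for a using v by (simp add: sobolev_vec_def)
  show "l2_vec V" using sobolev_square_integrable_box[OF va] by (simp add: l2_vec_def V_def)
  have "pairing (v $ a) (wavelet_dist (j, k)) = l2_inner B (dist_fourier (v $ a)) (e k) / c" for a
    unfolding pairing_wavelet_dist[OF va] c_eq ..
  then show "wavelet_coeffs v (j, k) = coef V k"
    by (simp add: wavelet_coeffs_def coef_def V_def)
qed

lemma residual_level:
  assumes v: "v \<in> sobolev_vec (- t / 2)" and W: "l2_vec W" and u: "\<And>k. u (j, k) = P *v coef W k"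
  shows "residual A v u (j, k) = coef (\<lambda>\<xi>. (\<chi> a. dist_fourier (v $ a) \<xi>) - preconditioned W \<xi>) k"
  unfolding residual_def wavelet_coeffs_level[OF v] apply_wavelet_matrix_level[OF W u]
  by (rule coef_diff[OF l2_vec_data[OF v] l2_vec_preconditioned[OF W], symmetric])

text \<open>\<open>P\<close> is constant on the level and \<open>coef\<close> is additive, so
  preconditioning the residual and adding it to the iterate amounts to adding \<open>R\<close> to
  \<open>W\<close> under the same \<open>P\<close>.\<close>

lemma richardson_step_level:
  assumes v: "v \<in> sobolev_vec (- t / 2)" and W: "l2_vec W" "\<And>k. richardson A M\<omega> v p (j, k) = P *v coef W k"
  defines "R \<equiv> \<lambda>\<xi>. (\<chi> a. dist_fourier (v $ a) \<xi>) - preconditioned W \<xi>"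
  shows "l2_vec R" and "richardson A M\<omega> v (Suc p) (j, k) = P *v coef (\<lambda>\<xi>. W \<xi> + R \<xi>) k"
proof -
  show R: "l2_vec R" unfolding R_def by (intro l2_vec_diff l2_vec_data[OF v] l2_vec_preconditioned W)
  show "richardson A M\<omega> v (Suc p) (j, k) = P *v coef (\<lambda>\<xi>. W \<xi> + R \<xi>) k"
    by (simp add: preconditioner_def residual_level[OF v W] coef_add[OF W(1) R] W(2)
        matrix_vector_right_distrib flip: R_def)
qed

text \<open>The invariant of the iteration; it starts with W = 0. It also supplies the form in which
  \<open>apply_wavelet_matrix_level\<close> evaluates \<open>A\<close> on the iterate.\<close>

lemma richardson_level:
  assumes v: "v \<in> sobolev_vec (- t / 2)"
  shows "\<exists>W. l2_vec W \<and> (\<forall>k. richardson A M\<omega> v p (j, k) = P *v coef W k)"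
proof (induction p)
  case 0
  have "coef (\<lambda>\<xi>. 0) k = 0" for k by (simp add: coef_def l2_inner_def vec_eq_iff)
  then show ?case by (intro exI[of _ "\<lambda>\<xi>. 0"]) (simp add: l2_vec_def square_integrable_zero)
next
  case (Suc p)
  then obtain W where W: "l2_vec W" "\<And>k. richardson A M\<omega> v p (j, k) = P *v coef W k" by blast
  show ?case using richardson_step_level[OF v W] l2_vec_add[OF W(1)] by blast
qed

lemma residual_level_decrease:
  assumes v: "v \<in> sobolev_vec (- t / 2)"
  defines "s p k \<equiv> \<Sum>a\<in>UNIV. (cmod (residual A v (richardson A M\<omega> v p) (j, k) $ a))\<^sup>2"
  shows "\<exists>x y. (s p has_sum x) UNIV \<and> (s (Suc p) has_sum y) UNIV \<and> y \<le> \<rho>\<^sup>2 * x"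
proof -
  obtain W where W: "l2_vec W" "\<And>k. richardson A M\<omega> v p (j, k) = P *v coef W k"
    using richardson_level[OF v] by blast
  let ?V = "\<lambda>\<xi>. \<chi> a. dist_fourier (v $ a) \<xi>"
  let ?R = "\<lambda>\<xi>. ?V \<xi> - preconditioned W \<xi>"
  let ?W = "\<lambda>\<xi>. W \<xi> + ?R \<xi>"
  note R = richardson_step_level(1)[OF v W]
  note r = residual_level[OF v l2_vec_add[OF W(1) R] richardson_step_level(2)[OF v W]]
  \<comment> \<open>By linearity the new residual V - M P (W + R) is the old one minus M P
    R.\<close>
  have "?V \<xi> - preconditioned ?W \<xi> = ?R \<xi> - preconditioned ?R \<xi>" for \<xi>
    by (simp add: preconditioned_def vec_eq_iff algebra_simps sum.distrib sum_subtractf)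
  then have r': "residual A v (richardson A M\<omega> v (Suc p)) (j, k) = coef (\<lambda>\<xi>. ?R \<xi> - preconditioned ?R \<xi>) k" for k
    unfolding r by (simp only:)
  have "(s p has_sum (LINT \<xi>|B. (norm (?R \<xi>))\<^sup>2) / c) UNIV"
    unfolding s_def residual_level[OF v W] by (rule parseval_coef[OF R])
  moreover have "(s (Suc p) has_sum (LINT \<xi>|B. (norm (?R \<xi> - preconditioned ?R \<xi>))\<^sup>2) / c) UNIV"
    unfolding s_def r' by (rule parseval_coef[OF l2_vec_diff[OF R l2_vec_preconditioned[OF R]]])
  moreover have "(LINT \<xi>|B. (norm (?R \<xi> - preconditioned ?R \<xi>))\<^sup>2) / c \<le> \<rho>\<^sup>2 * ((LINT \<xi>|B. (norm (?R \<xi>))\<^sup>2) / c)"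
    using divide_right_mono[OF defect_contracts[OF R], of c] c_pos by simp
  ultimately show ?thesis by blast
qed

end

section \<open>From estimates on each level to the whole index set\<close>

lemma summable_on_levels_le:
  fixes f g :: "'a \<times> 'b \<Rightarrow> real"
  assumes f0: "\<And>q. 0 \<le> f q" and g0: "\<And>q. 0 \<le> g q" and C: "0 \<le> C" and g: "g summable_on UNIV"
    and level: "\<And>j. \<exists>x y. ((\<lambda>k. g (j, k)) has_sum x) UNIV \<and> ((\<lambda>k. f (j, k)) has_sum y) UNIV \<and> y \<le> C * x"
  shows "f summable_on UNIV" "infsum f UNIV \<le> C * infsum g UNIV"
proof -
  obtain x y where x: "\<And>j. ((\<lambda>k. g (j, k)) has_sum x j) UNIV" and y: "\<And>j. ((\<lambda>k. f (j, k)) has_sum y j) UNIV"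
    and le: "\<And>j. y j \<le> C * x j" using level by metis
  have bound: "sum f F \<le> C * infsum g UNIV" if F: "finite F" for F
  proof -
    \<comment> \<open>A finite set of indices lies in the rectangle of its projections. Each row of
      the rectangle is below a full level sum, and the level sums of \<open>g\<close> over finitely
      many levels stay below its total; this bound gives both summability of \<open>f\<close> and
      the inequality.\<close>
    let ?J = "fst ` F" and ?K = "snd ` F"
    have "sum f F \<le> sum f (?J \<times> ?K)"
      by (rule sum_mono2) (use F f0 subset_fst_snd[of F] in auto)
    also have "\<dots> = (\<Sum>j\<in>?J. \<Sum>k\<in>?K. f (j, k))" by (simp add: sum.cartesian_product)
    also have "\<dots> \<le> (\<Sum>j\<in>?J. y j)"
    proof (rule sum_mono)
      fix j
      have "(\<Sum>k\<in>?K. f (j, k)) \<le> infsum (\<lambda>k. f (j, k)) UNIV"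
        by (rule finite_sum_le_infsum) (use F f0 has_sum_imp_summable[OF y] in auto)
      then show "(\<Sum>k\<in>?K. f (j, k)) \<le> y j" using infsumI[OF y] by simp
    qed
    also have "\<dots> \<le> C * (\<Sum>j\<in>?J. x j)" unfolding sum_distrib_left by (intro sum_mono le)
    also have "(\<Sum>j\<in>?J. x j) \<le> infsum g UNIV"
    proof -
      have s: "g summable_on (Sigma ?J (\<lambda>_. UNIV))" by (rule summable_on_subset_banach[OF g]) simp
      have "(\<Sum>j\<in>?J. x j) = (\<Sum>j\<in>?J. infsum (\<lambda>k. g (j, k)) UNIV)" by (simp add: infsumI[OF x])
      also have "\<dots> = infsum g (Sigma ?J (\<lambda>_. UNIV))"
        using infsum_Sigma_banach[OF s] F by simp
      also have "\<dots> \<le> infsum g UNIV" by (rule infsum_mono_neutral[OF s g]) (use g0 in auto)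
      finally show ?thesis .
    qed
    finally show ?thesis using C by (simp add: mult_left_mono)
  qed
  show s: "f summable_on UNIV"
    by (rule nonneg_bdd_above_summable_on) (use f0 bound in \<open>auto simp: bdd_above_def\<close>)
  show "infsum f UNIV \<le> C * infsum g UNIV"
    by (rule infsum_le_finite_sums[OF s]) (use bound in auto)
qed

theorem theorem5p2:
  fixes t \<rho> :: real
    and M :: "real ^ 'd \<Rightarrow> complex ^ 'm ^ 'n"
    and A :: "(real ^ 'd) distribution ^ 'm \<Rightarrow> (real ^ 'd) distribution ^ 'n"
    and M\<omega> :: "int ^ 'd \<Rightarrow> real ^ 'm ^ 'n"
  assumes "operator_with_symbol t M A"
    and "\<And>\<xi>. (\<Prod>i\<in>UNIV. \<xi> $ i) \<noteq> 0 \<Longrightarrow>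
           \<exists>X. is_pseudo_inverse (M \<xi>) X \<and> M \<xi> ** X = mat 1"
    and "\<rho> < 1"
    and "\<And>j \<xi>. \<xi> \<in> frequency_box j \<Longrightarrow>
           matrix_norm (mat 1 - M \<xi> ** pseudo_inverse (complex_matrix (M\<omega> j))) \<le> \<rho>"
  shows "\<exists>r::real. 0 \<le> r \<and> r < 1 \<and>
           (\<forall>v \<in> sobolev_vec (- t / 2). \<forall>p::nat. 1 \<le> p \<longrightarrow>
              l2_norm (- t / 2) (residual A v (richardson A M\<omega> v p))
                \<le> ennreal r * l2_norm (- t / 2) (residual A v (richardson A M\<omega> v (p - 1))))"
proof (intro exI[of _ "max \<rho> (1 / 2)"] conjI ballI allI impI)
  \<comment> \<open>The rate has to be positive, not merely nonnegative: when the old norm is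
    infinite, the right-hand side must be infinite too, but 0 * \<infinity> = 0 in
    \<open>ennreal\<close>. Any value strictly between 0 and 1 could replace 1 / 2.\<close>
  let ?r = "max \<rho> (1 / 2)"
  show "0 \<le> ?r" "?r < 1" using assms(3) by auto
  fix v :: "(real ^ 'd) distribution ^ 'n" and p :: nat
  assume v: "v \<in> sobolev_vec (- t / 2)" and p: "1 \<le> p"
  define s where "s p = weighted_sq (- t / 2) (residual A v (richardson A M\<omega> v p))" for p
  obtain p' where p': "p = Suc p'" using p by (cases p) auto
  \<comment> \<open>Comparing squares requires 0 \<le> \<rho>, which follows from the contraction
    bound at any point of a box; at level 0 the point with all coordinates pi, an endpoint of the
    positive interval, will do.\<close>
  have \<rho>: "\<rho>\<^sup>2 \<le> ?r\<^sup>2"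
  proof -
    have "frequency_box (0 :: int ^ 'd) \<noteq> {}"
    proof -
      have "(\<chi> i. pi) \<in> frequency_box (0 :: int ^ 'd)" by (simp add: frequency_box_def)
      then show ?thesis by blast
    qed
    then obtain \<xi> where "\<xi> \<in> frequency_box (0 :: int ^ 'd)" by blast
    from assms(4)[OF this] have "0 \<le> \<rho>"
      using matrix_entry_norm_le norm_ge_zero by (meson order_trans)
    then show ?thesis by (intro power_mono) auto
  qed
  \<comment> \<open>The weight depends on the level alone, so it factors out of both sums over
    positions.\<close>
  have level: "\<exists>x y. ((\<lambda>k. s p' (j, k)) has_sum x) UNIV \<and> ((\<lambda>k. s p (j, k)) has_sum y) UNIV \<and> y \<le> ?r\<^sup>2 * x" for j
  proof -
    interpret wavelet_level t \<rho> M A M\<omega> j "(2 * pi) ^ CARD('d)"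
      by unfold_locales (use assms in auto)
    let ?w = "2 powr (2 * (- t / 2) * real_of_int (Max (range (\<lambda>i. j $ i))))"
    let ?s = "\<lambda>p k. \<Sum>a\<in>UNIV. (cmod (residual A v (richardson A M\<omega> v p) (j, k) $ a))\<^sup>2"
    have s: "s p (j, k) = ?w * ?s p k" for p k by (simp add: s_def weighted_sq_def)
    obtain x y where xy: "(?s p' has_sum x) UNIV" "(?s p has_sum y) UNIV" "y \<le> \<rho>\<^sup>2 * x"
      using residual_level_decrease[OF v, of p'] unfolding p' by blast
    have "0 \<le> x" using xy(1) by (rule has_sum_nonneg) (simp add: sum_nonneg)
    then have "\<rho>\<^sup>2 * x \<le> ?r\<^sup>2 * x" using \<rho> by (rule mult_right_mono[rotated])
    then have "?w * y \<le> ?w * (?r\<^sup>2 * x)" using xy(3) by (intro mult_left_mono) auto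
    then have "?w * y \<le> ?r\<^sup>2 * (?w * x)" by (simp only: mult.left_commute)
    then show ?thesis unfolding s using has_sum_cmult_right[OF xy(1)] has_sum_cmult_right[OF xy(2)] by blast
  qed
  show "l2_norm (- t / 2) (residual A v (richardson A M\<omega> v p))
    \<le> ennreal ?r * l2_norm (- t / 2) (residual A v (richardson A M\<omega> v (p - 1)))"
  proof (cases "s p' summable_on UNIV")
    case True
    have s0: "0 \<le> s p q" for p q by (simp add: s_def weighted_sq_def sum_nonneg)
    note * = summable_on_levels_le[of "s p" "s p'" "?r\<^sup>2", OF s0 s0 _ True level]
    have "sqrt (infsum (s p) UNIV) \<le> sqrt (?r\<^sup>2 * infsum (s p') UNIV)" using *(2) by simp
    also have "\<dots> = ?r * sqrt (infsum (s p') UNIV)" by (simp add: real_sqrt_mult)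
    finally have "ennreal (sqrt (infsum (s p) UNIV)) \<le> ennreal ?r * ennreal (sqrt (infsum (s p') UNIV))"
      by (subst ennreal_mult[symmetric]) (auto intro: infsum_nonneg s0 ennreal_leI)
    then show ?thesis using True *(1) unfolding l2_norm_def s_def p' by simp
  next
    \<comment> \<open>Here the old residual lies outside the weighted space and its norm is
      infinite, so there is nothing to estimate.\<close>
    case False
    then have "l2_norm (- t / 2) (residual A v (richardson A M\<omega> v (p - 1))) = \<infinity>"
      unfolding l2_norm_def s_def p' by simp
    then show ?thesis by (simp add: ennreal_mult_top)
  qed
qed

end
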